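(* Let $n\ge 3$ and consider the renewal risk model with $n$-order phase-type interclaim times and exponential claim sizes described in the context, with optimal value functions $V_i$. (a) The family $(V_i)_{i=1}^n$ is the minimal nonnegative solution of the system, for $i=1,\dots,n$ and $x\ge 0$, $$W_i(x)=\sup_{D\in\mathscr{U}_{ad}}\mathbb{E}\Big[\int_{0-}^{\tau_1-} e^{-\delta t}\,\mathrm{d}D_t +e^{-\delta\tau_1}W_{\bar{J}_{\tau_1}}(X^D_{\tau_1}) \,\Big|\,J_0=i,\ X^D_{0-}=x\Big],\qquad( * )$$ where $W_{n+1}(x)=\beta e^{-\beta x}\int_0^xe^{\beta y}\sum_{i=1}^n\pi_iW_i(y)\,\mathrm dy$. That is, $(V_i)_{i=1}^n$ solves $( * )$, and every family $(W_i)_{i=1}^n$ of nonnegative measurable functions on $[0,\infty)$ solving $( * )$ satisfies $W_i\ge V_i$ for all $i$. (b) Suppose there are barriers $b_1^*,\dots,b_n^*\in[0,\infty)$ such that, for every $i$ and $x\ge 0$, the supremum in $( * )$ with $W=V$ is attained by the strategy that, prior to $\tau_1$, is the barrier strategy with barrier $b_i^*$ (i.e. $D_0=0$ and $D_t=\max\{0,x+ct-b_i^*\}$ for $0<t\le\tau_1$). Then the phase-wise barrier strategy with barriers $\{b_i^*\}_{i=1}^n$ is optimal for the dividend problem, i.e. it is an admissible strategy $D^*$ with $V_i^{D^*}(x)=V_i(x)$ for all $i\in\{1,\dots,n\}$ and $x\ge 0$.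
   Context: **Model.** Fix $n\ge 3$, $c>0$, $\beta>0$, $\delta>0$, and $\pi_1,\dots,\pi_n\ge0$ with $\sum_{i=1}^n\pi_i=1$. For $i\in\{1,\dots,n\}$ and $j\in\{1,\dots,n+1\}$, $j\ne i$, let $\lambda_{ij}\ge 0$ be transition intensities, and put $\lambda_i=\sum_{j=1,j\ne i}^{n+1}\lambda_{ij}>0$. A continuous-time Markov process $\bar J$ on $\{1,\dots,n+1\}$ has these intensities; $n+1$ is absorbing and all states $1,\dots,n$ (the phases) are transient. The observed phase process $J$ moves like $\bar J$ on $\{1,\dots,n\}$; each time $n+1$ is entered a claim occurs and the process immediately restarts in phase $i$ with probability $\pi_i$, independently of the past. $N_t$ is the number of claims up to time $t$. Claim sizes $Y_1,Y_2,\dots$ are i.i.d. with distribution function $1-e^{-\beta y}$, $y\ge 0$, and independent of $J$. With cumulative dividends $D_t$ and initial capital $x\ge 0$ the surplus is $X_t^D=x+ct-\sum_{k=1}^{N_t}Y_k-D_t$, with ruin time $\tau=\inf\{t: X_t^D<0\}$. **Admissible strategies and value function.** A dividend strategy $D$ is admissible ($D\in\mathscr U_{ad}$) if $D$ is nondecreasing, left-continuous with right limits, $D_0=0$, predictable with respect to the (completed) filtration of the observed claims and phases, and $D_t\le x+ct-\sum_{k=1}^{N_t}Y_k$ for all $t<\tau$. Put $$V_i^D(x)=\mathbb E\Big[\int_{0-}^{\tau-}e^{-\delta t}\,\mathrm dD_t\,\Big|\,J_0=i,\ X_{0-}^D=x\Big],\qquad V_i(x)=\sup_{D\in\mathscr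 U_{ad}}V_i^D(x),\quad x\ge 0,$$ where the integral includes the lump sum $D_{0+}-D_0$ and excludes any payment at or after $\tau$. **First jump.** $\tau_1=\inf\{t\ge 0:\bar J_t\ne J_0\}$ is the time of the first jump of the phase process (entrance into $n+1$, i.e. a claim, counts as a jump). In $( * )$, $X^D_{\tau_1}$ denotes $x+c\tau_1-D_{\tau_1}$, the surplus before deducting any claim occurring at $\tau_1$ (the claim and the restart are accounted for by $W_{n+1}$), and the integral includes the lump sum $D_{0+}-D_0$ and excludes any payment made at $\tau_1$ or later. **Phase-wise barrier strategy.** For $b=(b_1,\dots,b_n)\in[0,\infty)^n$, the phase-wise barrier strategy with barriers $b$ is: whenever the current phase is $i$, all capital above $b_i$ is immediately paid as dividend; while the surplus equals $b_i$ in phase $i$ all incoming premium is paid as dividend (at rate $c$) until the next jump of the phase process; while the surplus is below $b_i$ no dividend is paid; nothing is paid after ruin.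
   Formalization: The budget bound on dividends is required at every time by which no claim has made the surplus negative, so dividends cannot cause ruin; read literally with τ=inf{t: X_t<0} the bound is vacuous, and overpaying before the first jump would make the supremum in ( * ) infinite. *)

theory Defs
  imports "HOL-Probability.Probability"
begin

(* The phases 1..n are the elements of a finite type 'n, so n = CARD('n).  States of the absorbing
   process are of type 'n option: Some j is phase j, None is the absorbing state n+1 (a claim).
   intensity m i (Some i) is meaningless and never used. *)

record 'n risk_model =
  premium :: real
  claim_rate :: real
  discount :: real
  restart :: "'n pmf"
  intensity :: "'n \<Rightarrow> 'n option \<Rightarrow> real"

definition exit_rate :: "('n::finite) risk_model \<Rightarrow> 'n \<Rightarrow> real" where
  "exit_rate m i = (\<Sum>j\<in>UNIV - {Some i}. intensity m i j)"

definition jump_pmf :: "('n::finite) risk_model \<Rightarrow> 'n \<Rightarrow> 'n option pmf" where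
  "jump_pmf m i = embed_pmf (\<lambda>j. if j = Some i then 0 else intensity m i j / exit_rate m i)"


section \<open>The probability space\<close>

(* Jump chain / holding time construction.  The k-th entry of the sample path drives the (k+1)-st
   jump: a unit exponential (to be divided by the exit rate of the current phase), the target of
   the jump for each phase the process may currently be in, the phase in which the process restarts
   if the target is None, and the claim size paid in that case.  The claim sizes that are actually
   used are then i.i.d. and independent of the phases. *)

type_synonym 'n driver = "real \<times> ('n \<Rightarrow> 'n option) \<times> 'n \<times> real"

definition unit_time :: "'n driver \<Rightarrow> real" where
  "unit_time = (\<lambda>(e, g, r, y). e)"

definition target :: "'n driver \<Rightarrow> 'n \<Rightarrow> 'n option" where
  "target = (\<lambda>(e, g, r, y). g)"

definition restart_phase :: "'n driver \<Rightarrow> 'n" where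
  "restart_phase = (\<lambda>(e, g, r, y). r)"

definition claim_size :: "'n driver \<Rightarrow> real" where
  "claim_size = (\<lambda>(e, g, r, y). y)"

definition exp_measure :: "real \<Rightarrow> real measure" where
  "exp_measure l = density lborel (\<lambda>y. ennreal (exponential_density l y))"

definition driver_measure :: "('n::finite) risk_model \<Rightarrow> 'n driver measure" where
  "driver_measure m =
     exp_measure 1 \<Otimes>\<^sub>M measure_pmf (Pi_pmf UNIV None (jump_pmf m)) \<Otimes>\<^sub>M
     measure_pmf (restart m) \<Otimes>\<^sub>M exp_measure (claim_rate m)"

definition path_measure :: "('n::finite) risk_model \<Rightarrow> 'n driver stream measure" where
  "path_measure m = completion (stream_space (driver_measure m))"


section \<open>Phases, claims and observations\<close>

(* In all that follows, i is the initial phase J_0. *)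

primrec absorbing_chain :: "'n \<Rightarrow> 'n driver stream \<Rightarrow> nat \<Rightarrow> 'n option" where
  "absorbing_chain i \<omega> 0 = Some i"
| "absorbing_chain i \<omega> (Suc k) =
     (case absorbing_chain i \<omega> k of None \<Rightarrow> None | Some j \<Rightarrow> target (\<omega> !! k) j)"

definition transient :: "('n::finite) risk_model \<Rightarrow> 'n \<Rightarrow> bool" where
  "transient m i \<longleftrightarrow>
     measure (path_measure m)
       {\<omega> \<in> space (path_measure m). \<exists>k>0. absorbing_chain i \<omega> k = Some i} < 1"

primrec phase_chain :: "'n \<Rightarrow> 'n driver stream \<Rightarrow> nat \<Rightarrow> 'n" where
  "phase_chain i \<omega> 0 = i"
| "phase_chain i \<omega> (Suc k) =
     (case target (\<omega> !! k) (phase_chain i \<omega> k) of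
        None \<Rightarrow> restart_phase (\<omega> !! k) | Some j \<Rightarrow> j)"

(* Jumps are numbered from 1; claim_jump i \<omega> k and claim_at i \<omega> k belong to jump k + 1. *)

definition claim_jump :: "'n \<Rightarrow> 'n driver stream \<Rightarrow> nat \<Rightarrow> bool" where
  "claim_jump i \<omega> k \<longleftrightarrow> target (\<omega> !! k) (phase_chain i \<omega> k) = None"

definition claim_at :: "'n \<Rightarrow> 'n driver stream \<Rightarrow> nat \<Rightarrow> real" where
  "claim_at i \<omega> k = (if claim_jump i \<omega> k then claim_size (\<omega> !! k) else 0)"

definition jump_time :: "('n::finite) risk_model \<Rightarrow> 'n \<Rightarrow> 'n driver stream \<Rightarrow> nat \<Rightarrow> real" where
  "jump_time m i \<omega> k = (\<Sum>l<k. unit_time (\<omega> !! l) / exit_rate m (phase_chain i \<omega> l))"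

definition num_jumps :: "('n::finite) risk_model \<Rightarrow> 'n \<Rightarrow> real \<Rightarrow> 'n driver stream \<Rightarrow> nat" where
  "num_jumps m i t \<omega> = card {k. 0 < k \<and> jump_time m i \<omega> k \<le> t}"

definition phase_at :: "('n::finite) risk_model \<Rightarrow> 'n \<Rightarrow> real \<Rightarrow> 'n driver stream \<Rightarrow> 'n" where
  "phase_at m i t \<omega> = phase_chain i \<omega> (num_jumps m i t \<omega>)"

definition num_claims :: "('n::finite) risk_model \<Rightarrow> 'n \<Rightarrow> real \<Rightarrow> 'n driver stream \<Rightarrow> nat" where
  "num_claims m i t \<omega> = card {k. k < num_jumps m i t \<omega> \<and> claim_jump i \<omega> k}"

definition total_claims :: "('n::finite) risk_model \<Rightarrow> 'n \<Rightarrow> real \<Rightarrow> 'n driver stream \<Rightarrow> real" where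
  "total_claims m i t \<omega> = (\<Sum>k<num_jumps m i t \<omega>. claim_at i \<omega> k)"

definition observation ::
    "('n::finite) risk_model \<Rightarrow> 'n \<Rightarrow> real \<Rightarrow> 'n driver stream \<Rightarrow> 'n \<times> nat \<times> real" where
  "observation m i t \<omega> = (phase_at m i t \<omega>, num_claims m i t \<omega>, total_claims m i t \<omega>)"

(* Completed natural filtration; null_sets of a completed measure contains all subsets of null
   sets. *)

definition obs_filtration ::
    "('n::finite) risk_model \<Rightarrow> 'n \<Rightarrow> real \<Rightarrow> 'n driver stream measure" where
  "obs_filtration m i t = sigma (space (path_measure m))
     ({observation m i u -` A \<inter> space (path_measure m) | u A.
         0 \<le> u \<and> u \<le> t \<and> A \<in> sets (count_space UNIV \<Otimes>\<^sub>M count_space UNIV \<Otimes>\<^sub>M borel)}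
      \<union> null_sets (path_measure m))"

definition predictable_sigma ::
    "('n::finite) risk_model \<Rightarrow> 'n \<Rightarrow> (real \<times> 'n driver stream) measure" where
  "predictable_sigma m i = sigma ({0..} \<times> space (path_measure m))
     ({{0} \<times> A | A. A \<in> sets (obs_filtration m i 0)}
      \<union> {{s<..t} \<times> A | s t A. 0 \<le> s \<and> s < t \<and> A \<in> sets (obs_filtration m i s)})"


section \<open>Dividend strategies\<close>

type_synonym 'n strategy = "real \<Rightarrow> 'n driver stream \<Rightarrow> real"

definition surplus ::
    "('n::finite) risk_model \<Rightarrow> 'n \<Rightarrow> real \<Rightarrow> 'n strategy \<Rightarrow> real \<Rightarrow> 'n driver stream \<Rightarrow> real" where
  "surplus m i x D t \<omega> = x + premium m * t - total_claims m i t \<omega> - D t \<omega>"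

definition ruin_time ::
    "('n::finite) risk_model \<Rightarrow> 'n \<Rightarrow> real \<Rightarrow> 'n strategy \<Rightarrow> 'n driver stream \<Rightarrow> ereal" where
  "ruin_time m i x D \<omega> = Inf {ereal t | t. 0 \<le> t \<and> surplus m i x D t \<omega> < 0}"

(* Path properties are required almost surely.  Right limits exist by monotonicity.
   The last clause is the budget constraint D_t \<le> x + c t - (claims up to t) for all t before ruin.
   Ruin must there mean a claim exceeding the surplus: with the first time at which the surplus is
   negative the constraint would be empty, as a dividend payment beyond the surplus would itself
   produce that time.  Under the clause both notions of ruin time coincide. *)

definition admissible ::
    "('n::finite) risk_model \<Rightarrow> 'n \<Rightarrow> real \<Rightarrow> 'n strategy \<Rightarrow> bool" where
  "admissible m i x D \<longleftrightarrow>
     (\<lambda>(t, \<omega>). D t \<omega>) \<in> predictable_sigma m i \<rightarrow>\<^sub>M borel \<and>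
     (AE \<omega> in path_measure m.
        D 0 \<omega> = 0 \<and>
        mono_on {0..} (\<lambda>t. D t \<omega>) \<and>
        (\<forall>t>0. continuous (at_left t) (\<lambda>s. D s \<omega>)) \<and>
        (\<forall>t\<ge>0. (\<forall>k. claim_jump i \<omega> k \<and> jump_time m i \<omega> (Suc k) \<le> t \<longrightarrow>
                     0 \<le> surplus m i x D (jump_time m i \<omega> (Suc k)) \<omega>) \<longrightarrow>
               D t \<omega> \<le> x + premium m * t - total_claims m i t \<omega>))"

(* The Stieltjes measure dD on [0,\<infinity>), obtained from the right-continuous version of D extended by 0
   to negative times, so that it has the atom D_{0+} - D_0 at 0. *)

definition dividend_measure :: "'n strategy \<Rightarrow> 'n driver stream \<Rightarrow> real measure" where
  "dividend_measure D \<omega> =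
     interval_measure (\<lambda>t. if t < 0 then 0 else Lim (at_right t) (\<lambda>s. D s \<omega>))"

definition discounted_dividends ::
    "('n::finite) risk_model \<Rightarrow> 'n strategy \<Rightarrow> ereal \<Rightarrow> 'n driver stream \<Rightarrow> ennreal" where
  "discounted_dividends m D T \<omega> =
     (\<integral>\<^sup>+ t \<in> {t. 0 \<le> t \<and> ereal t < T}. ennreal (exp (- discount m * t)) \<partial>dividend_measure D \<omega>)"

definition strategy_value ::
    "('n::finite) risk_model \<Rightarrow> 'n \<Rightarrow> real \<Rightarrow> 'n strategy \<Rightarrow> ennreal" where
  "strategy_value m i x D =
     (\<integral>\<^sup>+ \<omega>. discounted_dividends m D (ruin_time m i x D \<omega>) \<omega> \<partial>path_measure m)"

definition optimal_value :: "('n::finite) risk_model \<Rightarrow> 'n \<Rightarrow> real \<Rightarrow> ennreal" where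
  "optimal_value m i x = (SUP D\<in>{D. admissible m i x D}. strategy_value m i x D)"


section \<open>The first-jump equation\<close>

(* Nonnegative functions on [0,\<infinity>) are represented with values in ennreal; their values at negative
   arguments are irrelevant.  with_absorbing m W adds the component W_{n+1}. *)

definition with_absorbing ::
    "('n::finite) risk_model \<Rightarrow> ('n \<Rightarrow> real \<Rightarrow> ennreal) \<Rightarrow> 'n option \<Rightarrow> real \<Rightarrow> ennreal" where
  "with_absorbing m W j x =
     (case j of
        Some i \<Rightarrow> W i x
      | None \<Rightarrow> ennreal (claim_rate m * exp (- claim_rate m * x)) *
          (\<integral>\<^sup>+ y \<in> {0..x}. ennreal (exp (claim_rate m * y)) *
             (\<Sum>i\<in>UNIV. ennreal (pmf (restart m) i) * W i y) \<partial>lborel))"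

definition first_jump_value ::
    "('n::finite) risk_model \<Rightarrow> ('n \<Rightarrow> real \<Rightarrow> ennreal) \<Rightarrow> 'n \<Rightarrow> real \<Rightarrow> 'n strategy \<Rightarrow> ennreal" where
  "first_jump_value m W i x D =
     (\<integral>\<^sup>+ \<omega>. (let \<tau> = jump_time m i \<omega> 1 in
        discounted_dividends m D (ereal \<tau>) \<omega> +
        ennreal (exp (- discount m * \<tau>)) *
          with_absorbing m W (absorbing_chain i \<omega> 1) (x + premium m * \<tau> - D \<tau> \<omega>))
      \<partial>path_measure m)"

definition first_jump_sup ::
    "('n::finite) risk_model \<Rightarrow> ('n \<Rightarrow> real \<Rightarrow> ennreal) \<Rightarrow> 'n \<Rightarrow> real \<Rightarrow> ennreal" where
  "first_jump_sup m W i x = (SUP D\<in>{D. admissible m i x D}. first_jump_value m W i x D)"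

definition nonneg_solution ::
    "('n::finite) risk_model \<Rightarrow> ('n \<Rightarrow> real \<Rightarrow> ennreal) \<Rightarrow> bool" where
  "nonneg_solution m W \<longleftrightarrow>
     (\<forall>i. W i \<in> borel_measurable (restrict_space borel {0..})) \<and>
     (\<forall>i. \<forall>x\<ge>0. W i x < \<infinity>) \<and>
     (\<forall>i. \<forall>x\<ge>0. W i x = first_jump_sup m W i x)"


section \<open>Barrier strategies\<close>

definition barrier_until_jump ::
    "('n::finite) risk_model \<Rightarrow> real \<Rightarrow> 'n \<Rightarrow> real \<Rightarrow> 'n strategy \<Rightarrow> bool" where
  "barrier_until_jump m b i x D \<longleftrightarrow>
     (AE \<omega> in path_measure m. D 0 \<omega> = 0 \<and>
        (\<forall>t. 0 < t \<and> t \<le> jump_time m i \<omega> 1 \<longrightarrow> D t \<omega> = max 0 (x + premium m * t - b)))"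

(* Dividends paid during the first h > 0 time units after a moment at which the surplus is u, with
   no jump in between and barrier b.  A negative u signals ruin. *)

definition barrier_payment :: "('n::finite) risk_model \<Rightarrow> real \<Rightarrow> real \<Rightarrow> real \<Rightarrow> real" where
  "barrier_payment m b u h = (if u < 0 then 0 else max 0 (u + premium m * h - b))"

(* Surplus immediately after the k-th jump (frozen from ruin on), and dividends paid before it. *)

primrec barrier_state ::
    "('n::finite) risk_model \<Rightarrow> ('n \<Rightarrow> real) \<Rightarrow> 'n \<Rightarrow> real \<Rightarrow> 'n driver stream \<Rightarrow> nat \<Rightarrow> real \<times> real" where
  "barrier_state m b i x \<omega> 0 = (x, 0)"
| "barrier_state m b i x \<omega> (Suc k) =
     (let (u, d) = barrier_state m b i x \<omega> k;
          h = jump_time m i \<omega> (Suc k) - jump_time m i \<omega> k;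
          a = barrier_payment m (b (phase_chain i \<omega> k)) u h
      in if u < 0 then (u, d) else (u + premium m * h - a - claim_at i \<omega> k, d + a))"

(* D is left-continuous: a payment triggered by a jump at time s, or at time 0, shows in D_t for
   t > s only.  Hence k counts the jumps strictly before t. *)

definition phasewise_barrier ::
    "('n::finite) risk_model \<Rightarrow> ('n \<Rightarrow> real) \<Rightarrow> 'n \<Rightarrow> real \<Rightarrow> 'n strategy" where
  "phasewise_barrier m b i x t \<omega> =
     (if t \<le> 0 then 0
      else let k = card {k. 0 < k \<and> jump_time m i \<omega> k < t};
               (u, d) = barrier_state m b i x \<omega> k
           in d + barrier_payment m (b (phase_chain i \<omega> k)) u (t - jump_time m i \<omega> k))"

end

theory Submission
  imports Defs "HOL-Real_Asymp.Real_Asymp"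
begin

text \<open>Every admissible strategy decomposes at the first jump: a predictable process is deterministic up
  to that time, and for almost every outcome of the first jump its continuation is predictable for the
  restarted process.  Hence the value of a strategy, truncated after \<open>n + 1\<close> jumps, is the one-step
  functional of the first-jump equation applied to the values of the continuations truncated after
  \<open>n\<close> jumps.  By induction on \<open>n\<close> every supersolution dominates all strategies.

  Conversely, strategies that are nearly optimal for countably many initial surpluses can be pasted to
  the given one at the first jump, and monotonicity of the value function reduces an arbitrary surplus
  to one of these; so \<open>V\<close> is a solution.

  If the supremum is always attained by barriers, then \<open>n\<close> iterations of the equation show that \<open>V\<close>
  exceeds the value of the phase-wise barrier strategy by at most the discounted value remaining after
  \<open>n\<close> jumps, which decays geometrically because \<open>V\<close> grows at most linearly.\<close>

section \<open>The driving sequence\<close>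

text \<open>The filtration is completed with the null sets of the whole path space, so a section of
  an adapted event at a fixed first driver is adapted only for almost every driver. The
  sigma-algebras are therefore handled through their generators, and exceptional drivers are
  collected over countably many sets or rational levels only.

  Values of continuations depend on the first driver through the strategy itself, and measurability
  of this dependence is not established. Estimates of such values use monotonicity of the
  nonnegative integral and a one-sided form of its additivity.

  Truncation at jumps lets the induction start from the value 0. In the geometric estimate one half
  of the discount rate absorbs the linear growth in the surplus, and the other half gives the
  contraction.\<close>

locale risk_process =
  fixes m :: "('n::finite) risk_model"
  assumes premium_pos: "premium m > 0"
    and claim_rate_pos: "claim_rate m > 0"
    and discount_pos: "discount m > 0"
    and intensity_nonneg: "\<And>i j. j \<noteq> Some i \<Longrightarrow> intensity m i j \<ge> 0"
    and exit_rate_pos: "\<And>i. exit_rate m i > 0"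
begin

abbreviation "DM \<equiv> driver_measure m"
abbreviation "P \<equiv> path_measure m"
abbreviation "S0 \<equiv> stream_space DM"

section \<open>Path space: measurability, null sets and integration through the first driver\<close>

lemma sets_exp_measure [simp, measurable_cong]: "sets (exp_measure l) = sets borel"
  by (simp add: exp_measure_def)

lemma space_exp_measure [simp]: "space (exp_measure l) = UNIV"
  by (simp add: exp_measure_def)

lemma prob_space_exp_measure: "l > 0 \<Longrightarrow> prob_space (exp_measure l)"
  unfolding exp_measure_def by (rule prob_space_exponential_density)

lemma space_DM [simp]: "space DM = UNIV"
  by (simp add: driver_measure_def space_pair_measure)

lemma space_S0 [simp]: "space S0 = UNIV"
  by (simp add: space_stream_space)

lemma space_P [simp]: "space P = UNIV"
  by (simp add: path_measure_def)

lemma prob_space_DM: "prob_space DM"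
  unfolding driver_measure_def
  by (intro prob_space_pair prob_space_measure_pmf prob_space_exp_measure claim_rate_pos) simp

sublocale DM: prob_space DM by (rule prob_space_DM)
sublocale S0: prob_space S0 by (rule DM.prob_space_stream_space)

sublocale P: prob_space P
proof
  show "emeasure P (space P) = 1"
    using S0.emeasure_space_1 by (simp add: path_measure_def del: space_S0)
qed

lemma measurable_unit_time [measurable]: "unit_time \<in> borel_measurable DM"
  unfolding unit_time_def driver_measure_def by measurable

lemma measurable_claim_size [measurable]: "claim_size \<in> borel_measurable DM"
  unfolding claim_size_def driver_measure_def by measurable

lemma measurable_target [measurable]: "target \<in> DM \<rightarrow>\<^sub>M count_space UNIV"
proof -
  have "(\<lambda>(e, g, r, y). g) \<in> DM \<rightarrow>\<^sub>M measure_pmf (Pi_pmf UNIV None (jump_pmf m))"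
    unfolding driver_measure_def by measurable
  then show ?thesis by (simp add: target_def)
qed

lemma measurable_restart_phase [measurable]: "restart_phase \<in> DM \<rightarrow>\<^sub>M count_space UNIV"
proof -
  have "(\<lambda>(e, g, r, y). r) \<in> DM \<rightarrow>\<^sub>M measure_pmf (restart m)"
    unfolding driver_measure_def by measurable
  then show ?thesis by (simp add: restart_phase_def)
qed

lemma measurable_P_S0: "f \<in> S0 \<rightarrow>\<^sub>M N \<Longrightarrow> f \<in> P \<rightarrow>\<^sub>M N"
  unfolding path_measure_def by (rule measurable_completion)

lemma AE_P_iff: "(AE \<omega> in P. Q \<omega>) \<longleftrightarrow> (AE \<omega> in S0. Q \<omega>)"
  unfolding path_measure_def by (rule AE_completion_iff)

lemma nn_integral_P: "(\<integral>\<^sup>+ \<omega>. f \<omega> \<partial>P) = (\<integral>\<^sup>+ \<omega>. f \<omega> \<partial>S0)"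
  unfolding path_measure_def by (rule nn_integral_completion)

text \<open>The exceptional set is covered by a null set of the uncompleted space, to which the
  product structure of \<open>stream_space\<close> applies; almost every section of the cover is
  null.\<close>

lemma AE_P_Stream:
  assumes "AE \<omega> in P. Q \<omega>"
  shows "AE d in DM. AE \<omega> in P. Q (d ## \<omega>)"
proof -
  from assms[unfolded AE_P_iff] obtain N where N: "N \<in> null_sets S0" "{\<omega>. \<not> Q \<omega>} \<subseteq> N"
    unfolding eventually_ae_filter by auto
  then have [measurable]: "N \<in> sets S0" by auto
  have "AE \<omega> in S0. \<omega> \<notin> N" using N by (simp add: AE_not_in)
  then have "AE d in DM. AE \<omega> in S0. d ## \<omega> \<notin> N"
    by (subst (asm) DM.AE_stream_space) simp_all
  then show ?thesis
    unfolding AE_P_iff by eventually_elim (use N in \<open>auto elim!: eventually_mono\<close>)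
qed

lemma AE_P_shd:
  assumes "AE d in DM. Q d"
  shows "AE \<omega> in P. Q (shd \<omega>)"
proof -
  from assms obtain N where N: "N \<in> null_sets DM" "{d. \<not> Q d} \<subseteq> N"
    unfolding eventually_ae_filter by auto
  then have [measurable]: "N \<in> sets DM" by auto
  have "AE d in DM. AE \<omega> in S0. shd (d ## \<omega>) \<notin> N"
    using AE_not_in[OF N(1)] by simp
  then have "AE \<omega> in S0. shd \<omega> \<notin> N"
    by (subst DM.AE_stream_space) simp_all
  then show ?thesis unfolding AE_P_iff by eventually_elim (use N in auto)
qed

lemma AE_P_stl:
  assumes "AE \<omega> in P. Q \<omega>"
  shows "AE \<omega> in P. Q (stl \<omega>)"
proof -
  from assms[unfolded AE_P_iff] obtain N where N: "N \<in> null_sets S0" "{d. \<not> Q d} \<subseteq> N"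
    unfolding eventually_ae_filter by auto
  then have [measurable]: "N \<in> sets S0" by auto
  have "AE d in DM. AE \<omega> in S0. stl (d ## \<omega>) \<notin> N"
    using AE_not_in[OF N(1)] by simp
  then have "AE \<omega> in S0. stl \<omega> \<notin> N"
    by (subst DM.AE_stream_space) simp_all
  then show ?thesis unfolding AE_P_iff by eventually_elim (use N in auto)
qed

text \<open>Not automatic for a completion: the preimage of a negligible set under
  \<open>stl\<close> has to be negligible again, which holds because the law of the stream is shift
  invariant (\<open>AE_P_stl\<close>).\<close>

lemma measurable_stl_P: "stl \<in> P \<rightarrow>\<^sub>M P"
proof (rule measurableI)
  fix A assume "A \<in> sets P"
  then obtain S N N' where S: "A = S \<union> N" "N \<subseteq> N'" "N' \<in> null_sets S0" "S \<in> sets S0"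
    unfolding path_measure_def by (rule sets_completionE)
  have "AE \<omega> in P. stl \<omega> \<notin> N'"
    by (rule AE_P_stl) (use AE_not_in[OF S(3)] in \<open>simp add: AE_P_iff\<close>)
  then have "AE \<omega> in P. \<not> stl \<omega> \<in> N" by eventually_elim (use S in auto)
  then have "AE \<omega> in S0. \<not> stl \<omega> \<in> N" by (simp add: AE_P_iff)
  from sets_completion_AE[OF this] have 1: "stl -` N \<inter> space P \<in> sets P"
    by (simp add: pred_def path_measure_def vimage_def)
  have "stl -` S \<inter> space S0 \<in> sets S0" using S(4) by (rule measurable_sets[OF measurable_stl])
  then have "stl -` S \<inter> space P \<in> sets P" by (simp add: path_measure_def)
  with 1 have "(stl -` S \<inter> space P) \<union> (stl -` N \<inter> space P) \<in> sets P" by (rule sets.Un[rotated])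
  also have "(stl -` S \<inter> space P) \<union> (stl -` N \<inter> space P) = stl -` A \<inter> space P" using S by auto
  finally show "stl -` A \<inter> space P \<in> sets P" .
qed simp

lemma sets_P_AE:
  assumes "A \<in> sets P" "AE \<omega> in P. \<omega> \<in> A \<longleftrightarrow> \<omega> \<in> B"
  shows "B \<in> sets P"
proof -
  have "AE \<omega> in S0. \<not> (\<omega> \<in> A - B)" "AE \<omega> in S0. \<not> (\<omega> \<in> B - A)"
    using assms(2) by (auto simp: AE_P_iff elim!: eventually_mono)
  from this[THEN sets_completion_AE] have "A - B \<in> sets P" "B - A \<in> sets P"
    by (simp_all add: pred_def path_measure_def set_diff_eq)
  with assms(1) have "(A - (A - B)) \<union> (B - A) \<in> sets P" by blast
  also have "(A - (A - B)) \<union> (B - A) = B" by auto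
  finally show ?thesis .
qed

lemma null_sets_P_iff: "N \<in> null_sets P \<longleftrightarrow> (AE \<omega> in P. \<omega> \<notin> N)"
proof
  assume "AE \<omega> in P. \<omega> \<notin> N"
  then have "AE \<omega> in P. \<omega> \<in> {} \<longleftrightarrow> \<omega> \<in> N" by simp
  from sets_P_AE[OF _ this] have "N \<in> sets P" by simp
  with \<open>AE \<omega> in P. \<omega> \<notin> N\<close> show "N \<in> null_sets P"
    by (simp add: AE_iff_null_sets)
qed (rule AE_not_in)

text \<open>Fubini for the completed space: \<open>F\<close> is replaced by an almost surely equal
  function that is measurable before completion, and the sections of the two agree almost surely for
  almost every first driver.\<close>

lemma nn_integral_P_Stream:
  assumes "F \<in> borel_measurable P"
  shows "(\<integral>\<^sup>+ \<omega>. F \<omega> \<partial>P) = (\<integral>\<^sup>+ d. (\<integral>\<^sup>+ \<omega>. F (d ## \<omega>) \<partial>P) \<partial>DM)"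
proof -
  from completion_ex_borel_measurable[OF assms[unfolded path_measure_def]]
  obtain G where [measurable]: "G \<in> borel_measurable S0" and G: "AE \<omega> in S0. F \<omega> = G \<omega>" by auto
  have "(\<integral>\<^sup>+ \<omega>. F \<omega> \<partial>P) = (\<integral>\<^sup>+ \<omega>. G \<omega> \<partial>S0)"
    unfolding nn_integral_P using G by (rule nn_integral_cong_AE)
  also have "\<dots> = (\<integral>\<^sup>+ d. (\<integral>\<^sup>+ \<omega>. G (d ## \<omega>) \<partial>S0) \<partial>DM)"
    by (rule DM.nn_integral_stream_space) simp
  also have "\<dots> = (\<integral>\<^sup>+ d. (\<integral>\<^sup>+ \<omega>. F (d ## \<omega>) \<partial>P) \<partial>DM)"
  proof (rule nn_integral_cong_AE)
    from G have "AE d in DM. AE \<omega> in P. F (d ## \<omega>) = G (d ## \<omega>)"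
      by (intro AE_P_Stream) (simp add: AE_P_iff)
    then show "AE d in DM. (\<integral>\<^sup>+ \<omega>. G (d ## \<omega>) \<partial>S0) = (\<integral>\<^sup>+ \<omega>. F (d ## \<omega>) \<partial>P)"
    proof eventually_elim
      case (elim d)
      then show ?case unfolding nn_integral_P AE_P_iff by (intro nn_integral_cong_AE) auto
    qed
  qed
  finally show ?thesis .
qed

lemma nn_integral_P_shd:
  assumes [measurable]: "G \<in> borel_measurable DM"
  shows "(\<integral>\<^sup>+ \<omega>. G (shd \<omega>) \<partial>P) = (\<integral>\<^sup>+ d. G d \<partial>DM)"
proof -
  have "(\<integral>\<^sup>+ \<omega>. G (shd \<omega>) \<partial>P) = (\<integral>\<^sup>+ d. (\<integral>\<^sup>+ \<omega>. G (shd (d ## \<omega>)) \<partial>S0) \<partial>DM)"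
    unfolding nn_integral_P by (rule DM.nn_integral_stream_space) simp
  then show ?thesis using S0.emeasure_space_1 by simp
qed

section \<open>Data of the first jump and the process restarted after it\<close>

definition hold :: "'n \<Rightarrow> 'n driver \<Rightarrow> real" where
  "hold i d = unit_time d / exit_rate m i"

definition succ_phase :: "'n \<Rightarrow> 'n driver \<Rightarrow> 'n" where
  "succ_phase i d = (case target d i of None \<Rightarrow> restart_phase d | Some j \<Rightarrow> j)"

definition loss :: "'n \<Rightarrow> 'n driver \<Rightarrow> real" where
  "loss i d = (if target d i = None then claim_size d else 0)"

lemma phase_chain_Stream: "phase_chain i (d ## \<omega>) (Suc k) = phase_chain (succ_phase i d) \<omega> k"
  by (induction k) (simp_all add: succ_phase_def split: option.split)

lemma claim_jump_Stream:
  "claim_jump i (d ## \<omega>) 0 \<longleftrightarrow> target d i = None"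
  "claim_jump i (d ## \<omega>) (Suc k) \<longleftrightarrow> claim_jump (succ_phase i d) \<omega> k"
  by (simp_all add: claim_jump_def phase_chain_Stream del: phase_chain.simps(2))

lemma claim_at_Stream:
  "claim_at i (d ## \<omega>) 0 = loss i d"
  "claim_at i (d ## \<omega>) (Suc k) = claim_at (succ_phase i d) \<omega> k"
  by (simp_all add: claim_at_def claim_jump_Stream loss_def)

lemma jump_time_0 [simp]: "jump_time m i \<omega> 0 = 0"
  by (simp add: jump_time_def)

lemma jump_time_Stream:
  "jump_time m i (d ## \<omega>) (Suc k) = hold i d + jump_time m (succ_phase i d) \<omega> k"
  unfolding jump_time_def
  by (simp add: sum.lessThan_Suc_shift phase_chain_Stream hold_def del: phase_chain.simps(2) sum.lessThan_Suc)

lemma jump_time_1: "jump_time m i \<omega> (Suc 0) = hold i (shd \<omega>)"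
  by (simp add: jump_time_def hold_def)

lemma measurable_target_apply [measurable]: "(\<lambda>d. target d i) \<in> DM \<rightarrow>\<^sub>M count_space UNIV"
  using measurable_compose[OF measurable_target, of "\<lambda>g. g i"] by simp

lemma measurable_succ_phase [measurable]: "succ_phase i \<in> DM \<rightarrow>\<^sub>M count_space UNIV"
proof -
  have "(\<lambda>d. (\<lambda>a d. case a of None \<Rightarrow> restart_phase d | Some j \<Rightarrow> j) (target d i) d) \<in> DM \<rightarrow>\<^sub>M count_space UNIV"
    by (rule measurable_compose_countable'[OF _ measurable_target_apply]) (auto split: option.split)
  then show ?thesis by (simp add: succ_phase_def[abs_def])
qed

lemma measurable_hold [measurable]: "hold i \<in> borel_measurable DM"
  unfolding hold_def by measurable

lemma measurable_loss [measurable]: "loss i \<in> borel_measurable DM"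
  unfolding loss_def by measurable

lemma measurable_phase_chain [measurable]: "(\<lambda>\<omega>. phase_chain i \<omega> k) \<in> S0 \<rightarrow>\<^sub>M count_space UNIV"
proof (induction k)
  case (Suc k)
  note [measurable] = Suc
  have [measurable]: "Measurable.pred S0 (\<lambda>\<omega>. phase_chain i \<omega> k = j)" for j by measurable
  have "(\<lambda>\<omega>. (\<lambda>j \<omega>. succ_phase j (\<omega> !! k)) (phase_chain i \<omega> k) \<omega>) \<in> S0 \<rightarrow>\<^sub>M count_space UNIV"
    by (rule measurable_compose_countable'[OF _ Suc]) auto
  then show ?case by (simp add: succ_phase_def)
qed simp

lemma measurable_claim_jump [measurable]: "Measurable.pred S0 (\<lambda>\<omega>. claim_jump i \<omega> k)"
proof -
  have "(\<lambda>\<omega>. (\<lambda>j \<omega>. target (\<omega> !! k) j = None) (phase_chain i \<omega> k) \<omega>) \<in> S0 \<rightarrow>\<^sub>M count_space UNIV"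
    by (rule measurable_compose_countable'[OF _ measurable_phase_chain]) auto
  then show ?thesis by (simp add: claim_jump_def)
qed

lemma measurable_claim_at [measurable]: "(\<lambda>\<omega>. claim_at i \<omega> k) \<in> borel_measurable S0"
  unfolding claim_at_def by measurable

lemma measurable_jump_time [measurable]: "(\<lambda>\<omega>. jump_time m i \<omega> k) \<in> borel_measurable S0"
proof -
  have "(\<lambda>\<omega>. (\<lambda>j \<omega>. unit_time (\<omega> !! l) / exit_rate m j) (phase_chain i \<omega> l) \<omega>) \<in> borel_measurable S0" for l
    by (rule measurable_compose_countable'[OF _ measurable_phase_chain]) auto
  then show ?thesis unfolding jump_time_def by simp
qed

text \<open>Excluding jumps from a phase to itself makes every jump visible in the observation. A
  claim of size 0 is allowed, since claims are also counted.\<close>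

definition good_driver :: "'n driver \<Rightarrow> bool" where
  "good_driver d \<longleftrightarrow> 0 < unit_time d \<and> (\<forall>i. target d i \<noteq> Some i) \<and> 0 \<le> claim_size d"

text \<open>Non-explosion is demanded from every initial phase, so that goodness survives prepending
  a driver, whatever the phase in which the restarted process begins.\<close>

definition good :: "'n driver stream \<Rightarrow> bool" where
  "good \<omega> \<longleftrightarrow> (\<forall>k. good_driver (\<omega> !! k)) \<and> (\<forall>i t. \<exists>k. t < jump_time m i \<omega> k)"

section \<open>Jump times\<close>

lemma nn_integral_DM:
  assumes [measurable]: "f \<in> borel_measurable DM"
  shows "(\<integral>\<^sup>+ d. f d \<partial>DM) = (\<integral>\<^sup>+ e. \<integral>\<^sup>+ g. \<integral>\<^sup>+ r. \<integral>\<^sup>+ y. f (e, g, r, y)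
    \<partial>exp_measure (claim_rate m) \<partial>measure_pmf (restart m)
    \<partial>measure_pmf (Pi_pmf UNIV None (jump_pmf m)) \<partial>exp_measure 1)"
proof -
  let ?E = "exp_measure (claim_rate m)" and ?R = "measure_pmf (restart m)"
    and ?G = "measure_pmf (Pi_pmf UNIV None (jump_pmf m))"
  interpret E: prob_space ?E by (rule prob_space_exp_measure[OF claim_rate_pos])
  interpret RE: prob_space "?R \<Otimes>\<^sub>M ?E" by (intro prob_space_pair prob_space_measure_pmf) unfold_locales
  interpret GRE: prob_space "?G \<Otimes>\<^sub>M ?R \<Otimes>\<^sub>M ?E" by (intro prob_space_pair prob_space_measure_pmf) unfold_locales
  have f [measurable]: "f \<in> borel_measurable (exp_measure 1 \<Otimes>\<^sub>M ?G \<Otimes>\<^sub>M ?R \<Otimes>\<^sub>M ?E)"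
    using assms by (simp add: driver_measure_def)
  have "(\<integral>\<^sup>+ d. f d \<partial>DM) = (\<integral>\<^sup>+ e. \<integral>\<^sup>+ p. f (e, p) \<partial>(?G \<Otimes>\<^sub>M ?R \<Otimes>\<^sub>M ?E) \<partial>exp_measure 1)"
    unfolding driver_measure_def by (rule GRE.nn_integral_fst[symmetric]) (rule f)
  also have "\<dots> = (\<integral>\<^sup>+ e. \<integral>\<^sup>+ g. \<integral>\<^sup>+ p. f (e, g, p) \<partial>(?R \<Otimes>\<^sub>M ?E) \<partial>?G \<partial>exp_measure 1)"
    by (intro nn_integral_cong RE.nn_integral_fst[symmetric] measurable_compose[OF measurable_Pair1' f]) simp
  also have "\<dots> = (\<integral>\<^sup>+ e. \<integral>\<^sup>+ g. \<integral>\<^sup>+ r. \<integral>\<^sup>+ y. f (e, g, r, y) \<partial>?E \<partial>?R \<partial>?G \<partial>exp_measure 1)"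
    by (intro nn_integral_cong E.nn_integral_fst[symmetric]
      measurable_compose[OF measurable_Pair1' measurable_compose[OF measurable_Pair1' f]]) simp_all
  finally show ?thesis .
qed

lemma pmf_jump_pmf: "pmf (jump_pmf m i) j = (if j = Some i then 0 else intensity m i j / exit_rate m i)"
  unfolding jump_pmf_def
proof (rule pmf_embed_pmf)
  show nn: "0 \<le> (if x = Some i then 0 else intensity m i x / exit_rate m i)" for x
    using intensity_nonneg exit_rate_pos[of i] by (simp add: less_imp_le)
  have "(\<integral>\<^sup>+ x. ennreal (if x = Some i then 0 else intensity m i x / exit_rate m i) \<partial>count_space UNIV)
    = ennreal (\<Sum>x\<in>UNIV. if x = Some i then 0 else intensity m i x / exit_rate m i)"
    using nn by (simp add: nn_integral_count_space_finite sum_ennreal)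
  also have "(\<Sum>x\<in>UNIV. if x = Some i then 0 else intensity m i x / exit_rate m i)
     = (\<Sum>x\<in>UNIV - {Some i}. intensity m i x / exit_rate m i)"
    by (intro sum.mono_neutral_cong_right) auto
  also have "\<dots> = 1" using exit_rate_pos[of i] by (simp add: exit_rate_def flip: sum_divide_distrib)
  finally show "(\<integral>\<^sup>+ x. ennreal (if x = Some i then 0 else intensity m i x / exit_rate m i) \<partial>count_space UNIV) = 1"
    by simp
qed

lemma AE_good_driver: "AE d in DM. good_driver d"
proof -
  let ?E = "exp_measure (claim_rate m)" and ?R = "measure_pmf (restart m)"
    and ?G = "measure_pmf (Pi_pmf UNIV None (jump_pmf m))"
  interpret E1: prob_space "exp_measure 1" by (rule prob_space_exp_measure) simp
  interpret E: prob_space ?E by (rule prob_space_exp_measure[OF claim_rate_pos])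
  interpret G: prob_space ?G by (rule prob_space_measure_pmf)
  interpret R: prob_space ?R by (rule prob_space_measure_pmf)
  interpret RE: prob_space "?R \<Otimes>\<^sub>M ?E" by (intro prob_space_pair prob_space_measure_pmf) unfold_locales
  interpret GRE: prob_space "?G \<Otimes>\<^sub>M ?R \<Otimes>\<^sub>M ?E" by (intro prob_space_pair prob_space_measure_pmf) unfold_locales
  interpret PA: pair_sigma_finite ?R ?E ..
  interpret PB: pair_sigma_finite ?G "?R \<Otimes>\<^sub>M ?E" ..
  interpret PC: pair_sigma_finite "exp_measure 1" "?G \<Otimes>\<^sub>M ?R \<Otimes>\<^sub>M ?E" ..
  have E1: "AE e in exp_measure 1. 0 < e"
    using AE_lborel_singleton[of 0] unfolding exp_measure_def
    by (subst AE_density) (auto simp: exponential_density_def elim!: eventually_mono)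
  have E: "AE e in ?E. 0 \<le> e"
    unfolding exp_measure_def
    by (subst AE_density) (auto simp: exponential_density_def)
  define A where "A = {g :: 'n \<Rightarrow> 'n option. \<forall>i. g i \<noteq> Some i}"
  have [measurable]: "A \<in> sets ?G" by simp
  have G: "AE g in ?G. g \<in> A"
    unfolding A_def
  proof (rule AE_pmfI, rule CollectI, rule allI)
    fix g i assume "g \<in> set_pmf (Pi_pmf UNIV None (jump_pmf m))"
    then have "g i \<in> set_pmf (jump_pmf m i)"
      by (subst (asm) set_Pi_pmf) (auto simp: PiE_dflt_def)
    then show "g i \<noteq> Some i" by (auto simp: set_pmf_iff pmf_jump_pmf)
  qed
  have p1: "Measurable.pred (?R \<Otimes>\<^sub>M ?E) (\<lambda>p. 0 \<le> snd p)"
    by (rule measurable_compose[OF measurable_snd, where g = "\<lambda>y. 0 \<le> y"]) simp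
  have p2: "Measurable.pred (?G \<Otimes>\<^sub>M ?R \<Otimes>\<^sub>M ?E) (\<lambda>p. fst p \<in> A \<and> 0 \<le> snd (snd p))"
    by (intro pred_intros_logic measurable_compose[OF measurable_snd p1]
      measurable_compose[OF measurable_fst, where g = "\<lambda>y. y \<in> A"]) simp
  have p3: "Measurable.pred (exp_measure 1 \<Otimes>\<^sub>M ?G \<Otimes>\<^sub>M ?R \<Otimes>\<^sub>M ?E)
      (\<lambda>p. 0 < fst p \<and> fst (snd p) \<in> A \<and> 0 \<le> snd (snd (snd p)))"
    by (intro pred_intros_logic(3) measurable_compose[OF measurable_snd p2]
      measurable_compose[OF measurable_fst, where g = "\<lambda>y. 0 < y"]) simp
  have "AE p in ?R \<Otimes>\<^sub>M ?E. 0 \<le> snd p"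
    using E by (intro PA.AE_pair_measure) auto
  with G have "AE p in ?G \<Otimes>\<^sub>M ?R \<Otimes>\<^sub>M ?E. fst p \<in> A \<and> 0 \<le> snd (snd p)"
    by (intro PB.AE_pair_measure) (use p2 in \<open>simp_all add: pred_def\<close>)
  with E1 have "AE d in DM. 0 < fst d \<and> fst (snd d) \<in> A \<and> 0 \<le> snd (snd (snd d))"
    unfolding driver_measure_def by (intro PC.AE_pair_measure) (use p3 in \<open>simp_all add: pred_def\<close>)
  then show ?thesis
    by eventually_elim (auto simp: A_def good_driver_def unit_time_def target_def claim_size_def)
qed

lemma nn_integral_exp_measure_1:
  assumes "a \<ge> 0"
  shows "(\<integral>\<^sup>+ e. ennreal (exp (- a * e)) \<partial>exp_measure 1) = ennreal (1 / (1 + a))"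
proof -
  have "(\<integral>\<^sup>+ e. ennreal (exp (- a * e)) \<partial>exp_measure 1) =
    (\<integral>\<^sup>+ e. ennreal (exponential_density 1 e) * ennreal (exp (- a * e)) \<partial>lborel)"
    unfolding exp_measure_def by (rule nn_integral_density) auto
  also have "\<dots> = (\<integral>\<^sup>+ e. ennreal (1 / (1 + a)) * ennreal (exponential_density (1 + a) e) \<partial>lborel)"
    using assms by (intro nn_integral_cong)
      (auto simp: exponential_density_def ennreal_mult[symmetric] exp_add[symmetric] field_simps)
  also have "\<dots> = ennreal (1 / (1 + a)) * (\<integral>\<^sup>+ e. ennreal (exponential_density (1 + a) e) \<partial>lborel)"
    by (rule nn_integral_cmult) auto
  also have "(\<integral>\<^sup>+ e. ennreal (exponential_density (1 + a) e) \<partial>lborel) = emeasure (exp_measure (1 + a)) UNIV"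
    unfolding exp_measure_def by (subst emeasure_density) auto
  also have "\<dots> = 1"
    using prob_space.emeasure_space_1[OF prob_space_exp_measure[of "1 + a"]] assms by simp
  finally show ?thesis by simp
qed

text \<open>A holding time in phase \<open>i\<close> has Laplace transform
  \<open>1 / (1 + a / exit_rate m i)\<close> at \<open>a\<close>. There are finitely many phases, so
  the largest of these numbers is still below 1.\<close>

lemma ex_discount_factor:
  assumes "a > 0"
  shows "\<exists>q. 0 \<le> q \<and> q < 1 \<and> (\<forall>i. (\<integral>\<^sup>+ d. ennreal (exp (- a * hold i d)) \<partial>DM) \<le> ennreal q)"
proof (intro exI conjI allI)
  let ?q = "MAX i. 1 / (1 + a / exit_rate m i)"
  have pos: "0 < 1 / (1 + a / exit_rate m i)" "1 / (1 + a / exit_rate m i) < 1" for i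
  proof -
    have "0 < a / exit_rate m i" using assms exit_rate_pos[of i] by simp
    then show "0 < 1 / (1 + a / exit_rate m i)" "1 / (1 + a / exit_rate m i) < 1" by (simp_all)
  qed
  have le: "1 / (1 + a / exit_rate m i) \<le> ?q" for i by (intro Max_ge) auto
  show "0 \<le> ?q" using le pos(1) by (meson less_imp_le order_trans)
  show "?q < 1" using pos(2) by (subst Max_less_iff) auto
  fix i
  interpret E: prob_space "exp_measure (claim_rate m)" by (rule prob_space_exp_measure[OF claim_rate_pos])
  have "(\<integral>\<^sup>+ d. ennreal (exp (- a * hold i d)) \<partial>DM) = (\<integral>\<^sup>+ e. ennreal (exp (- (a / exit_rate m i) * e)) \<partial>exp_measure 1)"
    using E.emeasure_space_1
    by (subst nn_integral_DM) (simp, simp add: hold_def unit_time_def)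
  also have "\<dots> = ennreal (1 / (1 + a / exit_rate m i))"
    using assms exit_rate_pos[of i] by (intro nn_integral_exp_measure_1) simp
  also have "\<dots> \<le> ennreal ?q" by (intro ennreal_leI le)
  finally show "(\<integral>\<^sup>+ d. ennreal (exp (- a * hold i d)) \<partial>DM) \<le> ennreal ?q" .
qed

text \<open>Conditioning on the first driver: the one-step bound is uniform in the phase, so the
  factors multiply although successive holding times depend on each other through the
  phases.\<close>

lemma nn_integral_exp_jump_time:
  assumes q: "0 \<le> q" "\<And>i. (\<integral>\<^sup>+ d. ennreal (exp (- a * hold i d)) \<partial>DM) \<le> ennreal q"
  shows "(\<integral>\<^sup>+ \<omega>. ennreal (exp (- a * jump_time m i \<omega> k)) \<partial>S0) \<le> ennreal (q ^ k)"
proof (induction k arbitrary: i)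
  case 0
  then show ?case using S0.emeasure_space_1 by simp
next
  case (Suc k)
  have "(\<integral>\<^sup>+ \<omega>. ennreal (exp (- a * jump_time m i \<omega> (Suc k))) \<partial>S0)
    = (\<integral>\<^sup>+ d. (\<integral>\<^sup>+ \<omega>. ennreal (exp (- a * hold i d)) * ennreal (exp (- a * jump_time m (succ_phase i d) \<omega> k)) \<partial>S0) \<partial>DM)"
    by (subst DM.nn_integral_stream_space)
      (auto intro!: nn_integral_cong simp: jump_time_Stream ennreal_mult[symmetric] exp_add[symmetric] algebra_simps)
  also have "\<dots> = (\<integral>\<^sup>+ d. ennreal (exp (- a * hold i d)) * (\<integral>\<^sup>+ \<omega>. ennreal (exp (- a * jump_time m (succ_phase i d) \<omega> k)) \<partial>S0) \<partial>DM)"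
    by (intro nn_integral_cong nn_integral_cmult) auto
  also have "\<dots> \<le> (\<integral>\<^sup>+ d. ennreal (exp (- a * hold i d)) * ennreal (q ^ k) \<partial>DM)"
    by (intro nn_integral_mono mult_left_mono Suc) auto
  also have "\<dots> = (\<integral>\<^sup>+ d. ennreal (exp (- a * hold i d)) \<partial>DM) * ennreal (q ^ k)"
    by (rule nn_integral_multc) auto
  also have "\<dots> \<le> ennreal q * ennreal (q ^ k)"
    by (intro mult_right_mono q) auto
  also have "\<dots> = ennreal (q ^ Suc k)" using q(1) by (simp add: ennreal_mult)
  finally show ?case .
qed

text \<open>Chernoff bound: if all jump times stay below \<open>t\<close>, then
  \<open>exp t * exp (- 1 * jump_time m i \<omega> k)\<close> is at least 1 for every
  \<open>k\<close>, whereas its expectation is at most \<open>exp t * q ^ k\<close>.\<close>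

lemma AE_jump_time_unbounded: "AE \<omega> in S0. \<exists>k. t < jump_time m i \<omega> k"
proof -
  obtain q where q: "0 \<le> q" "q < 1" "\<And>i. (\<integral>\<^sup>+ d. ennreal (exp (- 1 * hold i d)) \<partial>DM) \<le> ennreal q"
    using ex_discount_factor[of 1] by auto
  let ?A = "{\<omega>\<in>space S0. \<forall>k. jump_time m i \<omega> k \<le> t}"
  have A [measurable]: "?A \<in> sets S0" by measurable
  have "emeasure S0 ?A \<le> ennreal (exp t * q ^ k)" for k
  proof -
    have "emeasure S0 ?A = (\<integral>\<^sup>+ \<omega>. indicator ?A \<omega> \<partial>S0)"
      by (rule nn_integral_indicator[symmetric]) measurable
    also have "\<dots> \<le> (\<integral>\<^sup>+ \<omega>. ennreal (exp t) * ennreal (exp (- 1 * jump_time m i \<omega> k)) \<partial>S0)"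
      by (intro nn_integral_mono)
        (auto simp: indicator_def ennreal_mult[symmetric] exp_add[symmetric] intro!: ennreal_leI split: if_splits)
    also have "\<dots> = ennreal (exp t) * (\<integral>\<^sup>+ \<omega>. ennreal (exp (- 1 * jump_time m i \<omega> k)) \<partial>S0)"
      by (rule nn_integral_cmult) auto
    also have "\<dots> \<le> ennreal (exp t) * ennreal (q ^ k)"
      by (intro mult_left_mono nn_integral_exp_jump_time q) auto
    also have "\<dots> = ennreal (exp t * q ^ k)" using q(1) by (simp add: ennreal_mult)
    finally show ?thesis .
  qed
  moreover have "(\<lambda>k. ennreal (exp t * q ^ k)) \<longlonglongrightarrow> ennreal (exp t * 0)"
    using q by (intro tendsto_ennrealI tendsto_mult LIMSEQ_power_zero tendsto_const) auto
  ultimately have "emeasure S0 ?A \<le> ennreal (exp t * 0)" by (intro LIMSEQ_le_const) auto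
  then have "?A \<in> null_sets S0" by (intro null_setsI A) auto
  from AE_not_in[OF this] show ?thesis by eventually_elim (auto simp: not_le)
qed

lemma AE_good: "AE \<omega> in P. good \<omega>"
proof -
  have 1: "AE \<omega> in P. good_driver (\<omega> !! k)" for k
  proof (induction k)
    case 0 show ?case using AE_P_shd[OF AE_good_driver] by simp
  next
    case (Suc k) from AE_P_stl[OF Suc] show ?case by simp
  qed
  have "AE \<omega> in P. \<forall>i. \<forall>n. \<exists>k. real n < jump_time m i \<omega> k"
    unfolding AE_all_countable AE_P_iff using AE_jump_time_unbounded by blast
  moreover have "AE \<omega> in P. \<forall>k. good_driver (\<omega> !! k)"
    unfolding AE_all_countable using 1 by blast
  ultimately show ?thesis
  proof eventually_elim
    case (elim \<omega>)
    have "\<exists>k. t < jump_time m i \<omega> k" for i t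
    proof -
      obtain n where "t \<le> real n" using real_arch_simple by blast
      with elim(1) show ?thesis by (meson order_le_less_trans)
    qed
    with elim show ?case by (simp add: good_def)
  qed
qed

lemma good_driver_hold: "good_driver d \<Longrightarrow> 0 < hold i d"
  using exit_rate_pos[of i] by (simp add: good_driver_def hold_def)

lemma good_driver_loss: "good_driver d \<Longrightarrow> 0 \<le> loss i d"
  by (simp add: good_driver_def loss_def)

lemma good_StreamI:
  assumes "good_driver d" "good \<omega>" shows "good (d ## \<omega>)"
  unfolding good_def
proof safe
  fix k show "good_driver ((d ## \<omega>) !! k)"
    using assms by (cases k) (auto simp: good_def)
next
  fix i t
  obtain k where "t - hold i d < jump_time m (succ_phase i d) \<omega> k" using assms(2) unfolding good_def by blast
  then have "t < jump_time m i (d ## \<omega>) (Suc k)" by (simp add: jump_time_Stream)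
  then show "\<exists>k. t < jump_time m i (d ## \<omega>) k" ..
qed

lemma jump_time_Suc: "jump_time m i \<omega> (Suc k) = jump_time m i \<omega> k + hold (phase_chain i \<omega> k) (\<omega> !! k)"
  by (simp add: jump_time_def hold_def)

lemma strict_mono_jump_time: "good \<omega> \<Longrightarrow> strict_mono (jump_time m i \<omega>)"
  unfolding strict_mono_Suc_iff jump_time_Suc using good_driver_hold by (auto simp: good_def)

lemma jump_time_nonneg: "good \<omega> \<Longrightarrow> 0 \<le> jump_time m i \<omega> k"
  using strict_mono_less_eq[OF strict_mono_jump_time, of \<omega> i 0 k] by simp

lemma jump_time_pos: "good \<omega> \<Longrightarrow> 0 < k \<Longrightarrow> 0 < jump_time m i \<omega> k"
  using strict_mono_less[OF strict_mono_jump_time, of \<omega> i 0 k] by simp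

lemma jump_interval_ex:
  assumes "good \<omega>" "0 \<le> t"
  obtains k where "jump_time m i \<omega> k \<le> t" "t < jump_time m i \<omega> (Suc k)"
proof -
  obtain l where l: "t < jump_time m i \<omega> l" using assms unfolding good_def by blast
  define K where "K = (LEAST l. t < jump_time m i \<omega> l)"
  have K: "t < jump_time m i \<omega> K" unfolding K_def by (rule LeastI[of _ l]) (rule l)
  with assms have "K \<noteq> 0" by (cases K) auto
  then obtain k where k: "K = Suc k" by (cases K) auto
  have "\<not> t < jump_time m i \<omega> k" using not_less_Least[of k "\<lambda>l. t < jump_time m i \<omega> l"] k K_def by simp
  with K k show ?thesis by (intro that[of k]) auto
qed

text \<open>Left-open variant, suited to left-continuous processes: at a jump time it selects the
  interval that ends there.\<close>

lemma jump_interval_ex_strict: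
  assumes "good \<omega>" "0 < t"
  obtains k where "jump_time m i \<omega> k < t" "t \<le> jump_time m i \<omega> (Suc k)"
proof -
  obtain k where k: "jump_time m i \<omega> k \<le> t" "t < jump_time m i \<omega> (Suc k)"
    using jump_interval_ex[of \<omega> t i] assms by auto
  show ?thesis
  proof (cases "jump_time m i \<omega> k < t")
    case True then show ?thesis using k that by auto
  next
    case False
    with k have e: "jump_time m i \<omega> k = t" by simp
    with assms obtain l where "k = Suc l" by (cases k) auto
    with e strict_mono_jump_time[OF assms(1), of i] show ?thesis
      by (intro that[of l]) (auto simp: strict_mono_Suc_iff)
  qed
qed

lemma num_jumps_eq:
  assumes "good \<omega>" "jump_time m i \<omega> k \<le> t" "t < jump_time m i \<omega> (Suc k)"
  shows "num_jumps m i t \<omega> = k"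
proof -
  have "{l. 0 < l \<and> jump_time m i \<omega> l \<le> t} = {1..k}"
  proof (intro set_eqI iffI)
    fix l assume "l \<in> {l. 0 < l \<and> jump_time m i \<omega> l \<le> t}"
    then have "0 < l" "jump_time m i \<omega> l < jump_time m i \<omega> (Suc k)" using assms by auto
    then show "l \<in> {1..k}" using strict_mono_less[OF strict_mono_jump_time[OF assms(1)]] by auto
  next
    fix l assume "l \<in> {1..k}"
    then show "l \<in> {l. 0 < l \<and> jump_time m i \<omega> l \<le> t}"
      using strict_mono_less_eq[OF strict_mono_jump_time[OF assms(1)], of i l k] assms by simp
  qed
  then show ?thesis by (simp add: num_jumps_def)
qed

lemma num_jumps_strict_eq:
  assumes "good \<omega>" "jump_time m i \<omega> k < t" "t \<le> jump_time m i \<omega> (Suc k)"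
  shows "card {l. 0 < l \<and> jump_time m i \<omega> l < t} = k"
proof -
  have "{l. 0 < l \<and> jump_time m i \<omega> l < t} = {1..k}"
  proof (intro set_eqI iffI)
    fix l assume "l \<in> {l. 0 < l \<and> jump_time m i \<omega> l < t}"
    then have "0 < l" "jump_time m i \<omega> l < jump_time m i \<omega> (Suc k)" using assms by auto
    then show "l \<in> {1..k}" using strict_mono_less[OF strict_mono_jump_time[OF assms(1)]] by auto
  next
    fix l assume "l \<in> {1..k}"
    then show "l \<in> {l. 0 < l \<and> jump_time m i \<omega> l < t}"
      using strict_mono_less_eq[OF strict_mono_jump_time[OF assms(1)], of i l k] assms by simp
  qed
  then show ?thesis by simp
qed

lemma num_jumps_before:
  assumes "good_driver d" "good \<omega>" "0 \<le> t" "t < hold i d"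
  shows "num_jumps m i t (d ## \<omega>) = 0"
  using assms by (intro num_jumps_eq good_StreamI) (auto simp: jump_time_Stream)

lemma num_jumps_after:
  assumes "good_driver d" "good \<omega>" "0 \<le> t"
  shows "num_jumps m i (hold i d + t) (d ## \<omega>) = Suc (num_jumps m (succ_phase i d) t \<omega>)"
proof -
  obtain k where k: "jump_time m (succ_phase i d) \<omega> k \<le> t" "t < jump_time m (succ_phase i d) \<omega> (Suc k)"
    using jump_interval_ex[OF assms(2,3)] by blast
  then have "num_jumps m (succ_phase i d) t \<omega> = k" using assms by (intro num_jumps_eq)
  moreover have "num_jumps m i (hold i d + t) (d ## \<omega>) = Suc k"
    using k assms by (intro num_jumps_eq good_StreamI) (auto simp: jump_time_Stream)
  ultimately show ?thesis by simp
qed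

lemma total_claims_after:
  assumes "good_driver d" "good \<omega>" "0 \<le> t"
  shows "total_claims m i (hold i d + t) (d ## \<omega>) = loss i d + total_claims m (succ_phase i d) t \<omega>"
  using assms by (simp add: total_claims_def num_jumps_after sum.lessThan_Suc_shift claim_at_Stream del: sum.lessThan_Suc)

lemma card_claims_Suc:
  "card {k. k < Suc n \<and> Q k} = (if Q 0 then 1 else 0) + card {k. k < n \<and> Q (Suc k)}"
proof -
  have "{k. k < Suc n \<and> Q k} = (if Q 0 then {0} else {}) \<union> Suc ` {k. k < n \<and> Q (Suc k)}"
    by (auto simp: image_iff less_Suc_eq_0_disj)
  then show ?thesis by (simp add: card_insert_if card_image)
qed

lemma total_claims_before:
  assumes "good_driver d" "good \<omega>" "0 \<le> t" "t < hold i d"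
  shows "total_claims m i t (d ## \<omega>) = 0"
  using assms by (simp add: total_claims_def num_jumps_before)

lemma observation_before:
  assumes "good_driver d" "good \<omega>" "0 \<le> t" "t < hold i d"
  shows "observation m i t (d ## \<omega>) = (i, 0, 0)"
  using assms by (simp add: observation_def phase_at_def num_claims_def total_claims_def num_jumps_before)

section \<open>The filtration and the predictable sigma-algebra\<close>

abbreviation "OM \<equiv> (count_space UNIV \<Otimes>\<^sub>M count_space UNIV \<Otimes>\<^sub>M borel) :: ('n \<times> nat \<times> real) measure"
abbreviation "FI i t \<equiv> obs_filtration m i t"
abbreviation "PR i \<equiv> predictable_sigma m i"
abbreviation "JM \<equiv> restrict_space (borel :: real measure) {0..} \<Otimes>\<^sub>M P"

text \<open>The observation as a function of the number of jumps; together with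
  \<open>num_jumps\<close> it separates the jump data from the jump times.\<close>

definition hist :: "'n \<Rightarrow> 'n driver stream \<Rightarrow> nat \<Rightarrow> 'n \<times> nat \<times> real" where
  "hist i \<omega> k = (phase_chain i \<omega> k, card {l. l < k \<and> claim_jump i \<omega> l}, \<Sum>l<k. claim_at i \<omega> l)"

lemma observation_eq_hist: "observation m i t \<omega> = hist i \<omega> (num_jumps m i t \<omega>)"
  by (simp add: observation_def hist_def phase_at_def num_claims_def total_claims_def)

lemma measurable_hist [measurable]: "(\<lambda>\<omega>. hist i \<omega> k) \<in> S0 \<rightarrow>\<^sub>M OM"
  unfolding hist_def by measurable

lemma measurable_num_jumps [measurable]: "(\<lambda>\<omega>. num_jumps m i t \<omega>) \<in> S0 \<rightarrow>\<^sub>M count_space UNIV"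
  unfolding num_jumps_def by measurable

lemma measurable_observation [measurable]: "observation m i t \<in> S0 \<rightarrow>\<^sub>M OM"
  unfolding observation_eq_hist[abs_def]
  by (rule measurable_compose_countable'[OF _ measurable_num_jumps]) auto

lemma space_FI [simp]: "space (FI i t) = UNIV"
  unfolding obs_filtration_def by (subst space_measure_of) auto

lemma sets_FI: "sets (FI i t) = sigma_sets UNIV
   ({observation m i u -` A \<inter> space P | u A. 0 \<le> u \<and> u \<le> t \<and> A \<in> sets OM} \<union> null_sets P)"
  unfolding obs_filtration_def by (subst sets_measure_of) auto

lemma FI_obs: "0 \<le> u \<Longrightarrow> u \<le> t \<Longrightarrow> A \<in> sets OM \<Longrightarrow> {\<omega>. observation m i u \<omega> \<in> A} \<in> sets (FI i t)"
  unfolding sets_FI by (rule sigma_sets.Basic) (auto simp: vimage_def)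

lemma measurable_FI_obs: "0 \<le> u \<Longrightarrow> u \<le> t \<Longrightarrow> observation m i u \<in> FI i t \<rightarrow>\<^sub>M OM"
  by (rule measurableI) (auto simp: space_pair_measure vimage_def intro!: FI_obs)

lemma FI_null: "AE \<omega> in P. \<omega> \<notin> N \<Longrightarrow> N \<in> sets (FI i t)"
  unfolding sets_FI by (rule sigma_sets.Basic) (auto simp: null_sets_P_iff)

text \<open>Almost-sure statements about adapted events are proved over the generators. The
  exceptional set may depend on the event, since each step combines only countably many
  events.\<close>

lemma FI_induct [consumes 1, case_names obs null compl union]:
  assumes "A \<in> sets (FI i t)"
    and "\<And>u B. 0 \<le> u \<Longrightarrow> u \<le> t \<Longrightarrow> B \<in> sets OM \<Longrightarrow> Q {\<omega>. observation m i u \<omega> \<in> B}"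
    and "\<And>N. AE \<omega> in P. \<omega> \<notin> N \<Longrightarrow> Q N"
    and "\<And>A. A \<in> sets (FI i t) \<Longrightarrow> Q A \<Longrightarrow> Q (- A)"
    and "\<And>A :: nat \<Rightarrow> _. (\<And>n. A n \<in> sets (FI i t)) \<Longrightarrow> (\<And>n. Q (A n)) \<Longrightarrow> Q (\<Union>n. A n)"
  shows "Q A"
  using assms(1) unfolding sets_FI
proof (induction rule: sigma_sets.induct)
  case (Basic a)
  then show ?case using assms(2,3) by (auto simp: vimage_def null_sets_P_iff)
next
  case Empty show ?case by (rule assms(3)) simp
next
  case (Compl a) then show ?case using assms(4)[of a] by (simp add: sets_FI Compl_eq_Diff_UNIV)
next
  case (Union a) then show ?case using assms(5)[of a] by (simp add: sets_FI)
qed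

lemma FI_subset_P: "A \<in> sets (FI i t) \<Longrightarrow> A \<in> sets P"
proof (induction rule: FI_induct)
  case (obs u B)
  have "observation m i u \<in> P \<rightarrow>\<^sub>M OM" by (rule measurable_P_S0) simp
  from measurable_sets[OF this obs(3)] show ?case by (simp add: vimage_def)
next
  case (null N) then show ?case using null_sets_P_iff by auto
next
  case (compl A) then show ?case using sets.compl_sets[of A P] by (simp add: Compl_eq_Diff_UNIV)
qed auto

lemma FI_mono: "s \<le> t \<Longrightarrow> A \<in> sets (FI i s) \<Longrightarrow> A \<in> sets (FI i t)"
  unfolding sets_FI by (erule sigma_sets_mono'[THEN subsetD, rotated]) (blast intro: order_trans)

lemma FI_AE:
  assumes "A \<in> sets (FI i t)" "AE \<omega> in P. \<omega> \<in> A \<longleftrightarrow> \<omega> \<in> B"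
  shows "B \<in> sets (FI i t)"
proof -
  have "A - B \<in> sets (FI i t)" "B - A \<in> sets (FI i t)"
    using assms(2) by (auto intro!: FI_null elim!: eventually_mono)
  with assms(1) have "(A - (A - B)) \<union> (B - A) \<in> sets (FI i t)" by blast
  also have "(A - (A - B)) \<union> (B - A) = B" by auto
  finally show ?thesis .
qed

lemma sets_PR: "sets (PR i) = sigma_sets ({0..} \<times> UNIV)
     ({{0} \<times> A | A. A \<in> sets (FI i 0)}
      \<union> {{s<..t} \<times> A | s t A. 0 \<le> s \<and> s < t \<and> A \<in> sets (FI i s)})"
  unfolding predictable_sigma_def by (subst sets_measure_of) (auto simp: space_P)

lemma space_PR [simp]: "space (PR i) = {0..} \<times> UNIV"
  unfolding predictable_sigma_def by (subst space_measure_of) (auto simp: space_P)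

lemma PR_zero: "A \<in> sets (FI i 0) \<Longrightarrow> {0} \<times> A \<in> sets (PR i)"
  unfolding sets_PR by (rule sigma_sets.Basic) auto

lemma PR_Ioc: "0 \<le> s \<Longrightarrow> A \<in> sets (FI i s) \<Longrightarrow> {s<..t} \<times> A \<in> sets (PR i)"
proof (cases "s < t")
  case True
  then show "0 \<le> s \<Longrightarrow> A \<in> sets (FI i s) \<Longrightarrow> {s<..t} \<times> A \<in> sets (PR i)"
    unfolding sets_PR by (intro sigma_sets.Basic) auto
qed simp

lemma PR_Ioi:
  assumes "0 \<le> s" "A \<in> sets (FI i s)" shows "{s<..} \<times> A \<in> sets (PR i)"
proof -
  have "(\<Union>n::nat. {s<..real n} \<times> A) \<in> sets (PR i)"
    using assms by (intro sets.countable_UN) (auto intro: PR_Ioc)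
  also have "(\<Union>n::nat. {s<..real n} \<times> A) = {s<..} \<times> A"
    using real_arch_simple by auto
  finally show ?thesis .
qed

lemma PR_Ici:
  assumes "A \<in> sets (FI i 0)" shows "{0..} \<times> A \<in> sets (PR i)"
proof -
  have "{0} \<times> A \<union> {0<..} \<times> A \<in> sets (PR i)"
    using assms by (intro sets.Un PR_zero PR_Ioi) auto
  also have "{0} \<times> A \<union> {0<..} \<times> A = {0::real..} \<times> A" by auto
  finally show ?thesis .
qed

lemma PR_induct [consumes 1, case_names zero Ioc compl union]:
  assumes "C \<in> sets (PR i)"
    and "\<And>A. A \<in> sets (FI i 0) \<Longrightarrow> Q ({0} \<times> A)"
    and "\<And>s t A. 0 \<le> s \<Longrightarrow> s < t \<Longrightarrow> A \<in> sets (FI i s) \<Longrightarrow> Q ({s<..t} \<times> A)"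
    and "\<And>C. C \<in> sets (PR i) \<Longrightarrow> Q C \<Longrightarrow> Q ({0..} \<times> UNIV - C)"
    and "\<And>C :: nat \<Rightarrow> _. (\<And>n. C n \<in> sets (PR i)) \<Longrightarrow> (\<And>n. Q (C n)) \<Longrightarrow> Q (\<Union>n. C n)"
  shows "Q C"
  using assms(1) unfolding sets_PR
proof (induction rule: sigma_sets.induct)
  case (Basic a) then show ?case using assms(2,3) by auto
next
  case Empty show ?case using assms(2)[of "{}"] by simp
next
  case (Compl a) then show ?case using assms(4)[of a] by (simp add: sets_PR)
next
  case (Union a) then show ?case using assms(5)[of a] by (simp add: sets_PR)
qed

lemma space_JM [simp]: "space JM = {0..} \<times> UNIV"
  by (simp add: space_pair_measure space_restrict_space)

lemma JM_times: "X \<in> sets borel \<Longrightarrow> X \<subseteq> {0..} \<Longrightarrow> A \<in> sets P \<Longrightarrow> X \<times> A \<in> sets JM"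
  by (rule pair_measureI) (auto simp: sets_restrict_space_iff)

lemma PR_subset_JM: "C \<in> sets (PR i) \<Longrightarrow> C \<in> sets JM"
proof (induction rule: PR_induct)
  case (zero A) then show ?case by (intro JM_times FI_subset_P) auto
next
  case (Ioc s t A) then show ?case by (intro JM_times FI_subset_P) auto
next
  case (compl C) then show ?case using sets.compl_sets[of C JM] by (simp only: space_JM)
qed auto

lemma measurable_PR_JM: "f \<in> PR i \<rightarrow>\<^sub>M N \<Longrightarrow> f \<in> JM \<rightarrow>\<^sub>M N"
  unfolding measurable_def by (simp, blast intro: PR_subset_JM)

lemma measurable_PR_fst: "fst \<in> borel_measurable (PR i)"
  unfolding borel_measurable_iff_le
proof
  fix a :: real
  have "{0} \<times> UNIV \<union> {0<..a} \<times> UNIV \<in> sets (PR i)"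
    by (intro sets.Un PR_zero PR_Ioc) (auto intro: sets.top[of "FI i 0", simplified])
  moreover have "{w \<in> space (PR i). fst w \<le> a} = (if a < 0 then {} else {0} \<times> UNIV \<union> {0<..a} \<times> UNIV)"
    by auto
  ultimately show "{w \<in> space (PR i). fst w \<le> a} \<in> sets (PR i)" by auto
qed

text \<open>By completeness every part of the negligible set \<open>N\<close> is an event of time 0,
  so on the strip over \<open>N\<close> both coordinates are predictable, and with them every
  jointly measurable set.\<close>

lemma PR_null:
  assumes C: "C \<in> sets JM" and N: "AE \<omega> in P. \<omega> \<notin> N" and sub: "C \<subseteq> {0..} \<times> N"
  shows "C \<in> sets (PR i)"
proof -
  let ?R = "restrict_space (PR i) ({0..} \<times> N)"
  have N': "{0..} \<times> N \<in> sets (PR i)" by (intro PR_Ici FI_null N)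
  have eq: "({0::real..} \<times> N) \<inter> ({0..} \<times> UNIV) = {0..} \<times> N" by auto
  have sp: "space ?R = {0..} \<times> N" by (auto simp: space_restrict_space)
  have "(\<lambda>p. (fst p, snd p)) \<in> ?R \<rightarrow>\<^sub>M JM"
  proof (rule measurable_Pair)
    show "fst \<in> ?R \<rightarrow>\<^sub>M restrict_space borel {0..}"
      by (intro measurable_restrict_space2 measurable_restrict_space1 measurable_PR_fst) (auto simp: sp)
    show "snd \<in> ?R \<rightarrow>\<^sub>M P"
    proof (rule measurableI)
      fix A assume "A \<in> sets P"
      have "snd -` A \<inter> space ?R = {0..} \<times> (A \<inter> N)" by (auto simp: sp)
      moreover have "{0..} \<times> (A \<inter> N) \<in> sets (PR i)"
        by (intro PR_Ici FI_null) (use N in \<open>auto elim!: eventually_mono\<close>)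
      ultimately show "snd -` A \<inter> space ?R \<in> sets ?R"
        using N' eq by (subst sets_restrict_space_iff) auto
    qed (simp)
  qed
  from measurable_sets[OF this C] have "C \<inter> ({0..} \<times> N) \<in> sets ?R" by (simp add: sp)
  also have "C \<inter> ({0..} \<times> N) = C" using sub by auto
  finally show ?thesis using N' eq by (subst (asm) sets_restrict_space_iff) auto
qed

text \<open>Joint measurability of \<open>C'\<close> is essential: for \<open>\<omega>\<close> in a null set the section of a predictable set is
  still a Borel set, so indistinguishability from a predictable set is not enough.\<close>

lemma PR_AE:
  assumes C: "C \<in> sets (PR i)" and C': "C' \<in> sets JM"
    and ae: "AE \<omega> in P. \<forall>t\<ge>0. (t, \<omega>) \<in> C \<longleftrightarrow> (t, \<omega>) \<in> C'"
  shows "C' \<in> sets (PR i)"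
proof -
  define N where "N = {\<omega>. \<not> (\<forall>t\<ge>0. (t, \<omega>) \<in> C \<longleftrightarrow> (t, \<omega>) \<in> C')}"
  have N: "AE \<omega> in P. \<omega> \<notin> N" using ae by (auto simp: N_def elim!: eventually_mono)
  have N': "{0..} \<times> N \<in> sets (PR i)" by (intro PR_Ici FI_null N)
  have "C' \<inter> ({0..} \<times> N) \<in> sets (PR i)"
    by (intro PR_null[OF _ N] sets.Int C' PR_subset_JM[OF N']) auto
  with C N' have "(C - {0..} \<times> N) \<union> (C' \<inter> ({0..} \<times> N)) \<in> sets (PR i)" by blast
  also have "(C - {0..} \<times> N) \<union> (C' \<inter> ({0..} \<times> N)) = C'"
    using sets.sets_into_space[OF C] sets.sets_into_space[OF C'] unfolding space_PR space_JM N_def by auto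
  finally show ?thesis .
qed

lemma measurable_PR_AE:
  assumes f: "f \<in> PR i \<rightarrow>\<^sub>M N" and g: "g \<in> JM \<rightarrow>\<^sub>M N"
    and ae: "AE \<omega> in P. \<forall>t\<ge>0. f (t, \<omega>) = g (t, \<omega>)"
  shows "g \<in> PR i \<rightarrow>\<^sub>M N"
proof (rule measurableI)
  fix x assume "x \<in> space (PR i)" then show "g x \<in> space N" using measurable_space[OF g, of x] by simp
next
  fix A assume A: "A \<in> sets N"
  show "g -` A \<inter> space (PR i) \<in> sets (PR i)"
  proof (rule PR_AE)
    show "f -` A \<inter> space (PR i) \<in> sets (PR i)" using f A by (rule measurable_sets)
    show "g -` A \<inter> space (PR i) \<in> sets JM" using measurable_sets[OF g A] by simp
    show "AE \<omega> in P. \<forall>t\<ge>0. ((t, \<omega>) \<in> f -` A \<inter> space (PR i)) = ((t, \<omega>) \<in> g -` A \<inter> space (PR i))"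
      using ae by eventually_elim auto
  qed
qed

section \<open>Jump times are stopping times of the observed process\<close>

lemma pred_OM_eq:
  assumes f: "f \<in> N \<rightarrow>\<^sub>M OM" and g: "g \<in> N \<rightarrow>\<^sub>M OM"
  shows "Measurable.pred N (\<lambda>x. f x = g x)"
proof -
  have eq: "Measurable.pred N (\<lambda>x. a x = b x)"
    if [measurable]: "a \<in> N \<rightarrow>\<^sub>M count_space UNIV" "b \<in> N \<rightarrow>\<^sub>M count_space UNIV"
    for a b :: "'a \<Rightarrow> 'c::countable"
    by measurable
  have eq': "Measurable.pred N (\<lambda>x. a x = b x)"
    if [measurable]: "a \<in> borel_measurable N" "b \<in> borel_measurable N"
    for a b :: "'a \<Rightarrow> real"
    by measurable
  have "Measurable.pred N (\<lambda>x. fst (f x) = fst (g x))"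
    by (intro eq measurable_compose[OF f measurable_fst] measurable_compose[OF g measurable_fst])
  moreover have "Measurable.pred N (\<lambda>x. fst (snd (f x)) = fst (snd (g x)))"
    by (intro eq measurable_compose[OF f measurable_compose[OF measurable_snd measurable_fst]]
      measurable_compose[OF g measurable_compose[OF measurable_snd measurable_fst]])
  moreover have "Measurable.pred N (\<lambda>x. snd (snd (f x)) = snd (snd (g x)))"
    by (intro eq' measurable_compose[OF f measurable_compose[OF measurable_snd measurable_snd]]
      measurable_compose[OF g measurable_compose[OF measurable_snd measurable_snd]])
  ultimately show ?thesis unfolding prod_eq_iff by (intro pred_intros_logic) auto
qed

text \<open>A claim raises the claim count even if the restart returns to the same phase; any other
  jump changes the phase. This is what makes jump times observable.\<close>

lemma hist_Suc_neq:
  assumes "good \<omega>"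
  shows "hist i \<omega> (Suc k) \<noteq> hist i \<omega> k"
proof (cases "target (\<omega> !! k) (phase_chain i \<omega> k)")
  case None
  then have c: "claim_jump i \<omega> k" by (simp add: claim_jump_def)
  have "{l. l < Suc k \<and> claim_jump i \<omega> l} = insert k {l. l < k \<and> claim_jump i \<omega> l}"
    using c by auto
  then show ?thesis by (simp add: hist_def)
next
  case (Some j)
  with assms have "j \<noteq> phase_chain i \<omega> k" by (auto simp: good_def good_driver_def)
  with Some show ?thesis by (simp add: hist_def)
qed

text \<open>Countably many times, so that events can be written as countable unions. The end point
  \<open>t\<close> is included because a jump may occur exactly at \<open>t\<close>.\<close>

definition obs_times :: "real \<Rightarrow> real set" where
  "obs_times t = insert t (\<rat> \<inter> {0..t})"

lemma countable_obs_times: "countable (obs_times t)"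
  unfolding obs_times_def by (intro countable_insert countable_Int1 countable_rat)

lemma obs_times_ex:
  assumes "0 \<le> a" "a \<le> t" "a < b"
  shows "\<exists>u\<in>obs_times t. a \<le> u \<and> u < b"
proof (cases "t < b")
  case True then show ?thesis using assms by (auto simp: obs_times_def)
next
  case False
  obtain u where "u \<in> \<rat>" "a < u" "u < b" using Rats_dense_in_real[OF assms(3)] by auto
  then show ?thesis using False assms by (intro bexI[of _ u]) (auto simp: obs_times_def)
qed

text \<open>Jump \<open>k + 1\<close> has happened by time \<open>t\<close> iff the observations at
  two times of \<open>obs_times t\<close>, neither of them before jump \<open>k\<close>, differ. The
  equivalence is almost sure, which suffices in a completed filtration.\<close>

lemma FI_jump_time:
  assumes "0 \<le> t"
  shows "{\<omega>. jump_time m i \<omega> k \<le> t} \<in> sets (FI i t)"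
  using assms
proof (induction k arbitrary: t)
  case 0 then show ?case using sets.top[of "FI i t"] by simp
next
  case (Suc k)
  let ?A = "\<Union>u\<in>obs_times t. \<Union>u'\<in>obs_times t \<inter> {u..}.
    {\<omega>. jump_time m i \<omega> k \<le> u} \<inter> {\<omega>\<in>space (FI i t). observation m i u \<omega> \<noteq> observation m i u' \<omega>}"
  show ?case
  proof (rule FI_AE)
    show "?A \<in> sets (FI i t)"
    proof (intro sets.countable_UN'' countable_obs_times countable_Int1 sets.Int)
      fix u u' assume u: "u \<in> obs_times t" "u' \<in> obs_times t \<inter> {u..}"
      then have u': "0 \<le> u" "u \<le> t" "0 \<le> u'" "u' \<le> t" using Suc.prems by (auto simp: obs_times_def)
      show "{\<omega>. jump_time m i \<omega> k \<le> u} \<in> sets (FI i t)"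
        using u' by (intro FI_mono[OF _ Suc.IH]) auto
      have "Measurable.pred (FI i t) (\<lambda>\<omega>. observation m i u \<omega> = observation m i u' \<omega>)"
        using u' by (intro pred_OM_eq measurable_FI_obs) auto
      then show "{\<omega>\<in>space (FI i t). observation m i u \<omega> \<noteq> observation m i u' \<omega>} \<in> sets (FI i t)"
        by measurable
    qed
    show "AE \<omega> in P. \<omega> \<in> ?A \<longleftrightarrow> \<omega> \<in> {\<omega>. jump_time m i \<omega> (Suc k) \<le> t}"
      using AE_good
    proof eventually_elim
      case (elim \<omega>)
      let ?T = "jump_time m i \<omega>"
      have sm: "strict_mono ?T" using elim by (rule strict_mono_jump_time)
      show ?case
      proof
        assume "\<omega> \<in> ?A"
        then obtain u u' where u: "u \<in> obs_times t" "u' \<in> obs_times t" "u \<le> u'" "?T k \<le> u"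
          "observation m i u \<omega> \<noteq> observation m i u' \<omega>" by auto
        have "u' \<le> t" using u by (auto simp: obs_times_def)
        have "\<not> t < ?T (Suc k)"
        proof
          assume "t < ?T (Suc k)"
          then have "num_jumps m i u \<omega> = k" "num_jumps m i u' \<omega> = k"
            using u \<open>u' \<le> t\<close> elim by (auto intro!: num_jumps_eq)
          with u(5) show False by (simp add: observation_eq_hist)
        qed
        then show "\<omega> \<in> {\<omega>. jump_time m i \<omega> (Suc k) \<le> t}" by simp
      next
        assume "\<omega> \<in> {\<omega>. jump_time m i \<omega> (Suc k) \<le> t}"
        then have T: "?T (Suc k) \<le> t" by simp
        have lt: "?T k < ?T (Suc k)" "?T (Suc k) < ?T (Suc (Suc k))" using sm by (auto simp: strict_mono_Suc_iff)
        \<comment> \<open>One time from each of the two adjacent intervals, so that the observations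
          are consecutive values of \<open>hist\<close>.\<close>
        obtain u where u: "u \<in> obs_times t" "?T k \<le> u" "u < ?T (Suc k)"
          using obs_times_ex[of "?T k" t "?T (Suc k)"] lt T jump_time_nonneg[OF elim, of i k] by auto
        obtain u' where u': "u' \<in> obs_times t" "?T (Suc k) \<le> u'" "u' < ?T (Suc (Suc k))"
          using obs_times_ex[of "?T (Suc k)" t "?T (Suc (Suc k))"] lt T jump_time_nonneg[OF elim, of i "Suc k"] by auto
        have "num_jumps m i u \<omega> = k" "num_jumps m i u' \<omega> = Suc k"
          using u u' elim by (auto intro!: num_jumps_eq)
        then have "observation m i u \<omega> \<noteq> observation m i u' \<omega>"
          using hist_Suc_neq[OF elim, of i k] by (auto simp: observation_eq_hist)
        with u u' show "\<omega> \<in> ?A" by (intro UN_I[of u] UN_I[of u']) auto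
      qed
    qed
  qed
qed

text \<open>The data of jump \<open>k\<close> are read off from the observation at a time
  \<open>u \<le> t\<close> between jumps \<open>k\<close> and \<open>k + 1\<close>.\<close>

lemma FI_hist:
  assumes "0 \<le> t" "B \<in> sets OM"
  shows "{\<omega>. jump_time m i \<omega> k \<le> t \<and> hist i \<omega> k \<in> B} \<in> sets (FI i t)"
proof (rule FI_AE)
  let ?A = "\<Union>u\<in>obs_times t. ({\<omega>. jump_time m i \<omega> k \<le> u} - {\<omega>. jump_time m i \<omega> (Suc k) \<le> u})
     \<inter> {\<omega>. observation m i u \<omega> \<in> B}"
  show "?A \<in> sets (FI i t)"
  proof (intro sets.countable_UN'' countable_obs_times sets.Int sets.Diff)
    fix u assume "u \<in> obs_times t"
    then have u: "0 \<le> u" "u \<le> t" using assms by (auto simp: obs_times_def)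
    have "{\<omega>. jump_time m i \<omega> l \<le> u} \<in> sets (FI i t)" for l
      using u by (intro FI_mono[OF _ FI_jump_time]) auto
    then show "{\<omega>. jump_time m i \<omega> k \<le> u} \<in> sets (FI i t)"
      "{\<omega>. jump_time m i \<omega> (Suc k) \<le> u} \<in> sets (FI i t)" by blast+
    show "{\<omega>. observation m i u \<omega> \<in> B} \<in> sets (FI i t)"
      using u assms by (intro FI_obs) auto
  qed
  show "AE \<omega> in P. \<omega> \<in> ?A \<longleftrightarrow> \<omega> \<in> {\<omega>. jump_time m i \<omega> k \<le> t \<and> hist i \<omega> k \<in> B}"
    using AE_good
  proof eventually_elim
    case (elim \<omega>)
    let ?T = "jump_time m i \<omega>"
    have sm: "strict_mono ?T" using elim by (rule strict_mono_jump_time)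
    show ?case
    proof
      assume "\<omega> \<in> ?A"
      then obtain u where u: "u \<in> obs_times t" "?T k \<le> u" "u < ?T (Suc k)" "observation m i u \<omega> \<in> B"
        by auto
      then have "num_jumps m i u \<omega> = k" "u \<le> t" using elim by (auto intro!: num_jumps_eq simp: obs_times_def)
      with u show "\<omega> \<in> {\<omega>. jump_time m i \<omega> k \<le> t \<and> hist i \<omega> k \<in> B}" by (simp add: observation_eq_hist)
    next
      assume "\<omega> \<in> {\<omega>. jump_time m i \<omega> k \<le> t \<and> hist i \<omega> k \<in> B}"
      then have *: "?T k \<le> t" "hist i \<omega> k \<in> B" by auto
      have lt: "?T k < ?T (Suc k)" using sm by (auto simp: strict_mono_Suc_iff)
      obtain u where u: "u \<in> obs_times t" "?T k \<le> u" "u < ?T (Suc k)"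
        using obs_times_ex[of "?T k" t "?T (Suc k)"] lt * jump_time_nonneg[OF elim, of i k] by auto
      have "num_jumps m i u \<omega> = k" using u elim by (auto intro!: num_jumps_eq)
      then show "\<omega> \<in> ?A" using u * by (auto simp: observation_eq_hist)
    qed
  qed
qed

section \<open>Predictable versions of the data of past jumps\<close>

abbreviation past_jump :: "'n \<Rightarrow> nat \<Rightarrow> 'n driver stream set \<Rightarrow> (real \<times> 'n driver stream) set" where
  "past_jump i k A \<equiv> {(t, \<omega>). 0 \<le> t \<and> jump_time m i \<omega> k < t \<and> \<omega> \<in> A}"

lemma JM_after:
  assumes "A \<in> sets P"
  shows "past_jump i k A \<in> sets JM"
proof -
  have [measurable]: "(\<lambda>\<omega>. jump_time m i \<omega> k) \<in> borel_measurable P" by (rule measurable_P_S0) simp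
  have [measurable]: "fst \<in> borel_measurable JM"
    using measurable_PR_JM[OF measurable_PR_fst] .
  note [measurable] = assms
  have "{p \<in> space JM. jump_time m i (snd p) k < fst p \<and> snd p \<in> A} \<in> sets JM" by measurable
  also have "{p \<in> space JM. jump_time m i (snd p) k < fst p \<and> snd p \<in> A} = past_jump i k A"
    by auto
  finally show ?thesis .
qed

text \<open>Up to a null set, the open stochastic interval after jump \<open>k\<close> is a
  countable union of predictable rectangles: between the jump and \<open>t\<close> there is a
  rational \<open>q\<close>, at which the jump has already been seen.\<close>

lemma PR_after:
  assumes A: "A \<in> sets P" and F: "\<And>q. 0 \<le> q \<Longrightarrow> {\<omega>. jump_time m i \<omega> k \<le> q \<and> \<omega> \<in> A} \<in> sets (FI i q)"
  shows "past_jump i k A \<in> sets (PR i)"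
proof (rule PR_AE)
  let ?C = "\<Union>q\<in>\<rat> \<inter> {0..}. {q<..} \<times> {\<omega>. jump_time m i \<omega> k \<le> q \<and> \<omega> \<in> A}"
  show "?C \<in> sets (PR i)"
    by (intro sets.countable_UN'' countable_Int1 countable_rat PR_Ioi F) auto
  show "past_jump i k A \<in> sets JM" by (rule JM_after[OF A])
  show "AE \<omega> in P. \<forall>t\<ge>0. (t, \<omega>) \<in> ?C \<longleftrightarrow> (t, \<omega>) \<in> past_jump i k A"
    using AE_good
  proof eventually_elim
    case (elim \<omega>)
    show ?case
    proof (intro allI impI iffI)
      fix t assume "0 \<le> t" "(t, \<omega>) \<in> past_jump i k A"
      then have *: "jump_time m i \<omega> k < t" "\<omega> \<in> A" by auto
      obtain q where "q \<in> \<rat>" "jump_time m i \<omega> k < q" "q < t" using Rats_dense_in_real[OF *(1)] by auto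
      then show "(t, \<omega>) \<in> ?C" using * jump_time_nonneg[OF elim, of i k] by (intro UN_I[of q]) auto
    qed auto
  qed
qed

text \<open>The data of jump \<open>k\<close>, replaced by a dummy value as long as that jump is not strictly in the past;
  this makes them predictable.\<close>

definition cut_time :: "'n \<Rightarrow> nat \<Rightarrow> real \<times> 'n driver stream \<Rightarrow> real" where
  "cut_time i k p = (if jump_time m i (snd p) k < fst p then jump_time m i (snd p) k else 0)"

definition cut_hist :: "'n \<Rightarrow> nat \<Rightarrow> real \<times> 'n driver stream \<Rightarrow> 'n \<times> nat \<times> real" where
  "cut_hist i k p = (if jump_time m i (snd p) k < fst p then hist i (snd p) k else (i, 0, 0))"

lemma PR_past: "Measurable.pred (PR i) (\<lambda>p. jump_time m i (snd p) k < fst p)"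
proof -
  have "past_jump i k UNIV \<in> sets (PR i)"
    using sets.top[of P] by (intro PR_after) (auto intro: FI_jump_time)
  also have "past_jump i k UNIV =
    {p \<in> space (PR i). jump_time m i (snd p) k < fst p}" by auto
  finally show ?thesis by (simp add: pred_def)
qed

lemma measurable_cut_time: "cut_time i k \<in> borel_measurable (PR i)"
  unfolding borel_measurable_iff_le
proof
  fix a :: real
  have [measurable]: "(\<lambda>\<omega>. jump_time m i \<omega> k) \<in> borel_measurable P" by (rule measurable_P_S0) simp
  have "past_jump i k {\<omega>. jump_time m i \<omega> k \<le> a} \<in> sets (PR i)"
  proof (rule PR_after)
    have "{\<omega> \<in> space P. jump_time m i \<omega> k \<le> a} \<in> sets P" by measurable
    then show "{\<omega>. jump_time m i \<omega> k \<le> a} \<in> sets P" by simp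
    fix q :: real assume "0 \<le> q"
    show "{\<omega>. jump_time m i \<omega> k \<le> q \<and> \<omega> \<in> {\<omega>. jump_time m i \<omega> k \<le> a}} \<in> sets (FI i q)"
    proof (cases "0 \<le> a")
      case True
      then have "{\<omega>. jump_time m i \<omega> k \<le> min q a} \<in> sets (FI i q)"
        using \<open>0 \<le> q\<close> by (intro FI_mono[OF _ FI_jump_time]) auto
      then show ?thesis by simp
    next
      \<comment> \<open>The event is null rather than empty, since jump times are nonnegative only
        almost surely.\<close>
      case False
      have "AE \<omega> in P. 0 \<le> jump_time m i \<omega> k" using AE_good by eventually_elim (rule jump_time_nonneg)
      then show ?thesis using False by (intro FI_null) (auto elim!: eventually_mono)
    qed
  qed
  moreover have "{p \<in> space (PR i). \<not> jump_time m i (snd p) k < fst p} \<in> sets (PR i)"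
    using PR_past[of i k] by measurable
  ultimately have "past_jump i k {\<omega>. jump_time m i \<omega> k \<le> a} \<union>
     (if 0 \<le> a then {p \<in> space (PR i). \<not> jump_time m i (snd p) k < fst p} else {}) \<in> sets (PR i)" by auto
  also have "past_jump i k {\<omega>. jump_time m i \<omega> k \<le> a} \<union>
     (if 0 \<le> a then {p \<in> space (PR i). \<not> jump_time m i (snd p) k < fst p} else {}) =
    {w \<in> space (PR i). cut_time i k w \<le> a}"
    by (auto simp: cut_time_def)
  finally show "{w \<in> space (PR i). cut_time i k w \<le> a} \<in> sets (PR i)" .
qed

lemma measurable_cut_hist: "cut_hist i k \<in> PR i \<rightarrow>\<^sub>M OM"
proof (rule measurableI)
  fix B assume B: "B \<in> sets OM"
  have 1: "past_jump i k {\<omega>. hist i \<omega> k \<in> B} \<in> sets (PR i)"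
  proof (rule PR_after)
    have "(\<lambda>\<omega>. hist i \<omega> k) \<in> P \<rightarrow>\<^sub>M OM" by (rule measurable_P_S0) simp
    from measurable_sets[OF this B] show "{\<omega>. hist i \<omega> k \<in> B} \<in> sets P" by (simp add: vimage_def)
  qed (use FI_hist[OF _ B] in simp)
  have "{p \<in> space (PR i). \<not> jump_time m i (snd p) k < fst p} \<in> sets (PR i)"
    using PR_past[of i k] by measurable
  with 1 have 2: "past_jump i k {\<omega>. hist i \<omega> k \<in> B} \<union>
     {p \<in> space (PR i). \<not> jump_time m i (snd p) k < fst p} \<in> sets (PR i)" by (rule sets.Un)
  have eq: "cut_hist i k -` B \<inter> space (PR i) =
    past_jump i k {\<omega>. hist i \<omega> k \<in> B} \<union>
     (if (i, 0, 0) \<in> B then {p \<in> space (PR i). \<not> jump_time m i (snd p) k < fst p} else {})"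
  proof (intro set_eqI)
    fix p :: "real \<times> 'n driver stream"
    obtain t \<omega> where p: "p = (t, \<omega>)" by (cases p)
    show "p \<in> cut_hist i k -` B \<inter> space (PR i) \<longleftrightarrow> p \<in> past_jump i k {\<omega>. hist i \<omega> k \<in> B} \<union>
     (if (i, 0, 0) \<in> B then {p \<in> space (PR i). \<not> jump_time m i (snd p) k < fst p} else {})"
      by (simp add: p cut_hist_def conj_commute)
  qed
  show "cut_hist i k -` B \<inter> space (PR i) \<in> sets (PR i)"
    using 1 2 unfolding eq by (cases "(i, 0, 0) \<in> B") (simp_all only: if_True if_False Un_empty_right)
qed (simp add: space_pair_measure)

section \<open>Predictability and the first jump\<close>

text \<open>The restarted process counts claims from zero; the claim of the first jump, if there is
  one, is added back.\<close>

definition shift_obs :: "'n \<Rightarrow> 'n driver \<Rightarrow> 'n \<times> nat \<times> real \<Rightarrow> 'n \<times> nat \<times> real" where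
  "shift_obs i d = (\<lambda>(p, n, c). (p, (if target d i = None then 1 else 0) + n, loss i d + c))"

lemma measurable_shift_obs: "shift_obs i d \<in> OM \<rightarrow>\<^sub>M OM"
  unfolding shift_obs_def by measurable

lemma hist_Stream: "hist i (d ## \<omega>) (Suc k) = shift_obs i d (hist (succ_phase i d) \<omega> k)"
  by (simp add: hist_def shift_obs_def phase_chain_Stream card_claims_Suc claim_jump_Stream
    sum.lessThan_Suc_shift claim_at_Stream del: phase_chain.simps(2) sum.lessThan_Suc)

lemma observation_after:
  assumes "good_driver d" "good \<omega>" "0 \<le> t"
  shows "observation m i (hold i d + t) (d ## \<omega>) = shift_obs i d (observation m (succ_phase i d) t \<omega>)"
  using assms by (simp add: observation_eq_hist num_jumps_after hist_Stream)

lemma FI_compl: "A \<in> sets (FI i t) \<Longrightarrow> - A \<in> sets (FI i t)"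
  using sets.compl_sets[of A "FI i t"] by (simp add: Compl_eq_Diff_UNIV)

text \<open>For a fixed first driver, an observation before its jump is constant, and a later one is
  a function of an observation of the restarted process made \<open>hold i d\<close> earlier. If
  \<open>s\<close> precedes the jump, only events that are trivial up to null sets occur, hence the
  \<open>max 0\<close>.\<close>

lemma FI_shift:
  assumes "A \<in> sets (FI i s)" "0 \<le> s"
  shows "AE d in DM. {\<omega>. d ## \<omega> \<in> A} \<in> sets (FI (succ_phase i d) (max 0 (s - hold i d)))"
  using assms(1)
proof (induction rule: FI_induct)
  case (obs u B)
  show ?case using AE_good_driver
  proof eventually_elim
    case (elim d)
    show ?case
    proof (cases "u < hold i d")
      case True
      have U: "UNIV \<in> sets (FI j t)" for j t using sets.top[of "FI j t"] by simp
      show ?thesis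
      proof (rule FI_AE)
        show "(if (i, 0, 0) \<in> B then UNIV else {}) \<in> sets (FI (succ_phase i d) (max 0 (s - hold i d)))"
          by (simp add: U)
        show "AE \<omega> in P. (\<omega> \<in> (if (i, 0, 0) \<in> B then UNIV else {})) = (\<omega> \<in> {\<omega>. d ## \<omega> \<in> {\<omega>. observation m i u \<omega> \<in> B}})"
          using AE_good by eventually_elim (use True obs elim in \<open>simp add: observation_before\<close>)
      qed
    next
      case False
      show ?thesis
      proof (rule FI_AE)
        show "{\<omega>. observation m (succ_phase i d) (u - hold i d) \<omega> \<in> shift_obs i d -` B} \<in> sets (FI (succ_phase i d) (max 0 (s - hold i d)))"
          using measurable_sets[OF measurable_shift_obs obs(3), of i d] obs False
          by (intro FI_obs) (auto simp: space_pair_measure)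
        show "AE \<omega> in P. (\<omega> \<in> {\<omega>. observation m (succ_phase i d) (u - hold i d) \<omega> \<in> shift_obs i d -` B}) =
          (\<omega> \<in> {\<omega>. d ## \<omega> \<in> {\<omega>. observation m i u \<omega> \<in> B}})"
          using AE_good
        proof eventually_elim
          case (elim \<omega>)
          then show ?case using False \<open>good_driver d\<close> observation_after[of d \<omega> "u - hold i d" i] by simp
        qed
      qed
    qed
  qed
next
  case (null N)
  from AE_P_Stream[OF null] show ?case by eventually_elim (auto intro: FI_null)
next
  case (compl A)
  from compl(2) show ?case
  proof eventually_elim
    case (elim d)
    from FI_compl[OF elim] show ?case by (simp add: Collect_neg_eq)
  qed
next
  case (union A)
  have "AE d in DM. \<forall>n. {\<omega>. d ## \<omega> \<in> A n} \<in> sets (FI (succ_phase i d) (max 0 (s - hold i d)))"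
    unfolding AE_all_countable using union by blast
  then show ?case
  proof eventually_elim
    case (elim d)
    then have "(\<Union>n. {\<omega>. d ## \<omega> \<in> A n}) \<in> sets (FI (succ_phase i d) (max 0 (s - hold i d)))" by blast
    then show ?case by (simp add: Collect_ex_eq[symmetric] UN_iff)
  qed
qed

abbreviation shifted :: "'n \<Rightarrow> 'n driver \<Rightarrow> (real \<times> 'n driver stream) set \<Rightarrow> (real \<times> 'n driver stream) set" where
  "shifted i d C \<equiv> {(t, \<omega>). 0 \<le> t \<and> (hold i d + t, d ## \<omega>) \<in> C}"

lemma PR_shift:
  assumes "C \<in> sets (PR i)"
  shows "AE d in DM. shifted i d C \<in> sets (PR (succ_phase i d))"
  using assms
proof (induction rule: PR_induct)
  case (zero A)
  show ?case using AE_good_driver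
  proof eventually_elim
    case (elim d)
    have "shifted i d ({0} \<times> A) = {}"
      using good_driver_hold[OF elim, of i] by auto
    then show ?case by (simp only: sets.empty_sets)
  qed
next
  case (Ioc s u A)
  show ?case using AE_good_driver FI_shift[OF Ioc(3,1)]
  proof eventually_elim
    case (elim d)
    let ?A = "{\<omega>. d ## \<omega> \<in> A}" and ?h = "hold i d"
    show ?case
    proof (cases "?h \<le> s")
      case True
      then have "{(t, \<omega>). 0 \<le> t \<and> (?h + t, d ## \<omega>) \<in> {s<..u} \<times> A} = {s - ?h<..u - ?h} \<times> ?A" by auto
      with True elim(2) show ?thesis by (simp add: PR_Ioc max_absorb2)
    next
      \<comment> \<open>The rectangle begins before the jump. The jump time becomes time 0 of the
        restarted process, so a rectangle over \<open>{0}\<close> splits off.\<close>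
      case False
      then have A: "?A \<in> sets (FI (succ_phase i d) 0)" using elim by (simp add: max_absorb1)
      have "{(t, \<omega>). 0 \<le> t \<and> (?h + t, d ## \<omega>) \<in> {s<..u} \<times> A} =
        (if u < ?h then {} else {0} \<times> ?A \<union> {0<..u - ?h} \<times> ?A)" using False by auto
      moreover have "{0} \<times> ?A \<union> {0<..u - ?h} \<times> ?A \<in> sets (PR (succ_phase i d))"
        using A by (intro sets.Un PR_zero PR_Ioc) auto
      ultimately show ?thesis by (cases "u < ?h") (simp_all only: if_True if_False sets.empty_sets)
    qed
  qed
next
  case (compl C)
  from AE_good_driver compl(2) show ?case
  proof eventually_elim
    case (elim d)
    have "shifted i d ({0..} \<times> UNIV - C) =
       space (PR (succ_phase i d)) - shifted i d C"
      using good_driver_hold[OF elim(1), of i] by auto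
    with elim(2) show ?case by (simp only: sets.compl_sets)
  qed
next
  case (union C)
  have "AE d in DM. \<forall>n. shifted i d (C n) \<in> sets (PR (succ_phase i d))"
    unfolding AE_all_countable using union by blast
  then show ?case
  proof eventually_elim
    case (elim d)
    then have "(\<Union>n. shifted i d (C n)) \<in> sets (PR (succ_phase i d))" by blast
    also have "(\<Union>n. shifted i d (C n)) = shifted i d ((\<Union>n. C n))"
      by auto
    finally show ?case .
  qed
qed

text \<open>The exceptional drivers in \<open>PR_shift\<close> depend on the set, so only countably
  many level sets may be used; rational levels generate the others.\<close>

lemma measurable_PR_shift:
  fixes D :: "real \<times> 'n driver stream \<Rightarrow> real"
  assumes D: "D \<in> borel_measurable (PR i)"
  shows "AE d in DM. (\<lambda>(t, \<omega>). D (hold i d + t, d ## \<omega>)) \<in> borel_measurable (PR (succ_phase i d))"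
proof -
  have "AE d in DM. \<forall>q\<in>\<rat>. shifted i d {p \<in> space (PR i). q < D p} \<in> sets (PR (succ_phase i d))"
    using D by (intro AE_ball_countable'[OF _ countable_rat] PR_shift) measurable
  with AE_good_driver show ?thesis
  proof eventually_elim
    case (elim d)
    show ?case unfolding borel_measurable_iff_greater
    proof
      fix a :: real
      have "(\<Union>q\<in>\<rat> \<inter> {a<..}. shifted i d {p \<in> space (PR i). q < D p}) \<in> sets (PR (succ_phase i d))"
        using elim(2) by (intro sets.countable_UN'' countable_Int1 countable_rat) auto
      also have "(\<Union>q\<in>\<rat> \<inter> {a<..}. shifted i d {p \<in> space (PR i). q < D p}) =
        {w \<in> space (PR (succ_phase i d)). a < (\<lambda>(t, \<omega>). D (hold i d + t, d ## \<omega>)) w}"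
        (is "?L = ?R")
      proof (rule set_eqI, rule iffI)
        fix w assume "w \<in> ?R"
        then obtain t \<omega> where w: "w = (t, \<omega>)" "0 \<le> t" "a < D (hold i d + t, d ## \<omega>)" by auto
        from Rats_dense_in_real[OF w(3)] obtain q where "q \<in> \<rat>" "a < q" "q < D (hold i d + t, d ## \<omega>)" by auto
        with w good_driver_hold[OF elim(1), of i] show "w \<in> ?L" by (intro UN_I[of q]) auto
      qed auto
      finally show "?R \<in> sets (PR (succ_phase i d))" .
    qed
  qed
qed

section \<open>Strategies are deterministic up to the first jump\<close>

lemma AE_good_parts: "AE \<omega> in P. \<exists>d \<omega>'. \<omega> = d ## \<omega>' \<and> good_driver d \<and> good \<omega>'"
  using AE_P_shd[OF AE_good_driver] AE_P_stl[OF AE_good]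
proof eventually_elim
  case (elim \<omega>) then show ?case by (intro exI[of _ "shd \<omega>"] exI[of _ "stl \<omega>"]) auto
qed

abbreviation jumped :: "'n \<Rightarrow> 'n \<Rightarrow> (real \<times> 'n driver stream) set" where
  "jumped i j \<equiv> {(t, \<omega>). 0 \<le> t \<and> hold i (shd \<omega>) < t \<and> succ_phase i (shd \<omega>) = j}"

abbreviation after_jump :: "'n \<Rightarrow> real \<Rightarrow> 'n \<Rightarrow> 'n driver stream set \<Rightarrow> (real \<times> 'n driver stream) set" where
  "after_jump i s j A \<equiv> {(t, \<omega>). 0 \<le> t \<and> hold i (shd \<omega>) + s < t \<and> succ_phase i (shd \<omega>) = j \<and> stl \<omega> \<in> A}"

abbreviation pasted :: "'n \<Rightarrow> 'n \<Rightarrow> (real \<times> 'n driver stream) set \<Rightarrow> (real \<times> 'n driver stream) set" where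
  "pasted i j C \<equiv> {(t, \<omega>). 0 \<le> t \<and> hold i (shd \<omega>) < t \<and> succ_phase i (shd \<omega>) = j \<and> (t - hold i (shd \<omega>), stl \<omega>) \<in> C}"

text \<open>Until the first jump the observation is constantly \<open>(i, 0, 0)\<close>. On the
  event that no jump has occurred by time \<open>s\<close>, every event observable by then is
  therefore trivial.\<close>

lemma FI_before_jump:
  assumes "A \<in> sets (FI i s)" "0 \<le> s"
  shows "\<exists>c. AE \<omega> in P. s < hold i (shd \<omega>) \<longrightarrow> (\<omega> \<in> A \<longleftrightarrow> c)"
  using assms(1)
proof (induction rule: FI_induct)
  case (obs u B)
  from AE_good_parts have "AE \<omega> in P. s < hold i (shd \<omega>) \<longrightarrow> (observation m i u \<omega> \<in> B \<longleftrightarrow> (i, 0, 0) \<in> B)"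
    by eventually_elim (use obs observation_before in auto)
  then show ?case by auto
next
  case (null N)
  then have "AE \<omega> in P. s < hold i (shd \<omega>) \<longrightarrow> (\<omega> \<in> N \<longleftrightarrow> False)" by eventually_elim simp
  then show ?case ..
next
  case (compl A)
  then obtain c where "AE \<omega> in P. s < hold i (shd \<omega>) \<longrightarrow> (\<omega> \<in> A \<longleftrightarrow> c)" by blast
  then have "AE \<omega> in P. s < hold i (shd \<omega>) \<longrightarrow> (\<omega> \<in> - A \<longleftrightarrow> \<not> c)" by eventually_elim simp
  then show ?case ..
next
  case (union A)
  then have "\<forall>n. \<exists>c. AE \<omega> in P. s < hold i (shd \<omega>) \<longrightarrow> (\<omega> \<in> A n \<longleftrightarrow> c)" by blast
  from choice[OF this] obtain c where "\<forall>n. AE \<omega> in P. s < hold i (shd \<omega>) \<longrightarrow> (\<omega> \<in> A n \<longleftrightarrow> c n)" ..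
  then have "AE \<omega> in P. \<forall>n. s < hold i (shd \<omega>) \<longrightarrow> (\<omega> \<in> A n \<longleftrightarrow> c n)" by (rule AE_all_countable[THEN iffD2])
  then have "AE \<omega> in P. s < hold i (shd \<omega>) \<longrightarrow> (\<omega> \<in> (\<Union>n. A n) \<longleftrightarrow> (\<exists>n. c n))" by eventually_elim auto
  then show ?case ..
qed

abbreviation before_jump :: "'n \<Rightarrow> (real \<Rightarrow> 'n driver stream \<Rightarrow> bool) \<Rightarrow> bool" where
  "before_jump i Q \<equiv> (AE \<omega> in P. \<forall>t. 0 \<le> t \<and> t \<le> hold i (shd \<omega>) \<longrightarrow> Q t \<omega>)"

text \<open>The jump time itself is included: a rectangle \<open>{s<..u} \<times> A\<close> reaches
  it only if \<open>s\<close> lies strictly before the jump, and then \<open>A\<close> is trivial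
  there. This is the point where predictability, and not mere adaptedness, enters.\<close>

lemma PR_before_jump:
  assumes "C \<in> sets (PR i)"
  shows "\<exists>Z\<in>sets borel. before_jump i (\<lambda>t \<omega>. (t, \<omega>) \<in> C \<longleftrightarrow> t \<in> Z)"
  using assms
proof (induction rule: PR_induct)
  case (zero A)
  from FI_before_jump[OF zero] obtain c where "AE \<omega> in P. 0 < hold i (shd \<omega>) \<longrightarrow> (\<omega> \<in> A \<longleftrightarrow> c)" by blast
  then have "before_jump i (\<lambda>t \<omega>. (t, \<omega>) \<in> {0} \<times> A \<longleftrightarrow> t \<in> (if c then {0} else {}))"
    using AE_P_shd[OF AE_good_driver] by eventually_elim (use good_driver_hold in auto)
  then show ?case by - (rule bexI[where x = "if c then {0} else {}"], assumption, simp)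
next
  case (Ioc s u A)
  from FI_before_jump[OF Ioc(3,1)] obtain c where "AE \<omega> in P. s < hold i (shd \<omega>) \<longrightarrow> (\<omega> \<in> A \<longleftrightarrow> c)" by blast
  then have "before_jump i (\<lambda>t \<omega>. (t, \<omega>) \<in> {s<..u} \<times> A \<longleftrightarrow> t \<in> (if c then {s<..u} else {}))"
    by eventually_elim auto
  then show ?case by - (rule bexI[where x = "if c then {s<..u} else {}"], assumption, simp)
next
  case (compl C)
  then obtain Z where Z: "Z \<in> sets borel" "before_jump i (\<lambda>t \<omega>. (t, \<omega>) \<in> C \<longleftrightarrow> t \<in> Z)" by blast
  from Z(2) have "before_jump i (\<lambda>t \<omega>. (t, \<omega>) \<in> {0..} \<times> UNIV - C \<longleftrightarrow> t \<in> - Z)"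
    by eventually_elim auto
  moreover have "- Z \<in> sets borel" using Z(1) by (rule borel_comp)
  ultimately show ?case by - (rule bexI[where x = "- Z"], assumption+)
next
  case (union C)
  have "\<forall>n. \<exists>Z. Z \<in> sets borel \<and> before_jump i (\<lambda>t \<omega>. (t, \<omega>) \<in> C n \<longleftrightarrow> t \<in> Z)"
    using union(2) by blast
  from choice[OF this] obtain Z where Z: "\<And>n. Z n \<in> sets borel"
    "\<And>n. before_jump i (\<lambda>t \<omega>. (t, \<omega>) \<in> C n \<longleftrightarrow> t \<in> Z n)" by auto
  have "AE \<omega> in P. \<forall>n. \<forall>t. 0 \<le> t \<and> t \<le> hold i (shd \<omega>) \<longrightarrow> ((t, \<omega>) \<in> C n \<longleftrightarrow> t \<in> Z n)"
    by (intro AE_all_countable[THEN iffD2] allI Z(2))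
  then have "before_jump i (\<lambda>t \<omega>. (t, \<omega>) \<in> (\<Union>n. C n) \<longleftrightarrow> t \<in> (\<Union>n. Z n))"
    by eventually_elim auto
  moreover have "(\<Union>n. Z n) \<in> sets borel" using Z(1) by blast
  ultimately show ?case by - (rule bexI[where x = "\<Union>n. Z n"], assumption+)
qed

lemma measurable_PR_before_jump:
  fixes g :: "real \<times> 'n driver stream \<Rightarrow> ennreal"
  assumes "g \<in> borel_measurable (PR i)"
  shows "\<exists>f\<in>borel_measurable borel. before_jump i (\<lambda>t \<omega>. g (t, \<omega>) = f t)"
  using assms
proof (induction rule: borel_measurable_induct)
  case (cong f g)
  then show ?case by simp
next
  case (set C)
  from PR_before_jump[OF set] obtain Z where Z: "Z \<in> sets borel" "before_jump i (\<lambda>t \<omega>. (t, \<omega>) \<in> C \<longleftrightarrow> t \<in> Z)" by blast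
  from Z(2) have "before_jump i (\<lambda>t \<omega>. (indicator C (t, \<omega>) :: ennreal) = indicator Z t)"
    by eventually_elim (auto simp: indicator_def)
  moreover have "indicator Z \<in> borel_measurable borel" using Z(1) by simp
  ultimately show ?case by - (rule bexI[where x = "indicator Z"], assumption+)
next
  case (mult u c)
  then obtain f where [measurable]: "f \<in> borel_measurable borel" and f: "before_jump i (\<lambda>t \<omega>. u (t, \<omega>) = f t)" by blast
  from f have "before_jump i (\<lambda>t \<omega>. c * u (t, \<omega>) = c * f t)" by eventually_elim auto
  then show ?case by - (rule bexI[where x = "\<lambda>t. c * f t"], assumption, measurable)
next
  case (add u v)
  then obtain f g where [measurable]: "f \<in> borel_measurable borel" "g \<in> borel_measurable borel"
    and f: "before_jump i (\<lambda>t \<omega>. u (t, \<omega>) = f t)" and g: "before_jump i (\<lambda>t \<omega>. v (t, \<omega>) = g t)" by blast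
  from f g have "before_jump i (\<lambda>t \<omega>. v (t, \<omega>) + u (t, \<omega>) = g t + f t)" by eventually_elim auto
  then show ?case by - (rule bexI[where x = "\<lambda>t. g t + f t"], assumption, measurable)
next
  case (seq U)
  have "\<forall>n. \<exists>f. f \<in> borel_measurable borel \<and> before_jump i (\<lambda>t \<omega>. U n (t, \<omega>) = f t)"
    using seq by blast
  from choice[OF this] obtain f where [measurable]: "\<And>n. f n \<in> borel_measurable borel"
    and f: "\<And>n. before_jump i (\<lambda>t \<omega>. U n (t, \<omega>) = f n t)" by auto
  have "AE \<omega> in P. \<forall>n. \<forall>t. 0 \<le> t \<and> t \<le> hold i (shd \<omega>) \<longrightarrow> U n (t, \<omega>) = f n t"
    by (intro AE_all_countable[THEN iffD2] allI f)
  then have "before_jump i (\<lambda>t \<omega>. (SUP n. U n) (t, \<omega>) = (SUP n. f n t))"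
    by eventually_elim (auto simp: image_comp)
  then show ?case by - (rule bexI[where x = "\<lambda>t. SUP n. f n t"], assumption, measurable)
qed

section \<open>Predictability of processes pasted in at the first jump\<close>

lemma measurable_JM_fst [measurable]: "fst \<in> borel_measurable JM"
  using measurable_PR_JM[OF measurable_PR_fst] .

lemma measurable_P_shd: "f \<in> DM \<rightarrow>\<^sub>M N \<Longrightarrow> (\<lambda>\<omega>. f (shd \<omega>)) \<in> P \<rightarrow>\<^sub>M N"
  by (intro measurable_P_S0 measurable_compose[OF measurable_shd])

lemma JM_paste:
  assumes A: "A \<in> sets P"
  shows "after_jump i s j A \<in> sets JM"
proof -
  have [measurable]: "(\<lambda>\<omega>. hold i (shd \<omega>)) \<in> borel_measurable P" by (rule measurable_P_shd) simp
  have [measurable]: "(\<lambda>\<omega>. succ_phase i (shd \<omega>)) \<in> P \<rightarrow>\<^sub>M count_space UNIV" by (rule measurable_P_shd) simp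
  have "stl -` A \<inter> space P \<in> sets P" by (rule measurable_sets[OF measurable_stl_P A])
  then have [measurable]: "stl -` A \<in> sets P" by simp
  have "{p \<in> space JM. hold i (shd (snd p)) + s < fst p \<and> succ_phase i (shd (snd p)) = j \<and> snd p \<in> stl -` A} \<in> sets JM"
    by measurable
  also have "{p \<in> space JM. hold i (shd (snd p)) + s < fst p \<and> succ_phase i (shd (snd p)) = j \<and> snd p \<in> stl -` A} =
    after_jump i s j A" by auto
  finally show ?thesis .
qed

text \<open>The observation of the restarted process at time \<open>v\<close> has to be recovered
  from jumps of the original process strictly before \<open>t\<close>. This is possible because the
  first jump time plus \<open>v\<close> lies before \<open>t\<close>: the observation is the history
  at the last jump up to that moment, with the claim count and amount of the first jump
  subtracted.\<close>

lemma PR_paste_aux: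
  assumes "0 \<le> s" "0 \<le> v" "v \<le> s" and B: "B \<in> sets OM"
  shows "{(t, \<omega>). 0 \<le> t \<and> hold i (shd \<omega>) + s < t \<and> succ_phase i (shd \<omega>) = j \<and> observation m j v (stl \<omega>) \<in> B} \<in> sets (PR i)"
    (is "?C' \<in> _")
proof (rule PR_AE)
  note [measurable] = measurable_PR_fst PR_past measurable_cut_time
  have h [measurable]: "(\<lambda>p. fst (cut_hist i k p)) \<in> PR i \<rightarrow>\<^sub>M count_space UNIV"
    "(\<lambda>p. fst (snd (cut_hist i k p))) \<in> PR i \<rightarrow>\<^sub>M count_space UNIV"
    "(\<lambda>p. snd (snd (cut_hist i k p))) \<in> borel_measurable (PR i)" for k
    by (rule measurable_compose[OF measurable_cut_hist], measurable)+
  let ?h = "\<lambda>k p. (fst (cut_hist i k p), fst (snd (cut_hist i k p)) - fst (snd (cut_hist i 1 p)),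
      snd (snd (cut_hist i k p)) - snd (snd (cut_hist i 1 p)))"
  have hh: "?h k \<in> PR i \<rightarrow>\<^sub>M OM" for k by measurable
  have [measurable]: "Measurable.pred (PR i) (\<lambda>p. ?h k p \<in> B)" for k
    using measurable_sets[OF hh[of k] B] by (simp add: pred_def vimage_def Int_def conj_commute)
  \<comment> \<open>The bound \<open>k\<close> is the number of jumps of the restarted process up to
    time \<open>v\<close>; it appears as \<open>Suc k\<close> because jump 1 is the restart
    itself.\<close>
  let ?C = "{p \<in> space (PR i). cut_time i 1 p + s < fst p \<and> jump_time m i (snd p) 1 < fst p \<and>
     fst (cut_hist i 1 p) = j \<and>
     (\<exists>k. jump_time m i (snd p) (Suc k) < fst p \<and> cut_time i (Suc k) p \<le> cut_time i 1 p + v \<and>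
       \<not> (jump_time m i (snd p) (Suc (Suc k)) < fst p \<and> cut_time i (Suc (Suc k)) p \<le> cut_time i 1 p + v) \<and>
       ?h (Suc k) p \<in> B)}"
  show "?C \<in> sets (PR i)" by measurable
  show "?C' \<in> sets JM"
  proof -
    have "observation m j v -` B \<inter> space P \<in> sets P"
      by (rule measurable_sets[OF measurable_P_S0[OF measurable_observation] B])
    then show ?thesis by (intro JM_paste[of "{\<omega>. observation m j v \<omega> \<in> B}", simplified]) (simp add: vimage_def)
  qed
  show "AE \<omega> in P. \<forall>t\<ge>0. (t, \<omega>) \<in> ?C \<longleftrightarrow> (t, \<omega>) \<in> ?C'"
    using AE_good_parts
  proof eventually_elim
    case (elim \<omega>')
    from elim obtain d \<omega> where w: "\<omega>' = d ## \<omega>" and good: "good_driver d" "good \<omega>" by blast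
    let ?T = "jump_time m (succ_phase i d) \<omega>"
    obtain K where K: "?T K \<le> v" "v < ?T (Suc K)" using jump_interval_ex[OF good(2) \<open>0 \<le> v\<close>] by blast
    have obs: "observation m (succ_phase i d) v \<omega> = hist (succ_phase i d) \<omega> K"
      using num_jumps_eq[OF good(2) K] by (simp add: observation_eq_hist)
    have T0: "0 \<le> ?T k" for k by (rule jump_time_nonneg[OF good(2)])
    have uniq: "k = K" if "?T k \<le> v" "\<not> ?T (Suc k) \<le> v" for k
      using num_jumps_eq[OF good(2), of "succ_phase i d" k v] num_jumps_eq[OF good(2) K] that by simp
    have J1: "jump_time m i (d ## \<omega>) 1 = hold i d" by (simp add: jump_time_Stream)
    have H1: "hist i (d ## \<omega>) 1 = shift_obs i d (succ_phase i d, 0, 0)"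
      using hist_Stream[of i d \<omega> 0] by (simp add: hist_def)
    have H: "?h (Suc k) (t, d ## \<omega>) = hist (succ_phase i d) \<omega> k" if "hold i d < t" "hold i d + ?T k < t" for k t
      using that J1 H1 hist_Stream[of i d \<omega> k]
      by (auto simp: cut_hist_def jump_time_Stream shift_obs_def split: prod.splits)
    have "(t, \<omega>') \<in> ?C \<longleftrightarrow> (t, \<omega>') \<in> ?C'" if t: "0 \<le> t" for t
    proof (cases "hold i d + s < t \<and> succ_phase i d = j")
      case True
      then have lt: "hold i d < t" using \<open>0 \<le> s\<close> by linarith
      have "(t, d ## \<omega>) \<in> ?C \<longleftrightarrow> (\<exists>k. hold i d + ?T k < t \<and> ?T k \<le> v \<and>
        \<not> (hold i d + ?T (Suc k) < t \<and> ?T (Suc k) \<le> v) \<and> hist (succ_phase i d) \<omega> k \<in> B)"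
        using True lt t H J1 H1
        by (auto simp: cut_time_def cut_hist_def jump_time_Stream shift_obs_def)
      also have "\<dots> \<longleftrightarrow> (\<exists>k. ?T k \<le> v \<and> \<not> ?T (Suc k) \<le> v \<and> hist (succ_phase i d) \<omega> k \<in> B)"
        using True \<open>v \<le> s\<close> by (intro arg_cong[of _ _ Ex] ext) auto
      also have "\<dots> \<longleftrightarrow> hist (succ_phase i d) \<omega> K \<in> B" using uniq K by (metis not_le)
      also have "\<dots> \<longleftrightarrow> (t, d ## \<omega>) \<in> ?C'" using True t obs by auto
      finally show ?thesis unfolding w .
    next
      case False
      then show ?thesis using H1 J1 by (auto simp: w cut_time_def cut_hist_def jump_time_Stream shift_obs_def)
    qed
    then show ?case by blast
  qed
qed

lemma PR_paste_past:
  assumes "A \<in> sets (FI j s)" "0 \<le> s"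
  shows "after_jump i s j A \<in> sets (PR i)"
  using assms(1)
proof (induction rule: FI_induct)
  case (obs u B)
  then show ?case using PR_paste_aux[OF assms(2) obs(1,2,3)] by simp
next
  case (null N)
  have "N \<in> sets P" using null null_sets_P_iff by blast
  from JM_paste[OF this] show ?case
    by (rule PR_null[where N = "{\<omega>. stl \<omega> \<in> N}"]) (use AE_P_stl[OF null] in auto)
next
  case (compl A)
  \<comment> \<open>The case \<open>v = 0\<close> and \<open>B = UNIV\<close> of the previous lemma
    gives the set relative to which complements are taken.\<close>
  have "after_jump i s j UNIV \<in> sets (PR i)"
    using PR_paste_aux[of s 0 UNIV] assms(2) sets.top[of OM] by (simp add: space_pair_measure)
  with compl(2) have "after_jump i s j UNIV
    - after_jump i s j A \<in> sets (PR i)" by (intro sets.Diff)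
  also have "after_jump i s j UNIV
    - after_jump i s j A
    = after_jump i s j (- A)" by auto
  finally show ?case .
next
  case (union A)
  have "(\<Union>n. after_jump i s j (A n)) \<in> sets (PR i)"
    using union(2) by blast
  also have "(\<Union>n. after_jump i s j (A n)) =
    after_jump i s j ((\<Union>n. A n))" by auto
  finally show ?case .
qed

lemma PR_paste_base: "(jumped i j) \<in> sets (PR i)"
  using PR_paste_past[of UNIV j 0 i] sets.top[of "FI j 0"] by simp

lemma PR_paste:
  assumes "C \<in> sets (PR j)"
  shows "pasted i j C \<in> sets (PR i)"
  using assms
proof (induction rule: PR_induct)
  case (zero A)
  have "pasted i j ({0} \<times> A) = {}"
    by auto
  then show ?case by (simp only: sets.empty_sets)
next
  case (Ioc s u A)
  \<comment> \<open>\<open>A\<close> is still an event at the later time \<open>u\<close>, so the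
    left-open rectangle becomes a difference of two sets of the form
    \<open>after_jump\<close>.\<close>
  then have "A \<in> sets (FI j u)" by (intro FI_mono[of s u]) auto
  then have "after_jump i s j A -
    {(t, \<omega>). 0 \<le> t \<and> hold i (shd \<omega>) + u < t \<and> succ_phase i (shd \<omega>) = j \<and> stl \<omega> \<in> A} \<in> sets (PR i)"
    using Ioc by (intro sets.Diff PR_paste_past) auto
  also have "after_jump i s j A -
    {(t, \<omega>). 0 \<le> t \<and> hold i (shd \<omega>) + u < t \<and> succ_phase i (shd \<omega>) = j \<and> stl \<omega> \<in> A} =
    pasted i j ({s<..u} \<times> A)"
    using Ioc(1) by auto
  finally show ?case .
next
  case (compl C)
  have "(jumped i j) -
     pasted i j C \<in> sets (PR i)"
    by (intro sets.Diff PR_paste_base compl(2))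
  also have "(jumped i j) -
     pasted i j C =
     pasted i j ({0..} \<times> UNIV - C)"
    by auto
  finally show ?case .
next
  case (union C)
  have "(\<Union>n. pasted i j (C n)) \<in> sets (PR i)"
    using union(2) by blast
  also have "(\<Union>n. pasted i j (C n)) =
    pasted i j ((\<Union>n. C n))" by auto
  finally show ?case .
qed

lemma measurable_PR_paste:
  fixes E :: "real \<times> 'n driver stream \<Rightarrow> real"
  assumes E: "E \<in> borel_measurable (PR j)"
  shows "(\<lambda>(t, \<omega>). if hold i (shd \<omega>) < t \<and> succ_phase i (shd \<omega>) = j then E (t - hold i (shd \<omega>), stl \<omega>) else 0)
    \<in> borel_measurable (PR i)" (is "?f \<in> _")
proof (rule measurableI)
  fix B :: "real set" assume "B \<in> sets borel"
  then have C: "E -` B \<inter> space (PR j) \<in> sets (PR j)" using E by (rule measurable_sets[rotated])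
  let ?X = "pasted i j (E -` B \<inter> space (PR j))"
  let ?Y = "space (PR i) - (jumped i j)"
  have "?X \<in> sets (PR i)" "?X \<union> ?Y \<in> sets (PR i)"
    using PR_paste[OF C, of i] PR_paste_base[of i j] by (blast intro: sets.Un sets.compl_sets)+
  moreover have "?f -` B \<inter> space (PR i) = (if 0 \<in> B then ?X \<union> ?Y else ?X)"
    by (auto split: if_splits)
  ultimately show "?f -` B \<inter> space (PR i) \<in> sets (PR i)" by (cases "0 \<in> B") (simp_all only: if_True if_False)
qed simp

end

section \<open>Discounted dividends of a single path\<close>

definition regular_path :: "(real \<Rightarrow> real) \<Rightarrow> bool" where
  "regular_path a \<longleftrightarrow> a 0 = 0 \<and> mono_on {0..} a \<and> (\<forall>t>0. continuous (at_left t) a)"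

lemma regular_path_mono: "regular_path a \<Longrightarrow> 0 \<le> s \<Longrightarrow> s \<le> t \<Longrightarrow> a s \<le> a t"
  by (auto simp: regular_path_def mono_on_def)

lemma regular_path_nonneg: "regular_path a \<Longrightarrow> 0 \<le> t \<Longrightarrow> 0 \<le> a t"
  using regular_path_mono[of a 0 t] by (simp add: regular_path_def)

lemma regular_path_lim: "regular_path a \<Longrightarrow> 0 < t \<Longrightarrow> (a \<longlongrightarrow> a t) (at_left t)"
  by (simp add: regular_path_def continuous_within)

section \<open>The Stieltjes measure of a dividend path\<close>

definition right_limit :: "(real \<Rightarrow> real) \<Rightarrow> real \<Rightarrow> real" where
  "right_limit a t = (if t < 0 then 0 else Lim (at_right t) a)"

text \<open>For an increasing path the right limit is an infimum over later times, which reduces the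
  estimates that follow to order arguments.\<close>

lemma Lim_at_right_mono:
  fixes a :: "real \<Rightarrow> real"
  assumes "mono_on {0..} a" "0 \<le> t"
  shows "Lim (at_right t) a = Inf (a ` {t<..})"
proof (rule tendsto_Lim)
  have bdd: "bdd_below (a ` {t<..})"
    using assms by (intro bdd_belowI[of _ "a t"]) (auto simp: mono_on_def)
  have ne: "a ` {t<..} \<noteq> {}" by simp
  show "(a \<longlongrightarrow> Inf (a ` {t<..})) (at_right t)"
  proof (rule order_tendstoI)
    fix y assume "y < Inf (a ` {t<..})"
    then have "y < a s" if "t < s" for s using that cInf_lower[OF _ bdd, of "a s"] by force
    then show "\<forall>\<^sub>F s in at_right t. y < a s"
      by (auto simp: eventually_at_right[of t "t + 1"] intro: exI[of _ "t + 1"])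
  next
    fix y assume "Inf (a ` {t<..}) < y"
    then obtain s where s: "t < s" "a s < y" using cInf_lessD[OF ne] by auto
    have "a u < y" if "t < u" "u < s" for u
      using assms that s by (auto simp: mono_on_def intro: le_less_trans[of _ "a s"])
    then show "\<forall>\<^sub>F u in at_right t. a u < y"
      using s(1) by (auto simp: eventually_at_right[OF s(1)])
  qed
qed simp

context
  fixes a :: "real \<Rightarrow> real"
  assumes reg: "regular_path a"
begin

lemma right_limit_eq: "0 \<le> t \<Longrightarrow> right_limit a t = Inf (a ` {t<..})"
  using reg Lim_at_right_mono[of a t] by (simp add: right_limit_def regular_path_def)

lemma right_limit_bdd: "0 \<le> t \<Longrightarrow> bdd_below (a ` {t<..})"
  using regular_path_mono[OF reg] by (intro bdd_belowI[of _ "a t"]) auto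

lemma right_limit_le: "0 \<le> t \<Longrightarrow> t < s \<Longrightarrow> right_limit a t \<le> a s"
  unfolding right_limit_eq by (rule cInf_lower) (auto intro: right_limit_bdd)

lemma right_limit_ge: "0 \<le> t \<Longrightarrow> a t \<le> right_limit a t"
  unfolding right_limit_eq using regular_path_mono[OF reg] by (intro cInf_greatest) auto

lemma right_limit_mono: "s \<le> t \<Longrightarrow> right_limit a s \<le> right_limit a t"
proof (cases "0 \<le> s")
  case True
  assume "s \<le> t"
  then show ?thesis using True right_limit_le[of s t] right_limit_ge[of t] by (cases "s = t") auto
next
  case False
  assume "s \<le> t"
  show ?thesis
  proof (cases "0 \<le> t")
    case True
    then have "0 \<le> right_limit a t" using right_limit_ge[of t] regular_path_nonneg[OF reg, of t] by linarith
    then show ?thesis using False by (simp add: right_limit_def)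
  qed (use False in \<open>simp add: right_limit_def\<close>)
qed

lemma right_limit_continuous: "continuous (at_right t) (right_limit a)"
  unfolding continuous_within
proof (rule order_tendstoI)
  fix y assume "y < right_limit a t"
  then show "\<forall>\<^sub>F s in at_right t. y < right_limit a s"
    using right_limit_mono[of t] by (auto simp: eventually_at_right[of t "t + 1"] intro!: exI[of _ "t + 1"] intro: less_le_trans)
next
  fix y assume y: "right_limit a t < y"
  show "\<forall>\<^sub>F s in at_right t. right_limit a s < y"
  proof (cases "0 \<le> t")
    case True
    with y obtain s where s: "t < s" "a s < y" using cInf_lessD[of "a ` {t<..}" y] by (auto simp: right_limit_eq)
    have "right_limit a u < y" if "t < u" "u < s" for u
      using right_limit_le[of u s] that s True by linarith
    then show ?thesis using s(1) by (auto simp: eventually_at_right[OF s(1)])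
  next
    case False
    then have "t < 0" by simp
    then show ?thesis using y by (auto simp: eventually_at_right[OF \<open>t < 0\<close>] right_limit_def intro!: exI[of _ 0])
  qed
qed

text \<open>The right limits are squeezed between \<open>a\<close> at the approaching points and
  \<open>a s\<close>, and left-continuity closes the gap. At \<open>s = 0\<close> the points are
  negative, where the extension is 0.\<close>

lemma right_limit_tendsto:
  assumes "0 \<le> s"
  shows "(\<lambda>n. right_limit a (s - 1 / real (Suc n))) \<longlonglongrightarrow> a s"
proof (cases "s = 0")
  case True
  then show ?thesis using reg by (simp add: right_limit_def regular_path_def)
next
  case False
  with assms have s: "0 < s" by simp
  let ?u = "\<lambda>n. s - 1 / real (Suc n)"
  have u: "?u \<longlonglongrightarrow> s" by real_asymp
  have ev: "\<forall>\<^sub>F n in sequentially. 0 < ?u n" using order_tendstoD(1)[OF u s] .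
  have "filterlim ?u (at_left s) sequentially"
    using u by (simp add: filterlim_at)
  then have "(\<lambda>n. a (?u n)) \<longlonglongrightarrow> a s"
    by (rule filterlim_compose[OF regular_path_lim[OF reg s]])
  moreover have "\<forall>\<^sub>F n in sequentially. a (?u n) \<le> right_limit a (?u n)"
    using ev by (rule eventually_mono) (rule right_limit_ge, simp)
  moreover have "\<forall>\<^sub>F n in sequentially. right_limit a (?u n) \<le> a s"
    using ev by (rule eventually_mono) (rule right_limit_le, simp_all)
  ultimately show ?thesis
    by - (rule tendsto_sandwich[of "\<lambda>n. a (?u n)" _ _ "\<lambda>n. a s"], assumption+, rule tendsto_const)
qed

text \<open>Starting below 0, where \<open>right_limit a\<close> vanishes, captures the atom at 0.
  With the left end -1 the approximating intervals have ordered end points for every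
  \<open>s \<ge> 0\<close>.\<close>

lemma emeasure_right_limit_lessThan:
  assumes "0 \<le> s"
  shows "emeasure (interval_measure (right_limit a)) {-1<..<s} = ennreal (a s)"
proof -
  let ?\<mu> = "interval_measure (right_limit a)"
  let ?A = "\<lambda>n. {-1<..s - 1 / real (Suc n)}"
  have E: "emeasure ?\<mu> (?A n) = ennreal (right_limit a (s - 1 / real (Suc n)))" for n
  proof -
    have "1 / real (Suc n) \<le> 1" by simp
    then have "-1 \<le> s - 1 / real (Suc n)" using assms by linarith
    then have "emeasure ?\<mu> (?A n) = ennreal (right_limit a (s - 1 / real (Suc n)) - right_limit a (-1))"
      by (intro emeasure_interval_measure_Ioc right_limit_mono right_limit_continuous)
    then show ?thesis by (simp add: right_limit_def[of a "-1"])
  qed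
  have "incseq ?A"
  proof (rule incseq_SucI)
    fix n have "1 / real (Suc (Suc n)) \<le> 1 / real (Suc n)" by (simp add: frac_le)
    then show "?A n \<subseteq> ?A (Suc n)" by auto
  qed
  moreover have "range ?A \<subseteq> sets ?\<mu>" by auto
  ultimately have "(\<lambda>n. emeasure ?\<mu> (?A n)) \<longlonglongrightarrow> emeasure ?\<mu> (\<Union>n. ?A n)"
    by (rule Lim_emeasure_incseq[rotated])
  also have "(\<Union>n. ?A n) = {-1<..<s}"
  proof (intro set_eqI iffI)
    fix t assume "t \<in> {-1<..<s}"
    then obtain n where "1 / real (Suc n) < s - t" using reals_Archimedean[of "s - t"] by (auto simp: inverse_eq_divide)
    then show "t \<in> (\<Union>n. ?A n)" using \<open>t \<in> {-1<..<s}\<close> by (intro UN_I[of n]) auto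
  next
    fix t assume "t \<in> (\<Union>n. ?A n)"
    then obtain n where "-1 < t" "t \<le> s - 1 / real (Suc n)" by auto
    moreover have "0 < 1 / real (Suc n)" by simp
    ultimately have "-1 < t" "t < s" by linarith+
    then show "t \<in> {-1<..<s}" by simp
  qed
  finally have "(\<lambda>n. ennreal (right_limit a (s - 1 / real (Suc n)))) \<longlonglongrightarrow> emeasure ?\<mu> {-1<..<s}"
    by (simp only: E)
  moreover have "(\<lambda>n. ennreal (right_limit a (s - 1 / real (Suc n)))) \<longlonglongrightarrow> ennreal (a s)"
    by (intro tendsto_ennrealI right_limit_tendsto assms)
  ultimately show ?thesis by (rule LIMSEQ_unique)
qed

lemma emeasure_right_limit_Ico:
  assumes "0 \<le> s"
  shows "emeasure (interval_measure (right_limit a)) {0..<s} = ennreal (a s)"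
proof -
  let ?\<mu> = "interval_measure (right_limit a)"
  have 0: "emeasure ?\<mu> {-1<..<0} = 0"
    using emeasure_right_limit_lessThan[of 0] reg by (simp add: regular_path_def)
  have "emeasure ?\<mu> {-1<..<s} = emeasure ?\<mu> ({-1<..<0} \<union> {0..<s})"
    using assms by (intro arg_cong[of _ _ "emeasure ?\<mu>"]) auto
  also have "\<dots> = emeasure ?\<mu> {-1<..<0} + emeasure ?\<mu> {0..<s}"
    by (intro plus_emeasure[symmetric]) auto
  finally show ?thesis using 0 emeasure_right_limit_lessThan[OF assms] by simp
qed

end

text \<open>This is \<open>min s T\<close> as a real number, where \<open>T\<close> may be infinite;
  the outer \<open>max 0\<close> keeps the value in the domain of a path for all arguments.\<close>

definition stop :: "ereal \<Rightarrow> real \<Rightarrow> real" where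
  "stop T s = max 0 (real_of_ereal (min (ereal s) T))"

lemma stop_ereal: "0 \<le> t \<Longrightarrow> 0 \<le> s \<Longrightarrow> stop (ereal t) s = min s t"
  by (cases "s \<le> t") (simp_all add: stop_def min_def)

lemma stop_PInf: "0 \<le> s \<Longrightarrow> stop \<infinity> s = s"
  by (simp add: stop_def)

lemma stop_nonneg: "0 \<le> stop T s"
  by (simp add: stop_def)

lemma stop_le: "0 \<le> s \<Longrightarrow> 0 \<le> T \<Longrightarrow> stop T s \<le> s"
  by (cases T) (auto simp: stop_ereal stop_PInf zero_ereal_def[symmetric])

lemma stop_le_time: "0 \<le> s \<Longrightarrow> 0 \<le> T \<Longrightarrow> ereal (stop T s) \<le> T"
  by (cases T) (auto simp: stop_ereal stop_PInf)

lemma stop_mono: "0 \<le> s \<Longrightarrow> 0 \<le> T \<Longrightarrow> T \<le> T' \<Longrightarrow> stop T s \<le> stop T' s"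
  by (cases T; cases T') (auto simp: stop_ereal stop_PInf)

lemma measurable_stop [measurable]:
  assumes [measurable]: "f \<in> borel_measurable M" "g \<in> borel_measurable M"
  shows "(\<lambda>x. stop (f x) (g x)) \<in> borel_measurable M"
  unfolding stop_def by measurable

lemma measurable_regular_path:
  assumes "regular_path a"
  shows "(\<lambda>s. a (max 0 s)) \<in> borel_measurable borel"
  by (intro borel_measurable_mono) (auto simp: mono_def intro!: regular_path_mono[OF assms])

context risk_process
begin

text \<open>Integration by parts turns the discounted dividends into a Lebesgue integral of the path itself;
  by left-continuity \<open>a (stop T s)\<close> is the amount paid at times less than \<open>min s T\<close>.\<close>

definition disc :: "(real \<Rightarrow> real) \<Rightarrow> ereal \<Rightarrow> ennreal" where
  "disc a T = (\<integral>\<^sup>+ s. ennreal (exponential_density (discount m) s) * ennreal (a (stop T s)) \<partial>lborel)"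

lemma measurable_disc_integrand:
  assumes "regular_path a"
  shows "(\<lambda>s. ennreal (a (stop T s))) \<in> borel_measurable borel"
proof -
  have "(\<lambda>s. a (max 0 (stop T s))) \<in> borel_measurable borel"
    by (rule measurable_compose[OF _ measurable_regular_path[OF assms]]) measurable
  moreover have "max 0 (stop T s) = stop T s" for s using stop_nonneg[of T s] by simp
  ultimately show ?thesis by simp
qed

lemma disc_cong:
  assumes "0 \<le> T" "\<And>t. 0 \<le> t \<Longrightarrow> ereal t \<le> T \<Longrightarrow> a t = b t"
  shows "disc a T = disc b T"
  unfolding disc_def
proof (rule nn_integral_cong)
  fix s
  show "ennreal (exponential_density (discount m) s) * ennreal (a (stop T s)) =
    ennreal (exponential_density (discount m) s) * ennreal (b (stop T s))"
    using assms stop_nonneg[of T s] stop_le_time[of s T]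
    by (cases "0 \<le> s") (auto simp: exponential_density_def)
qed

lemma disc_mono:
  assumes "\<And>s. 0 \<le> s \<Longrightarrow> a (stop T s) \<le> b (stop T' s)"
  shows "disc a T \<le> disc b T'"
  unfolding disc_def
proof (rule nn_integral_mono)
  fix s
  show "ennreal (exponential_density (discount m) s) * ennreal (a (stop T s)) \<le>
    ennreal (exponential_density (discount m) s) * ennreal (b (stop T' s))"
    using assms by (cases "0 \<le> s") (auto simp: exponential_density_def intro!: mult_left_mono ennreal_leI)
qed

text \<open>Reads the discount factor as the probability that an exponential time of rate
  \<open>discount m\<close> exceeds \<open>t\<close>. This turns discounting into an average over
  paths stopped at such a time.\<close>

lemma exp_tail:
  assumes "0 \<le> t"
  shows "(\<integral>\<^sup>+ s. ennreal (exponential_density (discount m) s) * indicator {t<..} s \<partial>lborel) = ennreal (exp (- discount m * t))"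
proof -
  let ?d = "discount m"
  have "(\<integral>\<^sup>+ s. ennreal (exponential_density ?d s) * indicator {t<..} s \<partial>lborel) =
    (\<integral>\<^sup>+ s. ennreal (?d * exp (- ?d * s)) * indicator {t..} s \<partial>lborel)"
  proof (rule nn_integral_cong_AE)
    show "AE s in lborel. ennreal (exponential_density ?d s) * indicator {t<..} s = ennreal (?d * exp (- ?d * s)) * indicator {t..} s"
      using AE_lborel_singleton[of t]
    proof eventually_elim
      case (elim s)
      then show ?case using assms by (cases "t < s") (auto simp: exponential_density_def algebra_simps)
    qed
  qed
  also have "\<dots> = ennreal (0 - (- exp (- ?d * t)))"
  proof (rule nn_integral_FTC_atLeast)
    show "((\<lambda>s. - exp (- ?d * s)) \<longlongrightarrow> 0) at_top" using discount_pos by real_asymp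
  qed (use discount_pos in \<open>auto intro!: derivative_eq_intros\<close>)
  finally show ?thesis by simp
qed

lemma discounted_dividends_eq_disc:
  assumes reg: "regular_path (\<lambda>t. D t \<omega>)" and T: "0 \<le> T"
  shows "discounted_dividends m D T \<omega> = disc (\<lambda>t. D t \<omega>) T"
proof -
  let ?a = "\<lambda>t. D t \<omega>" and ?d = "discount m"
  let ?\<mu> = "interval_measure (right_limit ?a)"
  interpret I: sigma_finite_measure ?\<mu>
    by (intro sigma_finite_interval_measure right_limit_mono right_limit_continuous reg)
  interpret pair_sigma_finite ?\<mu> lborel ..
  have dm: "dividend_measure D \<omega> = ?\<mu>" by (simp add: dividend_measure_def right_limit_def[abs_def])
  have [measurable]: "{t. 0 \<le> t \<and> ereal t < T} \<in> sets borel"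
  proof -
    have "{t \<in> space borel. 0 \<le> t \<and> ereal t < T} \<in> sets borel" by measurable
    then show ?thesis by simp
  qed
  let ?I = "{t. 0 \<le> t \<and> ereal t < T}"
  have "discounted_dividends m D T \<omega> = (\<integral>\<^sup>+ t. ennreal (exp (- ?d * t)) * indicator ?I t \<partial>?\<mu>)"
    by (simp add: discounted_dividends_def dm)
  also have "\<dots> = (\<integral>\<^sup>+ t. (\<integral>\<^sup>+ s. ennreal (exponential_density ?d s) * indicator {t<..} s * indicator ?I t \<partial>lborel) \<partial>?\<mu>)"
  proof (rule nn_integral_cong)
    fix t
    show "ennreal (exp (- ?d * t)) * indicator ?I t = (\<integral>\<^sup>+ s. ennreal (exponential_density ?d s) * indicator {t<..} s * indicator ?I t \<partial>lborel)"
    proof (cases "t \<in> ?I")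
      case True
      then show ?thesis using exp_tail[of t] by simp
    qed simp
  qed
  \<comment> \<open>After exchanging the integrals, the inner one is the dividend measure of the
    times below both \<open>s\<close> and \<open>T\<close>, that is, of the interval from 0 to
    \<open>stop T s\<close>.\<close>
  also have "\<dots> = (\<integral>\<^sup>+ s. (\<integral>\<^sup>+ t. ennreal (exponential_density ?d s) * indicator {t<..} s * indicator ?I t \<partial>?\<mu>) \<partial>lborel)"
  proof (rule Fubini'[symmetric])
    have "(\<lambda>p. ennreal (exponential_density ?d (snd p)) * indicator {p. fst p < snd p} p * indicator ?I (fst p))
      \<in> borel_measurable (borel \<Otimes>\<^sub>M borel :: (real \<times> real) measure)"
      by measurable
    then show "(\<lambda>(t, s). ennreal (exponential_density ?d s) * indicator {t<..} s * indicator ?I t) \<in> borel_measurable (?\<mu> \<Otimes>\<^sub>M lborel)"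
      by (simp add: case_prod_beta' indicator_def cong: measurable_cong_sets)
  qed
  also have "\<dots> = (\<integral>\<^sup>+ s. ennreal (exponential_density ?d s) * ennreal (?a (stop T s)) \<partial>lborel)"
  proof (rule nn_integral_cong)
    fix s :: real
    show "(\<integral>\<^sup>+ t. ennreal (exponential_density ?d s) * indicator {t<..} s * indicator ?I t \<partial>?\<mu>) =
      ennreal (exponential_density ?d s) * ennreal (?a (stop T s))"
    proof (cases "0 \<le> s")
      case True
      have "(\<integral>\<^sup>+ t. ennreal (exponential_density ?d s) * indicator {t<..} s * indicator ?I t \<partial>?\<mu>) =
        (\<integral>\<^sup>+ t. ennreal (exponential_density ?d s) * indicator {0..<stop T s} t \<partial>?\<mu>)"
        using True T by (intro nn_integral_cong) (cases T; auto simp: indicator_def stop_ereal stop_PInf)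
      also have "\<dots> = ennreal (exponential_density ?d s) * emeasure ?\<mu> {0..<stop T s}"
        by (subst nn_integral_cmult_indicator) auto
      also have "emeasure ?\<mu> {0..<stop T s} = ennreal (?a (stop T s))"
        by (intro emeasure_right_limit_Ico reg stop_nonneg)
      finally show ?thesis .
    qed (simp add: exponential_density_def)
  qed
  finally show ?thesis by (simp add: disc_def)
qed

text \<open>After time \<tau> the stopped path is \<open>a \<tau>\<close> plus the stopped shifted
  path. Translating the integration variable by \<tau> produces the discount factor, because the
  exponential density is memoryless.\<close>

lemma disc_split:
  assumes reg: "regular_path a" and \<tau>: "0 \<le> \<tau>" and T: "0 \<le> T"
  shows "disc a (ereal \<tau> + T) = disc a (ereal \<tau>) + ennreal (exp (- discount m * \<tau>)) * disc (\<lambda>t. a (\<tau> + t) - a \<tau>) T"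
proof -
  let ?d = "discount m" and ?e = "\<lambda>s. ennreal (exponential_density (discount m) s)"
  let ?b = "\<lambda>t. a (\<tau> + t) - a \<tau>"
  have b0: "0 \<le> ?b t" if "0 \<le> t" for t using regular_path_mono[OF reg, of \<tau> "\<tau> + t"] that \<tau> by simp
  have "(\<lambda>s. ennreal (a (max 0 (\<tau> + stop T s)) - a \<tau>)) \<in> borel_measurable borel"
    by (intro measurable_compose[OF _ measurable_ennreal] borel_measurable_diff
      measurable_compose[OF _ measurable_regular_path[OF reg]]) measurable
  moreover have "max 0 (\<tau> + stop T s) = \<tau> + stop T s" for s using \<tau> stop_nonneg[of T s] by simp
  ultimately have "(\<lambda>s. ennreal (?b (stop T s))) \<in> borel_measurable borel" by simp
  then obtain g where g: "\<And>s. g s = ennreal (?b (stop T s))" and [measurable]: "g \<in> borel_measurable borel" by auto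
  note [measurable] = measurable_disc_integrand[OF reg]
  have "disc a (ereal \<tau> + T) = (\<integral>\<^sup>+ s. ?e s * ennreal (a (stop (ereal \<tau>) s)) + ?e s * (g (s - \<tau>) * indicator {\<tau>..} s) \<partial>lborel)"
    unfolding disc_def
  proof (rule nn_integral_cong)
    fix s
    show "?e s * ennreal (a (stop (ereal \<tau> + T) s)) = ?e s * ennreal (a (stop (ereal \<tau>) s)) + ?e s * (g (s - \<tau>) * indicator {\<tau>..} s)"
    proof (cases "0 \<le> s")
      case s: True
      show ?thesis
      proof (cases "\<tau> \<le> s")
        case True
        have "stop (ereal \<tau> + T) s = \<tau> + stop T (s - \<tau>)"
          using T \<tau> s True by (cases T) (auto simp: stop_ereal stop_PInf min_def)
        moreover have "stop (ereal \<tau>) s = \<tau>" using True \<tau> s by (simp add: stop_ereal)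
        moreover have "ennreal (a (\<tau> + stop T (s - \<tau>))) = ennreal (a \<tau>) + ennreal (?b (stop T (s - \<tau>)))"
          using regular_path_nonneg[OF reg \<tau>] b0[OF stop_nonneg] by (subst ennreal_plus[symmetric]) auto
        ultimately show ?thesis using True by (simp add: distrib_left g)
      next
        case False
        have "stop (ereal \<tau> + T) s = stop (ereal \<tau>) s"
          using T \<tau> s False by (cases T) (auto simp: stop_ereal stop_PInf min_def)
        then show ?thesis using False by simp
      qed
    qed (simp add: exponential_density_def)
  qed
  also have "\<dots> = disc a (ereal \<tau>) + (\<integral>\<^sup>+ s. ?e s * (g (s - \<tau>) * indicator {\<tau>..} s) \<partial>lborel)"
    unfolding disc_def by (rule nn_integral_add) measurable
  also have "(\<integral>\<^sup>+ s. ?e s * (g (s - \<tau>) * indicator {\<tau>..} s) \<partial>lborel) =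
     (\<integral>\<^sup>+ s. ?e (\<tau> + 1 * s) * (g (\<tau> + 1 * s - \<tau>) * indicator {\<tau>..} (\<tau> + 1 * s)) \<partial>lborel)"
  proof -
    have "(\<lambda>s. ?e s * (g (s - \<tau>) * indicator {\<tau>..} s)) \<in> borel_measurable borel" by measurable
    from nn_integral_real_affine[OF this, of 1 \<tau>] show ?thesis by simp
  qed
  also have "\<dots> = (\<integral>\<^sup>+ s. ennreal (exp (- ?d * \<tau>)) * (?e s * g s) \<partial>lborel)"
  proof (rule nn_integral_cong)
    fix s
    have "s < 0 \<or> exponential_density ?d (\<tau> + s) = exp (- ?d * \<tau>) * exponential_density ?d s"
      using \<tau> by (auto simp: exponential_density_def exp_add[symmetric] algebra_simps)
    then show "?e (\<tau> + 1 * s) * (g (\<tau> + 1 * s - \<tau>) * indicator {\<tau>..} (\<tau> + 1 * s)) =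
      ennreal (exp (- ?d * \<tau>)) * (?e s * g s)"
      using discount_pos by (cases "s < 0")
       (auto simp: indicator_def ennreal_mult mult.assoc exponential_density_def)
  qed
  also have "\<dots> = ennreal (exp (- ?d * \<tau>)) * disc ?b T"
    unfolding disc_def g[symmetric] by (rule nn_integral_cmult) measurable
  finally show ?thesis .
qed

text \<open>The sharp constant is \<open>premium m / discount m\<close>; estimating \<open>s\<close> by
  \<open>2 / \<delta> * exp (\<delta> * s / 2)\<close>, only integrals of exponentials are needed.\<close>

lemma disc_le_linear:
  assumes "0 \<le> T" "0 \<le> x" "\<And>t. 0 \<le> t \<Longrightarrow> ereal t \<le> T \<Longrightarrow> a t \<le> x + premium m * t"
  shows "disc a T \<le> ennreal (x + 4 * premium m / discount m)"
proof -
  let ?d = "discount m" and ?c = "premium m"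
  have P: "(\<integral>\<^sup>+ s. ennreal (exponential_density l s) \<partial>lborel) = 1" if "0 < l" for l
    using prob_space.emeasure_space_1[OF prob_space_exp_measure[OF that]]
    by (simp add: exp_measure_def emeasure_density)
  have "disc a T \<le> (\<integral>\<^sup>+ s. ennreal x * ennreal (exponential_density ?d s) + ennreal (4 * ?c / ?d) * ennreal (exponential_density (?d / 2) s) \<partial>lborel)"
    unfolding disc_def
  proof (rule nn_integral_mono)
    fix s
    show "ennreal (exponential_density ?d s) * ennreal (a (stop T s)) \<le>
      ennreal x * ennreal (exponential_density ?d s) + ennreal (4 * ?c / ?d) * ennreal (exponential_density (?d / 2) s)"
    proof (cases "0 \<le> s")
      case True
      have "a (stop T s) \<le> x + ?c * stop T s"
        using assms(1) True by (intro assms(3) stop_nonneg stop_le_time)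
      also have "\<dots> \<le> x + ?c * s" using stop_le[OF True assms(1)] premium_pos by simp
      also have "?c * s \<le> 2 * ?c / ?d * exp (?d * s / 2)"
      proof -
        have "?d * s / 2 \<le> exp (?d * s / 2)" using exp_ge_add_one_self[of "?d * s / 2"] by linarith
        then have "(2 * ?c / ?d) * (?d * s / 2) \<le> (2 * ?c / ?d) * exp (?d * s / 2)"
          using premium_pos discount_pos by (intro mult_left_mono) auto
        then show ?thesis using discount_pos by (simp add: field_simps)
      qed
      finally have "exponential_density ?d s * a (stop T s) \<le> exponential_density ?d s * (x + 2 * ?c / ?d * exp (?d * s / 2))"
        using discount_pos by (intro mult_left_mono) (auto simp: exponential_density_def)
      also have "\<dots> = x * exponential_density ?d s + (4 * ?c / ?d) * exponential_density (?d / 2) s"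
      proof -
        have "exp (- (s * ?d)) * exp (?d * s / 2) = exp (- (s * (?d / 2)))"
          by (simp add: exp_add[symmetric] algebra_simps)
        then show ?thesis using True by (simp add: exponential_density_def algebra_simps)
      qed
      finally have "ennreal (exponential_density ?d s * a (stop T s)) \<le> ennreal (x * exponential_density ?d s + (4 * ?c / ?d) * exponential_density (?d / 2) s)"
        by (rule ennreal_leI)
      also have "\<dots> = ennreal x * ennreal (exponential_density ?d s) + ennreal (4 * ?c / ?d) * ennreal (exponential_density (?d / 2) s)"
      proof -
        have "0 \<le> exponential_density ?d s" "0 \<le> exponential_density (?d / 2) s" "0 \<le> 4 * ?c / ?d"
          using premium_pos discount_pos True by (auto simp: exponential_density_def)
        then show ?thesis using assms(2) by (simp only: ennreal_plus ennreal_mult mult_nonneg_nonneg)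
      qed
      also have "ennreal (exponential_density ?d s * a (stop T s)) = ennreal (exponential_density ?d s) * ennreal (a (stop T s))"
        using discount_pos by (intro ennreal_mult') (auto simp: exponential_density_def)
      finally show ?thesis .
    qed (simp add: exponential_density_def)
  qed
  also have "\<dots> = ennreal x * 1 + ennreal (4 * ?c / ?d) * 1"
    using discount_pos by (simp add: nn_integral_add nn_integral_cmult P)
  also have "\<dots> = ennreal (x + 4 * ?c / ?d)"
    using assms(2) premium_pos discount_pos by (simp add: ennreal_plus)
  finally show ?thesis .
qed

text \<open>For fixed \<open>s\<close> the stopped value no longer changes once \<open>T n\<close>
  exceeds \<open>s\<close>, so monotone convergence applies to an eventually constant
  integrand.\<close>

lemma disc_SUP:
  assumes reg: "regular_path a" and R: "0 \<le> R" and T: "incseq T" "\<And>n. 0 \<le> T n" "\<And>t. \<exists>n. t < T n"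
  shows "disc a R = (SUP n. disc a (min R (ereal (T n))))"
proof -
  let ?e = "\<lambda>s. ennreal (exponential_density (discount m) s)"
  let ?R = "\<lambda>n. min R (ereal (T n))"
  have R0: "0 \<le> ?R n" for n using R T(2) by simp
  have R1: "?R n \<le> ?R n'" if "n \<le> n'" for n n'
    using T(1) that by (auto simp: incseq_def min_le_iff_disj)
  note [measurable] = measurable_disc_integrand[OF reg]
  have SUP: "?e s * ennreal (a (stop R s)) = (SUP n. ?e s * ennreal (a (stop (?R n) s)))" for s
  proof (cases "0 \<le> s")
    case True
    obtain n where "s < T n" using T(3) by blast
    then have eq: "stop R s = stop (?R n) s"
      using True R T(2)[of n] by (cases R) (auto simp: stop_ereal stop_PInf min_def)
    show ?thesis
    proof (rule antisym)
      show "?e s * ennreal (a (stop R s)) \<le> (SUP n. ?e s * ennreal (a (stop (?R n) s)))"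
        unfolding eq by (rule SUP_upper) simp
      show "(SUP n. ?e s * ennreal (a (stop (?R n) s))) \<le> ?e s * ennreal (a (stop R s))"
        using True R R0 by (intro SUP_least mult_left_mono ennreal_leI regular_path_mono[OF reg] stop_nonneg stop_mono) auto
    qed
  qed (simp add: exponential_density_def)
  have "disc a R = (\<integral>\<^sup>+ s. (SUP n. ?e s * ennreal (a (stop (?R n) s))) \<partial>lborel)"
    unfolding disc_def SUP ..
  also have "\<dots> = (SUP n. \<integral>\<^sup>+ s. ?e s * ennreal (a (stop (?R n) s)) \<partial>lborel)"
  proof (rule nn_integral_monotone_convergence_SUP)
    show "incseq (\<lambda>n s. ?e s * ennreal (a (stop (?R n) s)))"
    proof (rule incseq_SucI, rule le_funI)
      fix n s
      show "?e s * ennreal (a (stop (?R n) s)) \<le> ?e s * ennreal (a (stop (?R (Suc n)) s))"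
      proof (cases "0 \<le> s")
        case True then show ?thesis
          using R0 R1[of n "Suc n"] by (intro mult_left_mono ennreal_leI regular_path_mono[OF reg] stop_nonneg stop_mono) auto
      qed (simp add: exponential_density_def)
    qed
  qed measurable
  finally show ?thesis by (simp only: disc_def)
qed

section \<open>Decomposition at the first jump\<close>

text \<open>A version of \<open>ruin_time\<close> for a single path instead of a strategy, so that
  it can be applied to shifted paths.\<close>

definition ruin :: "'n \<Rightarrow> real \<Rightarrow> (real \<Rightarrow> real) \<Rightarrow> 'n driver stream \<Rightarrow> ereal" where
  "ruin i x a \<omega> = Inf {ereal t | t. 0 \<le> t \<and> x + premium m * t - total_claims m i t \<omega> - a t < 0}"

definition path_ok :: "'n \<Rightarrow> real \<Rightarrow> (real \<Rightarrow> real) \<Rightarrow> 'n driver stream \<Rightarrow> bool" where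
  "path_ok i x a \<omega> \<longleftrightarrow> regular_path a \<and>
     (\<forall>t\<ge>0. (\<forall>k. claim_jump i \<omega> k \<and> jump_time m i \<omega> (Suc k) \<le> t \<longrightarrow>
         0 \<le> x + premium m * jump_time m i \<omega> (Suc k) - total_claims m i (jump_time m i \<omega> (Suc k)) \<omega> - a (jump_time m i \<omega> (Suc k))) \<longrightarrow>
       a t \<le> x + premium m * t - total_claims m i t \<omega>)"

definition joint :: "'n strategy \<Rightarrow> bool" where
  "joint D \<longleftrightarrow> (\<lambda>(t, \<omega>). D t \<omega>) \<in> borel_measurable JM"

lemma ruin_time_eq: "ruin_time m i x D \<omega> = ruin i x (\<lambda>t. D t \<omega>) \<omega>"
  by (simp add: ruin_time_def ruin_def surplus_def)

lemma admissible_iff: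
  "admissible m i x D \<longleftrightarrow> (\<lambda>(t, \<omega>). D t \<omega>) \<in> borel_measurable (PR i) \<and> (AE \<omega> in P. path_ok i x (\<lambda>t. D t \<omega>) \<omega>)"
  by (simp add: admissible_def path_ok_def regular_path_def surplus_def conj_assoc)

lemma admissible_path_ok: "admissible m i x D \<Longrightarrow> AE \<omega> in P. path_ok i x (\<lambda>t. D t \<omega>) \<omega>"
  by (simp add: admissible_iff)

lemma admissible_joint: "admissible m i x D \<Longrightarrow> joint D"
  unfolding admissible_iff joint_def by (blast intro: measurable_PR_JM)

lemma path_ok_regular: "path_ok i x a \<omega> \<Longrightarrow> regular_path a"
  by (simp add: path_ok_def)

text \<open>Surplus right after the first jump, net of a claim. For a left-continuous path
  \<open>f\<close>, the amount \<open>f (hold i d)\<close> contains no payment triggered by the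
  jump. A negative value means ruin.\<close>

definition post :: "'n \<Rightarrow> real \<Rightarrow> (real \<Rightarrow> real) \<Rightarrow> 'n driver \<Rightarrow> real" where
  "post i x f d = x + premium m * hold i d - f (hold i d) - loss i d"

abbreviation shift_path :: "real \<Rightarrow> (real \<Rightarrow> real) \<Rightarrow> real \<Rightarrow> real" where
  "shift_path \<tau> a \<equiv> (\<lambda>t. a (\<tau> + t) - a \<tau>)"

lemma total_claims_nonneg: "good \<omega> \<Longrightarrow> 0 \<le> total_claims m i t \<omega>"
  unfolding total_claims_def by (intro sum_nonneg) (auto simp: claim_at_def good_def good_driver_def)

lemma surplus_shift:
  assumes "good_driver d" "good \<omega>" "0 \<le> t"
  shows "x + premium m * (hold i d + t) - total_claims m i (hold i d + t) (d ## \<omega>) - a (hold i d + t) =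
    post i x a d + premium m * t - total_claims m (succ_phase i d) t \<omega> - shift_path (hold i d) a t"
  using total_claims_after[OF assms, of i] by (simp add: post_def algebra_simps)

lemma surplus_before:
  assumes "good_driver d" "good \<omega>" "path_ok i x a (d ## \<omega>)" "0 \<le> t" "t < hold i d"
  shows "a t \<le> x + premium m * t"
proof -
  have "\<not> jump_time m i (d ## \<omega>) (Suc k) \<le> t" for k
    using assms jump_time_nonneg[of \<omega> "succ_phase i d" k] by (simp add: jump_time_Stream)
  then have "a t \<le> x + premium m * t - total_claims m i t (d ## \<omega>)"
    using assms(3,4) by (auto simp: path_ok_def)
  then show ?thesis using total_claims_before[of d \<omega> t i] assms by simp
qed

text \<open>Carries a bound valid strictly before a time over to that time. This is needed at a
  first claim and at ruin, where the budget clause would already deduct the claim.\<close>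

lemma left_limit_le_linear:
  assumes reg: "regular_path a" and t: "0 < t" and le: "\<And>s. 0 \<le> s \<Longrightarrow> s < t \<Longrightarrow> a s \<le> x + c * s"
  shows "a t \<le> x + c * t"
proof (rule tendsto_le[OF _ _ regular_path_lim[OF reg t]])
  show "((\<lambda>s. x + c * s) \<longlongrightarrow> x + c * t) (at_left t)" by (intro tendsto_intros)
  show "\<forall>\<^sub>F s in at_left t. a s \<le> x + c * s"
    using le by (auto simp: eventually_at_left[OF t] intro!: exI[of _ 0] t)
qed simp

lemma surplus_at_jump:
  assumes "good_driver d" "good \<omega>" "path_ok i x a (d ## \<omega>)"
  shows "a (hold i d) \<le> x + premium m * hold i d"
  by (rule left_limit_le_linear[OF path_ok_regular[OF assms(3)] good_driver_hold[OF assms(1)] surplus_before[OF assms]])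

lemma continuous_shift:
  fixes a :: "real \<Rightarrow> real"
  assumes "continuous (at_left (\<tau> + t)) a"
  shows "continuous (at_left t) (\<lambda>s. a (\<tau> + s))"
proof -
  have "(\<lambda>s. \<tau> + s) ` {..<t} = {..<\<tau> + t}"
  proof (intro set_eqI iffI)
    fix u assume "u \<in> {..<\<tau> + t}"
    then show "u \<in> (\<lambda>s. \<tau> + s) ` {..<t}" by (intro image_eqI[of _ _ "u - \<tau>"]) auto
  qed auto
  then have "continuous (at_left t) (a \<circ> (\<lambda>s. \<tau> + s))"
    by (intro continuous_within_compose) (use assms in \<open>auto intro!: continuous_intros\<close>)
  then show ?thesis by (simp add: o_def)
qed

lemma regular_path_shift:
  assumes "regular_path a" "0 \<le> \<tau>"
  shows "regular_path (shift_path \<tau> a)"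
  unfolding regular_path_def
proof (intro conjI allI impI)
  show "mono_on {0..} (shift_path \<tau> a)"
    using regular_path_mono[OF assms(1)] assms(2) by (auto simp: mono_on_def)
  fix t :: real assume "0 < t"
  then show "continuous (at_left t) (shift_path \<tau> a)"
    using assms by (intro continuous_diff continuous_const continuous_shift) (auto simp: regular_path_def)
qed simp

text \<open>The budget clause of the whole path presupposes that no earlier claim exceeded the
  surplus. For a claim at the first jump this is the hypothesis on \<open>post\<close>; for later
  claims it is the premise of the clause for the shifted path.\<close>

lemma path_ok_shift:
  assumes g: "good_driver d" "good \<omega>" and ok: "path_ok i x a (d ## \<omega>)" and y: "0 \<le> post i x a d"
  shows "path_ok (succ_phase i d) (post i x a d) (shift_path (hold i d) a) \<omega>"
  unfolding path_ok_def
proof (intro conjI allI impI)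
  let ?\<tau> = "hold i d" and ?j = "succ_phase i d" and ?y = "post i x a d"
  have \<tau>: "0 < ?\<tau>" by (rule good_driver_hold[OF g(1)])
  show "regular_path (shift_path ?\<tau> a)"
    using \<tau> by (intro regular_path_shift path_ok_regular[OF ok]) simp
  fix t :: real assume t: "0 \<le> t"
    and c: "\<forall>k. claim_jump ?j \<omega> k \<and> jump_time m ?j \<omega> (Suc k) \<le> t \<longrightarrow>
      0 \<le> ?y + premium m * jump_time m ?j \<omega> (Suc k) - total_claims m ?j (jump_time m ?j \<omega> (Suc k)) \<omega> - shift_path ?\<tau> a (jump_time m ?j \<omega> (Suc k))"
  have "a (?\<tau> + t) \<le> x + premium m * (?\<tau> + t) - total_claims m i (?\<tau> + t) (d ## \<omega>)"
  proof (rule ok[unfolded path_ok_def, THEN conjunct2, rule_format])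
    show "0 \<le> ?\<tau> + t" using \<tau> t by simp
    fix k assume k: "claim_jump i (d ## \<omega>) k \<and> jump_time m i (d ## \<omega>) (Suc k) \<le> ?\<tau> + t"
    show "0 \<le> x + premium m * jump_time m i (d ## \<omega>) (Suc k) - total_claims m i (jump_time m i (d ## \<omega>) (Suc k)) (d ## \<omega>) - a (jump_time m i (d ## \<omega>) (Suc k))"
    proof (cases k)
      case 0
      then show ?thesis using y surplus_shift[OF g, of 0 x i a] num_jumps_eq[OF g(2), of ?j 0 0] jump_time_pos[OF g(2), of "Suc 0" ?j]
        by (simp add: jump_time_Stream total_claims_def)
    next
      case (Suc l)
      then show ?thesis
        using c k jump_time_nonneg[OF g(2), of ?j "Suc l"]
        unfolding Suc jump_time_Stream claim_jump_Stream
        by (subst surplus_shift[OF g]) auto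
    qed
  qed
  then show "shift_path ?\<tau> a t \<le> ?y + premium m * t - total_claims m ?j t \<omega>"
    using surplus_shift[OF g t, of x i a] by linarith
qed

lemma ereal_Inf_shift:
  assumes "\<And>t. 0 \<le> t \<Longrightarrow> Q t \<longleftrightarrow> \<tau> \<le> t \<and> Q' (t - \<tau>)" "0 \<le> \<tau>"
  shows "Inf {ereal t | t. 0 \<le> t \<and> Q t} = ereal \<tau> + Inf {ereal t | t. 0 \<le> t \<and> Q' t}"
proof (rule antisym)
  have "Inf {ereal t | t. 0 \<le> t \<and> Q t} - ereal \<tau> \<le> Inf {ereal t | t. 0 \<le> t \<and> Q' t}"
  proof (rule Inf_greatest, clarify)
    fix t assume "0 \<le> t" "Q' t"
    then have "Inf {ereal t | t. 0 \<le> t \<and> Q t} \<le> ereal (t + \<tau>)"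
      using assms by (intro Inf_lower) auto
    then show "Inf {ereal t | t. 0 \<le> t \<and> Q t} - ereal \<tau> \<le> ereal t"
      by (subst ereal_minus_le) auto
  qed
  then show "Inf {ereal t | t. 0 \<le> t \<and> Q t} \<le> ereal \<tau> + Inf {ereal t | t. 0 \<le> t \<and> Q' t}"
    by (subst (asm) ereal_minus_le) (auto simp: add.commute)
  show "ereal \<tau> + Inf {ereal t | t. 0 \<le> t \<and> Q' t} \<le> Inf {ereal t | t. 0 \<le> t \<and> Q t}"
  proof (rule Inf_greatest, clarify)
    fix t assume "0 \<le> t" "Q t"
    then have t: "\<tau> \<le> t" "Q' (t - \<tau>)" using assms by auto
    then have "Inf {ereal t | t. 0 \<le> t \<and> Q' t} \<le> ereal (t - \<tau>)" by (intro Inf_lower) auto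
    then have "ereal \<tau> + Inf {ereal t | t. 0 \<le> t \<and> Q' t} \<le> ereal \<tau> + ereal (t - \<tau>)" by (rule add_left_mono)
    then show "ereal \<tau> + Inf {ereal t | t. 0 \<le> t \<and> Q' t} \<le> ereal t" by simp
  qed
qed

lemma ruin_nonneg: "0 \<le> ruin i x a \<omega>"
  unfolding ruin_def by (rule Inf_greatest) auto

text \<open>Before the first jump the budget clause excludes ruin. A negative \<open>post\<close> is
  covered as well: the restarted process then has a negative surplus at time 0.\<close>

lemma ruin_after:
  assumes g: "good_driver d" "good \<omega>" and ok: "path_ok i x a (d ## \<omega>)"
  shows "ruin i x a (d ## \<omega>) = ereal (hold i d) + ruin (succ_phase i d) (post i x a d) (shift_path (hold i d) a) \<omega>"
  unfolding ruin_def
proof (rule ereal_Inf_shift)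
  show "0 \<le> hold i d" using good_driver_hold[OF g(1), of i] by simp
  fix t :: real assume t: "0 \<le> t"
  show "x + premium m * t - total_claims m i t (d ## \<omega>) - a t < 0 \<longleftrightarrow>
    hold i d \<le> t \<and> post i x a d + premium m * (t - hold i d) - total_claims m (succ_phase i d) (t - hold i d) \<omega> - shift_path (hold i d) a (t - hold i d) < 0"
  proof (cases "hold i d \<le> t")
    case True
    then show ?thesis using surplus_shift[OF g, of "t - hold i d" x i a] by (simp, linarith)
  next
    case False
    then show ?thesis using surplus_before[OF g ok t] total_claims_before[OF g t] by simp
  qed
qed

lemma ruin_neg:
  assumes "good \<omega>" "x < 0" "a 0 = 0"
  shows "ruin i x a \<omega> = 0"
proof (rule antisym)
  have "total_claims m i 0 \<omega> = 0"
    using num_jumps_eq[OF assms(1), of i 0 0] jump_time_pos[OF assms(1), of "Suc 0" i] by (simp add: total_claims_def)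
  then show "ruin i x a \<omega> \<le> 0"
    unfolding ruin_def zero_ereal_def using assms by (intro Inf_lower) auto
qed (rule ruin_nonneg)

text \<open>Indexed by \<open>enat\<close> so that truncated and full values obey one recursion:
  \<open>eSuc\<close> leaves \<open>\<infinity>\<close> fixed.\<close>

definition horizon :: "'n \<Rightarrow> 'n driver stream \<Rightarrow> enat \<Rightarrow> ereal" where
  "horizon i \<omega> n = (case n of enat k \<Rightarrow> ereal (jump_time m i \<omega> k) | \<infinity> \<Rightarrow> \<infinity>)"

lemma horizon_nonneg: "good \<omega> \<Longrightarrow> 0 \<le> horizon i \<omega> n"
  by (cases n) (auto simp: horizon_def jump_time_nonneg)

lemma horizon_after: "horizon i (d ## \<omega>) (eSuc n) = ereal (hold i d) + horizon (succ_phase i d) \<omega> n"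
  by (cases n) (auto simp: horizon_def jump_time_Stream eSuc_enat)

lemma measurable_horizon: "(\<lambda>\<omega>. horizon i \<omega> n) \<in> borel_measurable P"
  by (rule measurable_P_S0, cases n) (simp_all add: horizon_def)

lemma disc_first_jump:
  assumes g: "good_driver d" "good \<omega>" and ok: "path_ok i x a (d ## \<omega>)"
  shows "disc a (min (ruin i x a (d ## \<omega>)) (horizon i (d ## \<omega>) (eSuc n))) =
    disc a (ereal (hold i d)) + ennreal (exp (- discount m * hold i d)) *
     (if 0 \<le> post i x a d then disc (shift_path (hold i d) a)
       (min (ruin (succ_phase i d) (post i x a d) (shift_path (hold i d) a) \<omega>) (horizon (succ_phase i d) \<omega> n)) else 0)"
proof -
  let ?\<tau> = "hold i d" and ?j = "succ_phase i d" and ?y = "post i x a d"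
  let ?R = "ruin ?j ?y (shift_path ?\<tau> a) \<omega>" and ?H = "horizon ?j \<omega> n"
  have \<tau>: "0 \<le> ?\<tau>" using good_driver_hold[OF g(1), of i] by simp
  have "min (ruin i x a (d ## \<omega>)) (horizon i (d ## \<omega>) (eSuc n)) = ereal ?\<tau> + min ?R ?H"
    unfolding ruin_after[OF g ok] horizon_after
    by (auto simp: min_def ereal_add_le_add_iff)
  then have "disc a (min (ruin i x a (d ## \<omega>)) (horizon i (d ## \<omega>) (eSuc n))) =
    disc a (ereal ?\<tau>) + ennreal (exp (- discount m * ?\<tau>)) * disc (shift_path ?\<tau> a) (min ?R ?H)"
    using disc_split[OF path_ok_regular[OF ok] \<tau>] ruin_nonneg horizon_nonneg[OF g(2)] by simp
  \<comment> \<open>After ruin at the first jump the continuation is stopped at time 0, where the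
    shifted path vanishes.\<close>
  moreover have "disc (shift_path ?\<tau> a) (min ?R ?H) = 0" if "\<not> 0 \<le> ?y"
  proof -
    have "?R = 0" using that by (intro ruin_neg g) auto
    then have "min ?R ?H = 0" using horizon_nonneg[OF g(2), of ?j n] by (simp add: min_def)
    moreover have "stop 0 s = 0" for s by (cases "0 \<le> s") (auto simp: stop_def min_def zero_ereal_def)
    ultimately show ?thesis by (simp add: disc_def)
  qed
  ultimately show ?thesis by simp
qed

lemma measurable_joint_at:
  assumes "joint D" and [measurable]: "f \<in> borel_measurable M" and g [measurable]: "g \<in> M \<rightarrow>\<^sub>M P" and nn: "\<And>x. 0 \<le> f x"
  shows "(\<lambda>x. D (f x) (g x)) \<in> borel_measurable M"
proof -
  have "(\<lambda>x. (f x, g x)) \<in> M \<rightarrow>\<^sub>M JM"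
    by (intro measurable_Pair measurable_restrict_space2 g) (use nn in auto)
  from measurable_compose[OF this assms(1)[unfolded joint_def]] show ?thesis by simp
qed

text \<open>Since \<open>disc\<close> is a Lebesgue integral of the stopped path, joint
  measurability of \<open>D\<close> gives measurability in the sample path through the parameter
  integral.\<close>

lemma measurable_disc:
  assumes D: "joint D" and [measurable]: "R \<in> borel_measurable P"
  shows "(\<lambda>\<omega>. disc (\<lambda>t. D t \<omega>) (R \<omega>)) \<in> borel_measurable P"
proof -
  have "(\<lambda>p. D (stop (R (fst p)) (snd p)) (fst p)) \<in> borel_measurable (P \<Otimes>\<^sub>M lborel)"
    by (rule measurable_joint_at[OF D]) (auto simp: stop_nonneg)
  then have "(\<lambda>(\<omega>, s). ennreal (exponential_density (discount m) s) * ennreal (D (stop (R \<omega>) s) \<omega>)) \<in> borel_measurable (P \<Otimes>\<^sub>M lborel)"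
    by (simp add: case_prod_beta')
  then show ?thesis
    unfolding disc_def by (rule lborel.borel_measurable_nn_integral)
qed

lemma measurable_P_AE:
  assumes f: "f \<in> P \<rightarrow>\<^sub>M N" and ae: "AE \<omega> in P. f \<omega> = g \<omega>" and g: "\<And>\<omega>. g \<omega> \<in> space N"
  shows "g \<in> P \<rightarrow>\<^sub>M N"
proof (rule measurableI)
  fix A assume "A \<in> sets N"
  with f have "f -` A \<inter> space P \<in> sets P" by (rule measurable_sets)
  moreover have "AE \<omega> in P. \<omega> \<in> f -` A \<inter> space P \<longleftrightarrow> \<omega> \<in> g -` A \<inter> space P"
    using ae by eventually_elim simp
  ultimately show "g -` A \<inter> space P \<in> sets P" by (rule sets_P_AE)
qed (rule g)

text \<open>By the budget clause the surplus becomes negative only after a claim has exceeded it, so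
  the infimum over all times reduces to one over the jump times. A countable infimum of this kind is
  measurable.\<close>

lemma ruin_at_claim:
  assumes g: "good \<omega>" and ok: "path_ok i x a \<omega>"
  shows "ruin i x a \<omega> = (INF k. if x + premium m * jump_time m i \<omega> k - (\<Sum>l<k. claim_at i \<omega> l) - a (jump_time m i \<omega> k) < 0
    then ereal (jump_time m i \<omega> k) else \<infinity>)"
proof -
  let ?T = "jump_time m i \<omega>"
  have tot: "total_claims m i (?T k) \<omega> = (\<Sum>l<k. claim_at i \<omega> l)" for k
    using num_jumps_eq[OF g, of i k "?T k"] strict_mono_jump_time[OF g, of i]
    by (simp add: total_claims_def strict_mono_Suc_iff)
  show ?thesis
  proof (rule antisym)
    show "ruin i x a \<omega> \<le> (INF k. if x + premium m * ?T k - (\<Sum>l<k. claim_at i \<omega> l) - a (?T k) < 0 then ereal (?T k) else \<infinity>)"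
      unfolding ruin_def
      by (rule INF_greatest) (auto intro!: Inf_lower simp: tot jump_time_nonneg[OF g])
    show "(INF k. if x + premium m * ?T k - (\<Sum>l<k. claim_at i \<omega> l) - a (?T k) < 0 then ereal (?T k) else \<infinity>) \<le> ruin i x a \<omega>"
      unfolding ruin_def
    proof (rule Inf_greatest, clarify)
      fix t assume t: "0 \<le> t" "x + premium m * t - total_claims m i t \<omega> - a t < 0"
      then have "\<not> a t \<le> x + premium m * t - total_claims m i t \<omega>" by simp
      \<comment> \<open>Contrapositive of the budget clause: overspending at time \<open>t\<close>
        requires a claim, not later than \<open>t\<close>, that left a negative surplus.\<close>
      with ok t obtain k where k: "?T (Suc k) \<le> t" "x + premium m * ?T (Suc k) - total_claims m i (?T (Suc k)) \<omega> - a (?T (Suc k)) < 0"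
        unfolding path_ok_def by (meson not_less)
      have "(INF k. if x + premium m * ?T k - (\<Sum>l<k. claim_at i \<omega> l) - a (?T k) < 0 then ereal (?T k) else \<infinity>)
        \<le> (if x + premium m * ?T (Suc k) - (\<Sum>l<Suc k. claim_at i \<omega> l) - a (?T (Suc k)) < 0 then ereal (?T (Suc k)) else \<infinity>)"
        by (rule INF_lower) simp
      also have "\<dots> = ereal (?T (Suc k))" using k(2) unfolding tot by simp
      also have "\<dots> \<le> ereal t" using k(1) by simp
      finally show "(INF k. if x + premium m * ?T k - (\<Sum>l<k. claim_at i \<omega> l) - a (?T k) < 0 then ereal (?T k) else \<infinity>) \<le> ereal t" .
    qed
  qed
qed

lemma measurable_ruin:
  assumes adm: "admissible m i x D"
  shows "(\<lambda>\<omega>. ruin i x (\<lambda>t. D t \<omega>) \<omega>) \<in> borel_measurable P"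
proof (rule measurable_P_AE)
  \<comment> \<open>Joint measurability concerns nonnegative times, and \<open>max 0\<close>
    provides them for every sample path; almost surely it leaves the jump times unchanged.\<close>
  let ?T = "\<lambda>\<omega> k. max 0 (jump_time m i \<omega> k)"
  have [measurable]: "(\<lambda>\<omega>. ?T \<omega> k) \<in> borel_measurable P" "(\<lambda>\<omega>. claim_at i \<omega> k) \<in> borel_measurable P" for k
    by (rule measurable_P_S0, simp)+
  have [measurable]: "(\<lambda>\<omega>. D (?T \<omega> k) \<omega>) \<in> borel_measurable P" for k
    by (rule measurable_joint_at[OF admissible_joint[OF adm]]) auto
  show "(\<lambda>\<omega>. INF k. if x + premium m * ?T \<omega> k - (\<Sum>l<k. claim_at i \<omega> l) - D (?T \<omega> k) \<omega> < 0 then ereal (?T \<omega> k) else \<infinity>) \<in> borel_measurable P"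
    by measurable
  from AE_good admissible_path_ok[OF adm] show "AE \<omega> in P. (INF k. if x + premium m * ?T \<omega> k - (\<Sum>l<k. claim_at i \<omega> l) - D (?T \<omega> k) \<omega> < 0 then ereal (?T \<omega> k) else \<infinity>)
    = ruin i x (\<lambda>t. D t \<omega>) \<omega>"
  proof eventually_elim
    case (elim \<omega>)
    have "?T \<omega> k = jump_time m i \<omega> k" for k using jump_time_nonneg[OF elim(1), of i k] by simp
    then show ?case by (simp only: ruin_at_claim[OF elim])
  qed
qed simp

section \<open>Truncated values and their recursion at the first jump\<close>

abbreviation paid :: "'n \<Rightarrow> real \<Rightarrow> 'n strategy \<Rightarrow> enat \<Rightarrow> 'n driver stream \<Rightarrow> ennreal" where
  "paid i x D n \<omega> \<equiv> disc (\<lambda>t. D t \<omega>) (min (ruin i x (\<lambda>t. D t \<omega>) \<omega>) (horizon i \<omega> n))"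

definition val :: "'n \<Rightarrow> real \<Rightarrow> 'n strategy \<Rightarrow> enat \<Rightarrow> ennreal" where
  "val i x D n = (\<integral>\<^sup>+ \<omega>. paid i x D n \<omega> \<partial>P)"

lemma measurable_val:
  assumes "admissible m i x D"
  shows "(\<lambda>\<omega>. paid i x D n \<omega>) \<in> borel_measurable P"
  by (intro measurable_disc[OF admissible_joint[OF assms]] borel_measurable_min measurable_ruin[OF assms] measurable_horizon)

lemma strategy_value_eq_val:
  assumes "admissible m i x D"
  shows "strategy_value m i x D = val i x D \<infinity>"
  unfolding strategy_value_def val_def
proof (rule nn_integral_cong_AE)
  have "AE \<omega> in P. path_ok i x (\<lambda>t. D t \<omega>) \<omega>" using assms by (simp add: admissible_iff)
  then show "AE \<omega> in P. discounted_dividends m D (ruin_time m i x D \<omega>) \<omega> = paid i x D \<infinity> \<omega>"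
    by eventually_elim (simp add: ruin_time_eq horizon_def discounted_dividends_eq_disc path_ok_regular ruin_nonneg min_def)
qed

lemma val_SUP:
  assumes adm: "admissible m i x D"
  shows "val i x D \<infinity> = (SUP n. val i x D (enat n))"
proof -
  note ok = admissible_path_ok[OF adm]
  let ?F = "\<lambda>n \<omega>. paid i x D n \<omega>"
  have "val i x D \<infinity> = (\<integral>\<^sup>+ \<omega>. (SUP n. ?F (enat n) \<omega>) \<partial>P)"
    unfolding val_def
  proof (rule nn_integral_cong_AE)
    from AE_good ok show "AE \<omega> in P. ?F \<infinity> \<omega> = (SUP n. ?F (enat n) \<omega>)"
    proof eventually_elim
      case (elim \<omega>)
      have "disc (\<lambda>t. D t \<omega>) (ruin i x (\<lambda>t. D t \<omega>) \<omega>) = (SUP n. disc (\<lambda>t. D t \<omega>) (min (ruin i x (\<lambda>t. D t \<omega>) \<omega>) (ereal (jump_time m i \<omega> n))))"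
      proof (rule disc_SUP[OF path_ok_regular[OF elim(2)] ruin_nonneg])
        show "incseq (jump_time m i \<omega>)" using strict_mono_jump_time[OF elim(1)] by (simp add: strict_mono_mono)
        show "0 \<le> jump_time m i \<omega> n" for n by (rule jump_time_nonneg[OF elim(1)])
        show "\<exists>n. t < jump_time m i \<omega> n" for t using elim(1) by (simp add: good_def)
      qed
      then show ?case by (simp add: horizon_def min_def)
    qed
  qed
  also have "\<dots> = (SUP n. val i x D (enat n))"
    unfolding val_def
  proof (rule nn_integral_monotone_convergence_SUP_AE)
    show "?F (enat n) \<in> borel_measurable P" for n by (rule measurable_val[OF adm])
    fix n
    from AE_good ok show "AE \<omega> in P. ?F (enat n) \<omega> \<le> ?F (enat (Suc n)) \<omega>"
    proof eventually_elim
      case (elim \<omega>)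
      have "horizon i \<omega> (enat n) \<le> horizon i \<omega> (enat (Suc n))"
        using strict_mono_jump_time[OF elim(1), of i] by (simp add: horizon_def strict_mono_Suc_iff less_imp_le)
      then have "min (ruin i x (\<lambda>t. D t \<omega>) \<omega>) (horizon i \<omega> (enat n)) \<le> min (ruin i x (\<lambda>t. D t \<omega>) \<omega>) (horizon i \<omega> (enat (Suc n)))"
        by (auto simp: min_le_iff_disj)
      then show ?case
        using ruin_nonneg horizon_nonneg[OF elim(1)]
        by (intro disc_mono regular_path_mono[OF path_ok_regular[OF elim(2)]] stop_nonneg stop_mono) auto
    qed
  qed
  finally show ?thesis .
qed

definition initial :: "'n \<Rightarrow> 'n strategy \<Rightarrow> (real \<Rightarrow> real) \<Rightarrow> bool" where
  "initial i D f \<longleftrightarrow> f \<in> borel_measurable borel \<and> before_jump i (\<lambda>t \<omega>. D t \<omega> = f t)"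

lemma initial_ex:
  assumes adm: "admissible m i x D"
  shows "\<exists>f. initial i D f"
proof -
  have "(\<lambda>(t, \<omega>). D t \<omega>) \<in> borel_measurable (PR i)" using adm by (simp add: admissible_iff)
  \<comment> \<open>The passage to \<open>ennreal\<close> is undone below, since dividends are
    nonnegative almost surely.\<close>
  then have "(\<lambda>p. ennreal ((\<lambda>(t, \<omega>). D t \<omega>) p)) \<in> borel_measurable (PR i)" by measurable
  from measurable_PR_before_jump[OF this] obtain f where [measurable]: "f \<in> borel_measurable borel"
    and f: "before_jump i (\<lambda>t \<omega>. ennreal (D t \<omega>) = f t)" by auto
  note admissible_path_ok[OF adm]
  with f have "before_jump i (\<lambda>t \<omega>. D t \<omega> = enn2real (f t))"
  proof eventually_elim
    case (elim \<omega>)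
    show ?case
    proof (intro allI impI)
      fix t assume t: "0 \<le> t \<and> t \<le> hold i (shd \<omega>)"
      have "0 \<le> D t \<omega>" using regular_path_nonneg[OF path_ok_regular[OF elim(2)], of t] t by simp
      moreover have "f t = ennreal (D t \<omega>)" using elim(1) t by simp
      ultimately show "D t \<omega> = enn2real (f t)" by simp
    qed
  qed
  then show ?thesis unfolding initial_def by (intro exI[of _ "\<lambda>t. enn2real (f t)"]) simp
qed

text \<open>The subtracted amount almost surely equals the dividends paid up to the jump; being
  constant for a fixed driver, it does not affect predictability.\<close>

definition continuation :: "'n \<Rightarrow> 'n strategy \<Rightarrow> (real \<Rightarrow> real) \<Rightarrow> 'n driver \<Rightarrow> 'n strategy" where
  "continuation i D f d t \<omega> = D (hold i d + t) (d ## \<omega>) - f (hold i d)"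

lemma AE_initial:
  assumes "admissible m i x D" "initial i D f"
  shows "AE d in DM. good_driver d \<and> (AE \<omega> in P. good \<omega> \<and> path_ok i x (\<lambda>t. D t (d ## \<omega>)) (d ## \<omega>) \<and>
     (\<forall>t. 0 \<le> t \<and> t \<le> hold i d \<longrightarrow> D t (d ## \<omega>) = f t))"
proof -
  have "AE d in DM. AE \<omega> in P. path_ok i x (\<lambda>t. D t (d ## \<omega>)) (d ## \<omega>)"
    using assms(1) by (intro AE_P_Stream) (simp add: admissible_iff)
  moreover have "AE d in DM. AE \<omega> in P. \<forall>t. 0 \<le> t \<and> t \<le> hold i (shd (d ## \<omega>)) \<longrightarrow> D t (d ## \<omega>) = f t"
    using assms(2) by (intro AE_P_Stream) (simp add: initial_def)
  ultimately show ?thesis using AE_good_driver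
  proof eventually_elim
    case (elim d)
    from elim(1,2) AE_good have "AE \<omega> in P. good \<omega> \<and> path_ok i x (\<lambda>t. D t (d ## \<omega>)) (d ## \<omega>) \<and>
     (\<forall>t. 0 \<le> t \<and> t \<le> hold i d \<longrightarrow> D t (d ## \<omega>) = f t)" by eventually_elim simp
    with elim(3) show ?case by simp
  qed
qed

lemma initial_post:
  assumes "good_driver d" "\<forall>t. 0 \<le> t \<and> t \<le> hold i d \<longrightarrow> a t = f t"
  shows "post i x a d = post i x f d" "shift_path (hold i d) a = (\<lambda>t. a (hold i d + t) - f (hold i d))"
    "disc a (ereal (hold i d)) = disc f (ereal (hold i d))"
  using assms good_driver_hold[OF assms(1), of i] by (auto simp: post_def intro!: disc_cong)

lemma AE_continuation:
  assumes adm: "admissible m i x D" and init: "initial i D f"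
  shows "AE d in DM. 0 \<le> post i x f d \<longrightarrow> admissible m (succ_phase i d) (post i x f d) (continuation i D f d)"
proof -
  have "(\<lambda>(t, \<omega>). D t \<omega>) \<in> borel_measurable (PR i)" using adm by (simp add: admissible_iff)
  from measurable_PR_shift[OF this] AE_initial[OF adm init] show ?thesis
  proof eventually_elim
    case (elim d)
    from elim(2) have gd: "good_driver d" by simp
    show ?case
    proof
      assume y: "0 \<le> post i x f d"
      have "(\<lambda>(t, \<omega>). D (hold i d + t) (d ## \<omega>) - f (hold i d)) \<in> borel_measurable (PR (succ_phase i d))"
        using elim(1) by (simp add: case_prod_beta')
      moreover from elim(2)[THEN conjunct2] have "AE \<omega> in P. path_ok (succ_phase i d) (post i x f d) (\<lambda>t. D (hold i d + t) (d ## \<omega>) - f (hold i d)) \<omega>"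
      proof eventually_elim
        case (elim \<omega>)
        note * = initial_post[OF gd elim[THEN conjunct2, THEN conjunct2]]
        show ?case using path_ok_shift[OF gd, of \<omega> i x "\<lambda>t. D t (d ## \<omega>)"] elim y unfolding * by simp
      qed
      ultimately show "admissible m (succ_phase i d) (post i x f d) (continuation i D f d)"
        by (simp add: admissible_iff continuation_def)
    qed
  qed
qed

text \<open>The one-step functional as a function of the first driver: \<open>g\<close> is evaluated
  at the phase after a possible restart and at the surplus after a possible claim, and nothing
  follows ruin.\<close>

abbreviation payoff :: "'n \<Rightarrow> real \<Rightarrow> (real \<Rightarrow> real) \<Rightarrow> ('n \<Rightarrow> real \<Rightarrow> ennreal) \<Rightarrow> 'n driver \<Rightarrow> ennreal" where
  "payoff i x f g d \<equiv> disc f (ereal (hold i d)) + ennreal (exp (- discount m * hold i d)) *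
     (if 0 \<le> post i x f d then g (succ_phase i d) (post i x f d) else 0)"

text \<open>For almost every first driver, \<open>D\<close> follows \<open>f\<close> up to the jump
  and then \<open>f (hold i d)\<close> plus its continuation, so the pathwise splitting can be
  integrated over the rest of the stream. With \<open>n = \<infinity>\<close> this is the recursion
  for the untruncated value.\<close>

lemma val_first_jump:
  assumes adm: "admissible m i x D" and init: "initial i D f"
  shows "val i x D (eSuc n) = (\<integral>\<^sup>+ d. payoff i x f (\<lambda>j y. val j y (continuation i D f d) n) d \<partial>DM)"
proof -
  let ?F = "\<lambda>n \<omega>. paid i x D n \<omega>"
  have "val i x D (eSuc n) = (\<integral>\<^sup>+ d. (\<integral>\<^sup>+ \<omega>. ?F (eSuc n) (d ## \<omega>) \<partial>P) \<partial>DM)"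
    unfolding val_def by (rule nn_integral_P_Stream[OF measurable_val[OF adm]])
  also have "\<dots> = (\<integral>\<^sup>+ d. payoff i x f (\<lambda>j y. val j y (continuation i D f d) n) d \<partial>DM)"
  proof (rule nn_integral_cong_AE)
    from AE_initial[OF adm init] AE_continuation[OF adm init]
    show "AE d in DM. (\<integral>\<^sup>+ \<omega>. ?F (eSuc n) (d ## \<omega>) \<partial>P) = payoff i x f (\<lambda>j y. val j y (continuation i D f d) n) d"
    proof eventually_elim
      case (elim d)
      let ?\<tau> = "hold i d" and ?y = "post i x f d" and ?j = "succ_phase i d" and ?C = "continuation i D f d"
      let ?G = "\<lambda>\<omega>. if 0 \<le> ?y then disc (\<lambda>t. ?C t \<omega>) (min (ruin ?j ?y (\<lambda>t. ?C t \<omega>) \<omega>) (horizon ?j \<omega> n)) else 0"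
      from elim(1) have gd: "good_driver d" by simp
      have G [measurable]: "?G \<in> borel_measurable P"
        using elim(2) measurable_val[of ?j ?y ?C n] by (cases "0 \<le> ?y") auto
      have "(\<integral>\<^sup>+ \<omega>. ?F (eSuc n) (d ## \<omega>) \<partial>P) = (\<integral>\<^sup>+ \<omega>. disc f (ereal ?\<tau>) + ennreal (exp (- discount m * ?\<tau>)) * ?G \<omega> \<partial>P)"
      proof (rule nn_integral_cong_AE)
        from elim(1)[THEN conjunct2] show "AE \<omega> in P. ?F (eSuc n) (d ## \<omega>) = disc f (ereal ?\<tau>) + ennreal (exp (- discount m * ?\<tau>)) * ?G \<omega>"
        proof eventually_elim
          case (elim \<omega>)
          note * = initial_post[OF gd elim[THEN conjunct2, THEN conjunct2]]
          have "(\<lambda>t. ?C t \<omega>) = (\<lambda>t. D (hold i d + t) (d ## \<omega>) - f (hold i d))" by (simp add: continuation_def)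
          then show ?case
            using disc_first_jump[OF gd, of \<omega> i x "\<lambda>t. D t (d ## \<omega>)" n] elim unfolding * by simp
        qed
      qed
      also have "\<dots> = disc f (ereal ?\<tau>) + ennreal (exp (- discount m * ?\<tau>)) * (\<integral>\<^sup>+ \<omega>. ?G \<omega> \<partial>P)"
        using P.emeasure_space_1 by (simp add: nn_integral_add nn_integral_cmult)
      also have "(\<integral>\<^sup>+ \<omega>. ?G \<omega> \<partial>P) = (if 0 \<le> ?y then val ?j ?y ?C n else 0)"
        by (simp add: val_def)
      finally show ?case .
    qed
  qed
  finally show ?thesis .
qed

section \<open>The first-jump equation: upper bounds for the optimal value\<close>


text \<open>A solution is prescribed on nonnegative surpluses only. The extension by 0 is Borel on
  the whole line and expresses that nothing is received after ruin.\<close>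

definition pos_part :: "('n \<Rightarrow> real \<Rightarrow> ennreal) \<Rightarrow> 'n \<Rightarrow> real \<Rightarrow> ennreal" where
  "pos_part W j y = (if 0 \<le> y then W j y else 0)"

lemma measurable_pos_part:
  assumes "W j \<in> borel_measurable (restrict_space borel {0..})"
  shows "pos_part W j \<in> borel_measurable borel"
proof -
  have "(\<lambda>y. if y \<in> {0..} then W j y else 0) \<in> borel_measurable borel"
    using assms by (subst measurable_If_restrict_space_iff) (simp_all only: Collect_mem_eq, auto)
  then show ?thesis by (simp add: pos_part_def[abs_def])
qed

lemma with_absorbing_pos_part:
  "0 \<le> z \<Longrightarrow> with_absorbing m W o' z = with_absorbing m (pos_part W) o' z"
proof (cases o')
  case None
  have "(\<Sum>i\<in>UNIV. ennreal (pmf (restart m) i) * W i y) * indicator {0..z} y =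
    (\<Sum>i\<in>UNIV. ennreal (pmf (restart m) i) * pos_part W i y) * (indicator {0..z} y :: ennreal)" for y
    by (cases "y \<in> {0..z}") (simp_all add: pos_part_def)
  then show ?thesis by (simp add: None with_absorbing_def mult.assoc)
qed (simp add: with_absorbing_def pos_part_def)

lemma measurable_with_absorbing:
  assumes [measurable]: "\<And>j. W j \<in> borel_measurable borel"
  shows "with_absorbing m W o' \<in> borel_measurable borel"
proof (cases o')
  case None
  have "(\<lambda>(z, y). ennreal (exp (claim_rate m * y)) * (\<Sum>i\<in>UNIV. ennreal (pmf (restart m) i) * W i y) *
     indicator {p. 0 \<le> snd p \<and> snd p \<le> fst p} (z, y)) \<in> borel_measurable (borel \<Otimes>\<^sub>M lborel :: (real \<times> real) measure)"
    by measurable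
  then have "(\<lambda>z. \<integral>\<^sup>+ y. ennreal (exp (claim_rate m * y)) * (\<Sum>i\<in>UNIV. ennreal (pmf (restart m) i) * W i y) *
     indicator {p. 0 \<le> snd p \<and> snd p \<le> fst p} (z, y) \<partial>lborel) \<in> borel_measurable borel"
    by (rule lborel.borel_measurable_nn_integral)
  also have "(\<lambda>z. \<integral>\<^sup>+ y. ennreal (exp (claim_rate m * y)) * (\<Sum>i\<in>UNIV. ennreal (pmf (restart m) i) * W i y) *
     indicator {p. 0 \<le> snd p \<and> snd p \<le> fst p} (z, y) \<partial>lborel) =
     (\<lambda>z. \<integral>\<^sup>+ y\<in>{0..z}. ennreal (exp (claim_rate m * y)) * (\<Sum>i\<in>UNIV. ennreal (pmf (restart m) i) * W i y) \<partial>lborel)"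
    by (intro ext nn_integral_cong) (auto simp: indicator_def)
  finally show ?thesis using None by (simp add: with_absorbing_def[abs_def])
qed (simp add: with_absorbing_def[abs_def])

text \<open>The component of the absorbing state is the expected value after a claim and a restart:
  the claim density at \<open>z - u\<close> factors into a function of \<open>z\<close> and
  \<open>exp (claim_rate m * u)\<close>. The density vanishes for \<open>u > z\<close>, and
  \<open>W\<close> vanishes for \<open>u < 0\<close>.\<close>

lemma claim_convolution:
  assumes [measurable]: "\<And>j. W j \<in> borel_measurable borel" and neg: "\<And>j y. y < 0 \<Longrightarrow> W j y = 0"
  shows "(\<integral>\<^sup>+ r. \<integral>\<^sup>+ y. W r (z - y) \<partial>exp_measure (claim_rate m) \<partial>measure_pmf (restart m)) = with_absorbing m W None z"
proof -
  let ?b = "claim_rate m"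
  have 1: "(\<integral>\<^sup>+ y. W r (z - y) \<partial>exp_measure ?b) = (\<integral>\<^sup>+ u. ennreal (?b * exp (- ?b * z)) * (ennreal (exp (?b * u)) * W r u * indicator {0..z} u) \<partial>lborel)" for r
  proof -
    have "(\<integral>\<^sup>+ y. W r (z - y) \<partial>exp_measure ?b) = (\<integral>\<^sup>+ y. ennreal (exponential_density ?b y) * W r (z - y) \<partial>lborel)"
      unfolding exp_measure_def by (rule nn_integral_density) auto
    also have "\<dots> = (\<integral>\<^sup>+ u. ennreal (exponential_density ?b (z - u)) * W r u \<partial>lborel)"
    proof -
      have "(\<lambda>y. ennreal (exponential_density ?b y) * W r (z - y)) \<in> borel_measurable borel" by measurable
      from nn_integral_real_affine[OF this, of "-1" z] show ?thesis by simp
    qed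
    also have "\<dots> = (\<integral>\<^sup>+ u. ennreal (?b * exp (- ?b * z)) * (ennreal (exp (?b * u)) * W r u * indicator {0..z} u) \<partial>lborel)"
    proof (rule nn_integral_cong)
      fix u
      show "ennreal (exponential_density ?b (z - u)) * W r u = ennreal (?b * exp (- ?b * z)) * (ennreal (exp (?b * u)) * W r u * indicator {0..z} u)"
      proof (cases "u \<in> {0..z}")
        case True
        have "exponential_density ?b (z - u) = (?b * exp (- ?b * z)) * exp (?b * u)"
          using True by (simp add: exponential_density_def exp_add[symmetric] algebra_simps)
        then show ?thesis using True claim_rate_pos by (simp add: ennreal_mult mult.assoc)
      next
        case False
        then show ?thesis using neg[of u r] by (cases "u < 0") (auto simp: exponential_density_def)
      qed
    qed
    finally show ?thesis .
  qed
  have "(\<integral>\<^sup>+ r. \<integral>\<^sup>+ y. W r (z - y) \<partial>exp_measure ?b \<partial>measure_pmf (restart m)) =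
    (\<Sum>r\<in>UNIV. ennreal (pmf (restart m) r) * (\<integral>\<^sup>+ u. ennreal (?b * exp (- ?b * z)) * (ennreal (exp (?b * u)) * W r u * indicator {0..z} u) \<partial>lborel))"
    unfolding 1 by (simp add: nn_integral_measure_pmf nn_integral_count_space_finite)
  also have "\<dots> = (\<Sum>r\<in>UNIV. \<integral>\<^sup>+ u. ennreal (pmf (restart m) r) * (ennreal (?b * exp (- ?b * z)) * (ennreal (exp (?b * u)) * W r u * indicator {0..z} u)) \<partial>lborel)"
    by (intro sum.cong nn_integral_cmult[symmetric]) auto
  also have "\<dots> = (\<integral>\<^sup>+ u. (\<Sum>r\<in>UNIV. ennreal (pmf (restart m) r) * (ennreal (?b * exp (- ?b * z)) * (ennreal (exp (?b * u)) * W r u * indicator {0..z} u))) \<partial>lborel)"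
    by (intro nn_integral_sum[symmetric]) auto
  also have "\<dots> = (\<integral>\<^sup>+ u. ennreal (?b * exp (- ?b * z)) * (ennreal (exp (?b * u)) * (\<Sum>r\<in>UNIV. ennreal (pmf (restart m) r) * W r u) * indicator {0..z} u) \<partial>lborel)"
    by (intro nn_integral_cong) (auto simp: sum_distrib_left sum_distrib_right ac_simps intro!: sum.cong)
  also have "\<dots> = ennreal (?b * exp (- ?b * z)) * (\<integral>\<^sup>+ u\<in>{0..z}. ennreal (exp (?b * u)) * (\<Sum>r\<in>UNIV. ennreal (pmf (restart m) r) * W r u) \<partial>lborel)"
    by (rule nn_integral_cmult) measurable
  finally show ?thesis by (simp add: with_absorbing_def)
qed

lemma measurable_disc_hold:
  assumes [measurable]: "f \<in> borel_measurable borel"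
  shows "(\<lambda>d. disc f (ereal (hold i d))) \<in> borel_measurable DM"
  unfolding disc_def by (rule lborel.borel_measurable_nn_integral) measurable

lemma measurable_post:
  assumes [measurable]: "f \<in> borel_measurable borel"
  shows "post i x f \<in> borel_measurable DM"
  unfolding post_def by measurable

lemma measurable_at_post:
  assumes [measurable]: "f \<in> borel_measurable borel" and W: "\<And>j. W j \<in> borel_measurable borel"
  shows "(\<lambda>d. W (succ_phase i d) (post i x f d)) \<in> borel_measurable DM"
  by (rule measurable_compose_countable'[of _ "\<lambda>j d. W j (post i x f d)", OF measurable_compose[OF measurable_post W] measurable_succ_phase])
     auto

text \<open>Up to the first jump \<open>D\<close> is the deterministic \<open>f\<close>, so the
  integrand depends on the first driver alone. At a claim, integrating out restart phase and claim
  size turns the value after the jump into the absorbing component; at a change of phase the two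
  integrands agree.\<close>

lemma first_jump_value_eq:
  assumes adm: "admissible m i x D" and init: "initial i D f"
    and W: "\<And>j. W j \<in> borel_measurable (restrict_space borel {0..})"
  shows "first_jump_value m W i x D = (\<integral>\<^sup>+ d. payoff i x f W d \<partial>DM)"
proof -
  have f [measurable]: "f \<in> borel_measurable borel" using init by (simp add: initial_def)
  note Wp = measurable_pos_part[OF W]
  let ?WA = "with_absorbing m (pos_part W)"
  note [measurable] = measurable_with_absorbing[OF Wp] measurable_disc_hold[OF f] measurable_at_post[OF f Wp]
  let ?z = "\<lambda>d. x + premium m * hold i d - f (hold i d)"
  let ?A = "\<lambda>d. disc f (ereal (hold i d))" and ?e = "\<lambda>d. ennreal (exp (- discount m * hold i d))"
  have [measurable]: "(\<lambda>d. ?WA (target d i) (?z d)) \<in> borel_measurable DM"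
    by (rule measurable_compose_countable'[OF _ measurable_target_apply]) auto
  have "first_jump_value m W i x D = (\<integral>\<^sup>+ \<omega>. (\<lambda>d. ?A d + ?e d * ?WA (target d i) (?z d)) (shd \<omega>) \<partial>P)"
    unfolding first_jump_value_def
  proof (rule nn_integral_cong_AE)
    note admissible_path_ok[OF adm]
    moreover have "before_jump i (\<lambda>t \<omega>. D t \<omega> = f t)" using init by (simp add: initial_def)
    ultimately show "AE \<omega> in P. (let \<tau> = jump_time m i \<omega> 1 in discounted_dividends m D (ereal \<tau>) \<omega> +
        ennreal (exp (- discount m * \<tau>)) * with_absorbing m W (absorbing_chain i \<omega> 1) (x + premium m * \<tau> - D \<tau> \<omega>)) =
      (\<lambda>d. ?A d + ?e d * ?WA (target d i) (?z d)) (shd \<omega>)"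
      using AE_good_parts
    proof eventually_elim
      case (elim \<omega>')
      then obtain d \<omega> where w: "\<omega>' = d ## \<omega>" "good_driver d" "good \<omega>" by blast
      have ok: "path_ok i x (\<lambda>t. D t \<omega>') (d ## \<omega>)" using elim(1) by (simp add: w)
      have \<tau>: "0 \<le> hold i d" using good_driver_hold[OF w(2), of i] by simp
      have eq: "\<And>t. 0 \<le> t \<Longrightarrow> t \<le> hold i d \<Longrightarrow> D t \<omega>' = f t" using elim(2) by (simp add: w)
      have "discounted_dividends m D (ereal (hold i d)) \<omega>' = disc (\<lambda>t. D t \<omega>') (ereal (hold i d))"
        using path_ok_regular[OF ok] \<tau> by (intro discounted_dividends_eq_disc) auto
      also have "\<dots> = disc f (ereal (hold i d))"
        using eq \<tau> by (intro disc_cong) auto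
      finally have 1: "discounted_dividends m D (ereal (hold i d)) \<omega>' = disc f (ereal (hold i d))" .
      \<comment> \<open>The surplus just before a claim is nonnegative, so \<open>W\<close> and
        \<open>pos_part W\<close> give the same value.\<close>
      have "0 \<le> ?z d" using surplus_at_jump[OF w(2,3) ok] eq[OF \<tau>] by simp
      then have "with_absorbing m W (target d i) (?z d) = ?WA (target d i) (?z d)" by (rule with_absorbing_pos_part)
      moreover have "jump_time m i \<omega>' 1 = hold i d" by (simp add: w jump_time_Stream)
      moreover have "absorbing_chain i \<omega>' 1 = target d i" by (simp add: w)
      ultimately show ?case using 1 eq[OF \<tau>] by (simp add: Let_def w)
    qed
  qed
  also have "\<dots> = (\<integral>\<^sup>+ d. ?A d + ?e d * ?WA (target d i) (?z d) \<partial>DM)"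
    by (rule nn_integral_P_shd) measurable
  also have "\<dots> = (\<integral>\<^sup>+ d. ?A d + ?e d * pos_part W (succ_phase i d) (post i x f d) \<partial>DM)"
  proof (subst (1 2) nn_integral_DM, measurable, rule nn_integral_cong, rule nn_integral_cong)
    fix e and g :: "'n \<Rightarrow> 'n option"
    let ?E = "exp_measure (claim_rate m)" and ?R = "measure_pmf (restart m)"
    interpret E: prob_space ?E by (rule prob_space_exp_measure[OF claim_rate_pos])
    note E1 = E.emeasure_space_1[unfolded space_exp_measure]
    let ?h = "e / exit_rate m i"
    let ?z = "x + premium m * ?h - f ?h" and ?A = "disc f (ereal ?h)" and ?k = "ennreal (exp (- discount m * ?h))"
    have h: "hold i (e, g, r, y) = ?h" "target (e, g, r, y) i = g i" for r y
      by (simp_all add: hold_def unit_time_def target_def)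
    have "(\<integral>\<^sup>+ r. \<integral>\<^sup>+ y. ?A + ?k * ?WA (g i) ?z \<partial>?E \<partial>?R) = (\<integral>\<^sup>+ r. \<integral>\<^sup>+ y. ?A + ?k *
         pos_part W (succ_phase i (e, g, r, y)) (post i x f (e, g, r, y)) \<partial>?E \<partial>?R)"
    proof (cases "g i")
      case None
      have p: "succ_phase i (e, g, r, y) = r" "post i x f (e, g, r, y) = ?z - y" for r y
        using None by (simp_all add: succ_phase_def post_def loss_def h restart_phase_def claim_size_def)
      have "(\<integral>\<^sup>+ y. ?A + ?k * pos_part W r (?z - y) \<partial>?E) = ?A + ?k * (\<integral>\<^sup>+ y. pos_part W r (?z - y) \<partial>?E)" for r
      proof -
        have [measurable]: "(\<lambda>y. pos_part W r (?z - y)) \<in> borel_measurable ?E"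
          using measurable_compose[OF _ Wp, of "\<lambda>y. ?z - y" borel] by (simp cong: measurable_cong_sets)
        have "(\<integral>\<^sup>+ y. ?A + ?k * pos_part W r (?z - y) \<partial>?E) = (\<integral>\<^sup>+ y. ?A \<partial>?E) + (\<integral>\<^sup>+ y. ?k * pos_part W r (?z - y) \<partial>?E)"
          by (rule nn_integral_add) measurable
        also have "(\<integral>\<^sup>+ y. ?k * pos_part W r (?z - y) \<partial>?E) = ?k * (\<integral>\<^sup>+ y. pos_part W r (?z - y) \<partial>?E)"
          by (rule nn_integral_cmult) measurable
        finally show ?thesis by (simp add: E1)
      qed
      then have "(\<integral>\<^sup>+ r. \<integral>\<^sup>+ y. ?A + ?k * pos_part W r (?z - y) \<partial>?E \<partial>?R) =
          ?A + ?k * (\<integral>\<^sup>+ r. \<integral>\<^sup>+ y. pos_part W r (?z - y) \<partial>?E \<partial>?R)"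
        by (simp add: nn_integral_add nn_integral_cmult)
      also have "(\<integral>\<^sup>+ r. \<integral>\<^sup>+ y. pos_part W r (?z - y) \<partial>?E \<partial>?R) = ?WA None ?z"
        by (rule claim_convolution[OF Wp]) (simp add: pos_part_def)
      finally show ?thesis unfolding p None by (simp add: E1)
    next
      case (Some j)
      then show ?thesis by (simp add: with_absorbing_def succ_phase_def post_def loss_def h)
    qed
    then show "(\<integral>\<^sup>+ r. \<integral>\<^sup>+ y. disc f (ereal (hold i (e, g, r, y))) + ennreal (exp (- discount m * hold i (e, g, r, y))) *
         ?WA (target (e, g, r, y) i) (x + premium m * hold i (e, g, r, y) - f (hold i (e, g, r, y))) \<partial>?E \<partial>?R)
       = (\<integral>\<^sup>+ r. \<integral>\<^sup>+ y. disc f (ereal (hold i (e, g, r, y))) + ennreal (exp (- discount m * hold i (e, g, r, y))) *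
         pos_part W (succ_phase i (e, g, r, y)) (post i x f (e, g, r, y)) \<partial>?E \<partial>?R)"
      unfolding h .
  qed
  finally show ?thesis by (simp add: pos_part_def)
qed

lemma val_0:
  assumes ok: "AE \<omega> in P. path_ok i x (\<lambda>t. D t \<omega>) \<omega>"
  shows "val i x D 0 = 0"
proof -
  have "val i x D 0 = (\<integral>\<^sup>+ \<omega>. 0 \<partial>P)"
    unfolding val_def
  proof (rule nn_integral_cong_AE)
    from ok show "AE \<omega> in P. paid i x D 0 \<omega> = 0"
    proof eventually_elim
      case (elim \<omega>)
      have "min (ruin i x (\<lambda>t. D t \<omega>) \<omega>) (horizon i \<omega> 0) = 0"
        using ruin_nonneg[of i x "\<lambda>t. D t \<omega>" \<omega>] by (simp add: horizon_def zero_enat_def zero_ereal_def min_def)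
      moreover have "stop 0 s = 0" for s by (cases "0 \<le> s") (auto simp: stop_def min_def zero_ereal_def)
      ultimately show ?case using path_ok_regular[OF elim] by (simp add: disc_def regular_path_def)
    qed
  qed
  then show ?thesis by simp
qed

text \<open>Each first driver has its own continuation. Comparing the integrals pointwise requires
  no measurability in the driver, so the induction hypothesis is applied driver by driver.\<close>

lemma val_le_supersolution:
  assumes W: "\<And>j. W j \<in> borel_measurable (restrict_space borel {0..})"
    and super: "\<And>j y. 0 \<le> y \<Longrightarrow> first_jump_sup m W j y \<le> W j y"
    and "0 \<le> x" "admissible m i x D"
  shows "val i x D (enat n) \<le> W i x"
  using assms(3,4)
proof (induction n arbitrary: i x D)
  case 0
  then show ?case by (simp add: val_0 admissible_iff flip: zero_enat_def)
next
  case (Suc n)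
  from initial_ex[OF Suc.prems(2)] obtain f where f: "initial i D f" ..
  have "val i x D (enat (Suc n)) = (\<integral>\<^sup>+ d. payoff i x f (\<lambda>j y. val j y (continuation i D f d) (enat n)) d \<partial>DM)"
    using val_first_jump[OF Suc.prems(2) f, of "enat n"] by (simp add: eSuc_enat)
  also have "\<dots> \<le> (\<integral>\<^sup>+ d. payoff i x f W d \<partial>DM)"
  proof (rule nn_integral_mono_AE)
    from AE_continuation[OF Suc.prems(2) f]
    show "AE d in DM. payoff i x f (\<lambda>j y. val j y (continuation i D f d) (enat n)) d \<le>
      payoff i x f W d"
      by eventually_elim (auto intro!: add_left_mono mult_left_mono Suc.IH)
  qed
  also have "\<dots> = first_jump_value m W i x D" by (rule first_jump_value_eq[OF Suc.prems(2) f W, symmetric])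
  also have "\<dots> \<le> first_jump_sup m W i x" unfolding first_jump_sup_def using Suc.prems by (intro SUP_upper) simp
  also have "\<dots> \<le> W i x" by (rule super[OF Suc.prems(1)])
  finally show ?case .
qed

lemma optimal_value_le_supersolution:
  assumes W: "\<And>j. W j \<in> borel_measurable (restrict_space borel {0..})"
    and super: "\<And>j y. 0 \<le> y \<Longrightarrow> first_jump_sup m W j y \<le> W j y"
    and "0 \<le> x"
  shows "optimal_value m i x \<le> W i x"
  unfolding optimal_value_def
proof (rule SUP_least, clarify)
  fix D assume adm: "admissible m i x D"
  show "strategy_value m i x D \<le> W i x"
    unfolding strategy_value_eq_val[OF adm] val_SUP[OF adm]
    by (rule SUP_least) (rule val_le_supersolution[OF W super assms(3) adm])
qed

section \<open>Finiteness, monotonicity and measurability of the optimal value\<close>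

lemma val_le_optimal: "admissible m i x D \<Longrightarrow> val i x D \<infinity> \<le> optimal_value m i x"
  unfolding optimal_value_def by (subst strategy_value_eq_val[symmetric]) (auto intro: SUP_upper)

text \<open>Strictly before ruin the surplus is nonnegative and claims only reduce it;
  left-continuity gives the bound at the ruin time as well.\<close>

lemma path_ok_le_linear:
  assumes g: "good \<omega>" and ok: "path_ok i x a \<omega>" and t: "0 \<le> x" "0 \<le> t" "ereal t \<le> ruin i x a \<omega>"
  shows "a t \<le> x + premium m * t"
proof -
  have lt: "a s \<le> x + premium m * s" if "0 \<le> s" "ereal s < ruin i x a \<omega>" for s
  proof (rule ccontr)
    assume "\<not> ?thesis"
    then have "x + premium m * s - total_claims m i s \<omega> - a s < 0" using total_claims_nonneg[OF g, of i s] by simp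
    then have "ruin i x a \<omega> \<le> ereal s" unfolding ruin_def using that by (intro Inf_lower) auto
    with that show False by simp
  qed
  show ?thesis
  proof (cases "t = 0")
    case True then show ?thesis using path_ok_regular[OF ok] t by (simp add: regular_path_def)
  next
    case False
    with t have "0 < t" by simp
    then show ?thesis
    proof (rule left_limit_le_linear[OF path_ok_regular[OF ok]])
      fix s assume s: "0 \<le> s" "s < t"
      then have "ereal s < ruin i x a \<omega>" using less_le_trans[OF _ t(3), of "ereal s"] by simp
      with s show "a s \<le> x + premium m * s" by (intro lt)
    qed
  qed
qed

definition value_const :: real where "value_const = 4 * premium m / discount m"

lemma val_le_linear:
  assumes adm: "admissible m i x D" and "0 \<le> x"
  shows "val i x D \<infinity> \<le> ennreal (x + value_const)"
proof -
  have "val i x D \<infinity> \<le> (\<integral>\<^sup>+ \<omega>. ennreal (x + value_const) \<partial>P)"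
    unfolding val_def
  proof (rule nn_integral_mono_AE)
    from AE_good admissible_path_ok[OF adm] show "AE \<omega> in P. paid i x D \<infinity> \<omega> \<le> ennreal (x + value_const)"
    proof eventually_elim
      case (elim \<omega>)
      then show ?case
        using assms(2) path_ok_le_linear[OF elim assms(2)] unfolding value_const_def
        by (intro disc_le_linear) (auto simp: ruin_nonneg horizon_def)
    qed
  qed
  then show ?thesis using P.emeasure_space_1 by simp
qed

lemma optimal_value_le_linear: "0 \<le> x \<Longrightarrow> optimal_value m i x \<le> ennreal (x + value_const)"
  unfolding optimal_value_def
  by (rule SUP_least) (auto simp: strategy_value_eq_val intro: val_le_linear)

lemma optimal_value_finite: "0 \<le> x \<Longrightarrow> optimal_value m i x < \<infinity>"
  using optimal_value_le_linear[of x i] by (auto simp: less_top[symmetric] top_unique)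

text \<open>Pays \<open>h\<close> at once and then follows \<open>D\<close>; since a strategy is 0
  at time 0 and left-continuous, the payment shows for \<open>t > 0\<close> only. With
  \<open>h\<close> more initial capital the surplus after time 0 is the one under \<open>D\<close>,
  which compares the values at different surpluses.\<close>

definition lump :: "real \<Rightarrow> 'n strategy \<Rightarrow> 'n strategy" where
  "lump h D t \<omega> = D t \<omega> + (if 0 < t then h else 0)"

lemma total_claims_0: "good \<omega> \<Longrightarrow> total_claims m i 0 \<omega> = 0"
  using num_jumps_eq[of \<omega> i 0 0] jump_time_pos[of \<omega> "Suc 0" i] by (simp add: total_claims_def)

lemma path_ok_lump:
  assumes g: "good \<omega>" and ok: "path_ok i x a \<omega>" and h: "0 \<le> h" "0 \<le> x"
  shows "path_ok i (x + h) (\<lambda>t. a t + (if 0 < t then h else 0)) \<omega>"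
  unfolding path_ok_def
proof (intro conjI allI impI)
  note reg = path_ok_regular[OF ok]
  show "regular_path (\<lambda>t. a t + (if 0 < t then h else 0))"
    unfolding regular_path_def
  proof (intro conjI allI impI)
    show "a 0 + (if (0::real) < 0 then h else 0) = 0" using reg by (simp add: regular_path_def)
    show "mono_on {0..} (\<lambda>t. a t + (if 0 < t then h else 0))"
      unfolding mono_on_def
    proof (intro allI impI, elim conjE)
      fix r s :: real assume "r \<in> {0..}" "s \<in> {0..}" "r \<le> s"
      then show "a r + (if 0 < r then h else 0) \<le> a s + (if 0 < s then h else 0)"
        using h by (intro add_mono regular_path_mono[OF reg]) auto
    qed
    fix t :: real assume t: "0 < t"
    have "((\<lambda>s. a s + h) \<longlongrightarrow> a t + h) (at_left t)" by (intro tendsto_intros regular_path_lim[OF reg t])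
    moreover have "\<forall>\<^sub>F s in at_left t. a s + h = a s + (if 0 < s then h else 0)"
      using t by (auto simp: eventually_at_left[OF t])
    ultimately have "((\<lambda>s. a s + (if 0 < s then h else 0)) \<longlongrightarrow> a t + h) (at_left t)"
      by (rule Lim_transform_eventually)
    then show "continuous (at_left t) (\<lambda>t. a t + (if 0 < t then h else 0))" using t by (simp add: continuous_within)
  qed
  fix t :: real assume t: "0 \<le> t" and c: "\<forall>k. claim_jump i \<omega> k \<and> jump_time m i \<omega> (Suc k) \<le> t \<longrightarrow>
    0 \<le> x + h + premium m * jump_time m i \<omega> (Suc k) - total_claims m i (jump_time m i \<omega> (Suc k)) \<omega> -
      (a (jump_time m i \<omega> (Suc k)) + (if 0 < jump_time m i \<omega> (Suc k) then h else 0))"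
  have "a t \<le> x + premium m * t - total_claims m i t \<omega>"
  proof (rule ok[unfolded path_ok_def, THEN conjunct2, rule_format, OF t])
    fix k assume "claim_jump i \<omega> k \<and> jump_time m i \<omega> (Suc k) \<le> t"
    with c jump_time_pos[OF g, of "Suc k" i]
    show "0 \<le> x + premium m * jump_time m i \<omega> (Suc k) - total_claims m i (jump_time m i \<omega> (Suc k)) \<omega> - a (jump_time m i \<omega> (Suc k))"
      by fastforce
  qed
  then show "a t + (if 0 < t then h else 0) \<le> x + h + premium m * t - total_claims m i t \<omega>"
    using h by auto
qed

lemma ruin_lump:
  assumes g: "good \<omega>" and a: "a 0 = 0" and h: "0 \<le> h" "0 \<le> x"
  shows "ruin i (x + h) (\<lambda>t. a t + (if 0 < t then h else 0)) \<omega> = ruin i x a \<omega>"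
proof -
  have eq: "x + h + premium m * t - total_claims m i t \<omega> - (a t + (if 0 < t then h else 0)) < 0 \<longleftrightarrow>
    x + premium m * t - total_claims m i t \<omega> - a t < 0" if "0 \<le> t" for t
    \<comment> \<open>At time 0 the lump sum is not yet deducted, but both surpluses are nonnegative
      then.\<close>
    using that h total_claims_0[OF g] a by (cases "t = 0") auto
  show ?thesis unfolding ruin_def
    by (intro arg_cong[of _ _ Inf] Collect_cong ex_cong1 conj_cong refl eq)
qed

lemma admissible_lump:
  assumes adm: "admissible m i x D" and h: "0 \<le> h" "0 \<le> x"
  shows "admissible m i (x + h) (lump h D)"
  unfolding admissible_iff
proof
  have [measurable]: "(\<lambda>(t, \<omega>). D t \<omega>) \<in> borel_measurable (PR i)" "fst \<in> borel_measurable (PR i)"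
    using adm measurable_PR_fst by (simp_all add: admissible_iff)
  have "(\<lambda>p. (\<lambda>(t, \<omega>). D t \<omega>) p + (if 0 < fst p then h else 0)) \<in> borel_measurable (PR i)" by measurable
  then show "(\<lambda>(t, \<omega>). lump h D t \<omega>) \<in> borel_measurable (PR i)" by (simp add: lump_def case_prod_beta')
  from AE_good admissible_path_ok[OF adm] show "AE \<omega> in P. path_ok i (x + h) (\<lambda>t. lump h D t \<omega>) \<omega>"
    unfolding lump_def by eventually_elim (rule path_ok_lump[OF _ _ h])
qed

lemma val_lump:
  assumes adm: "admissible m i x D" and h: "0 \<le> h" "0 \<le> x"
  shows "val i x D n \<le> val i (x + h) (lump h D) n"
  unfolding val_def
proof (rule nn_integral_mono_AE)
  from AE_good admissible_path_ok[OF adm] show "AE \<omega> in P. paid i x D n \<omega> \<le>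
    disc (\<lambda>t. lump h D t \<omega>) (min (ruin i (x + h) (\<lambda>t. lump h D t \<omega>) \<omega>) (horizon i \<omega> n))"
  proof eventually_elim
    case (elim \<omega>)
    have "ruin i (x + h) (\<lambda>t. lump h D t \<omega>) \<omega> = ruin i x (\<lambda>t. D t \<omega>) \<omega>"
      unfolding lump_def using path_ok_regular[OF elim(2)] h by (intro ruin_lump elim) (auto simp: regular_path_def)
    then show ?case using h horizon_nonneg[OF elim(1)] ruin_nonneg by (auto intro!: disc_mono simp: lump_def)
  qed
qed

lemma optimal_value_mono:
  assumes "0 \<le> x" "x \<le> y"
  shows "optimal_value m i x \<le> optimal_value m i y"
proof -
  have "strategy_value m i x D \<le> optimal_value m i y" if adm: "admissible m i x D" for D
  proof -
    have "strategy_value m i x D \<le> val i (x + (y - x)) (lump (y - x) D) \<infinity>"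
      unfolding strategy_value_eq_val[OF adm] using assms by (intro val_lump adm) auto
    also have "\<dots> \<le> optimal_value m i (x + (y - x))"
      using assms by (intro val_le_optimal admissible_lump adm) auto
    finally show ?thesis by simp
  qed
  then show ?thesis by (subst optimal_value_def) (auto intro: SUP_least)
qed

text \<open>A supremum over uncountably many strategies need not be measurable; here monotonicity in
  the surplus settles the matter.\<close>

lemma measurable_optimal_value: "optimal_value m i \<in> borel_measurable (restrict_space borel {0..})"
proof -
  have "mono_on {0..} (\<lambda>x. enn2real (optimal_value m i x))"
    using optimal_value_mono optimal_value_finite by (auto simp: mono_on_def intro!: enn2real_mono)
  then have "(\<lambda>x. ennreal (enn2real (optimal_value m i x))) \<in> borel_measurable (restrict_space borel {0..})"
    by (intro measurable_compose[OF borel_measurable_mono_on_fnc measurable_ennreal])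
  moreover have "ennreal (enn2real (optimal_value m i x)) = optimal_value m i x" if "x \<in> space (restrict_space borel {0..})" for x
    using that optimal_value_finite[of x i] by (simp add: space_restrict_space)
  ultimately show ?thesis by (rule measurable_cong[THEN iffD1, rotated])
qed

lemma optimal_value_le_first_jump_sup:
  "optimal_value m i x \<le> first_jump_sup m (optimal_value m) i x"
  unfolding optimal_value_def[of m i x]
proof (rule SUP_least, clarify)
  fix D assume adm: "admissible m i x D"
  from initial_ex[OF adm] obtain f where f: "initial i D f" ..
  have "strategy_value m i x D = (\<integral>\<^sup>+ d. payoff i x f (\<lambda>j y. val j y (continuation i D f d) \<infinity>) d \<partial>DM)"
    using val_first_jump[OF adm f, of \<infinity>] by (simp add: strategy_value_eq_val[OF adm])
  also have "\<dots> \<le> (\<integral>\<^sup>+ d. payoff i x f (optimal_value m) d \<partial>DM)"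
  proof (rule nn_integral_mono_AE)
    from AE_continuation[OF adm f]
    show "AE d in DM. payoff i x f (\<lambda>j y. val j y (continuation i D f d) \<infinity>) d \<le>
      payoff i x f (optimal_value m) d"
      by eventually_elim (auto intro!: add_left_mono mult_left_mono val_le_optimal)
  qed
  also have "\<dots> = first_jump_value m (optimal_value m) i x D"
    by (rule first_jump_value_eq[OF adm f measurable_optimal_value, symmetric])
  also have "\<dots> \<le> first_jump_sup m (optimal_value m) i x"
    unfolding first_jump_sup_def using adm by (intro SUP_upper) simp
  finally show "strategy_value m i x D \<le> first_jump_sup m (optimal_value m) i x" .
qed

section \<open>Phase-wise barrier strategies\<close>

lemma regular_path_cong:
  assumes eq: "\<And>t. 0 \<le> t \<Longrightarrow> a t = b t"
  shows "regular_path a \<longleftrightarrow> regular_path b"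
proof -
  have "continuous (at_left t) a \<longleftrightarrow> continuous (at_left t) b" if t: "0 < t" for t
  proof -
    have "\<forall>\<^sub>F s in at_left t. a s = b s"
      using eq t by (auto simp: eventually_at_left[OF t])
    then have "(a \<longlongrightarrow> b t) (at_left t) \<longleftrightarrow> (b \<longlongrightarrow> b t) (at_left t)" by (rule tendsto_cong)
    then show ?thesis using eq[of t] t by (simp add: continuous_within)
  qed
  moreover have "mono_on {0..} a \<longleftrightarrow> mono_on {0..} b" using eq by (simp add: mono_on_def)
  ultimately show ?thesis using eq[of 0] by (auto simp: regular_path_def)
qed

lemma path_ok_cong:
  assumes g: "good \<omega>" and eq: "\<And>t. 0 \<le> t \<Longrightarrow> a t = b t"
  shows "path_ok i x a \<omega> \<longleftrightarrow> path_ok i x b \<omega>"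
  unfolding path_ok_def using regular_path_cong[OF eq] eq jump_time_nonneg[OF g, of i] by auto

lemma ruin_cong:
  assumes eq: "\<And>t. 0 \<le> t \<Longrightarrow> a t = b t"
  shows "ruin i x a \<omega> = ruin i x b \<omega>"
  unfolding ruin_def by (intro arg_cong[of _ _ Inf] Collect_cong ex_cong1 conj_cong refl) (simp add: eq)

lemma val_cong:
  assumes ae: "AE \<omega> in P. \<forall>t\<ge>0. D t \<omega> = E t \<omega>"
  shows "val i x D n = val i x E n"
  unfolding val_def
proof (rule nn_integral_cong_AE)
  from AE_good ae show "AE \<omega> in P. paid i x D n \<omega> =
    paid i x E n \<omega>"
  proof eventually_elim
    case (elim \<omega>)
    have eq: "ruin i x (\<lambda>t. D t \<omega>) \<omega> = ruin i x (\<lambda>t. E t \<omega>) \<omega>" by (rule ruin_cong) (use elim in simp)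
    show ?case unfolding eq
      by (rule disc_cong) (use elim horizon_nonneg ruin_nonneg in auto)
  qed
qed

text \<open>\<open>barrier_state\<close> for arbitrary jump data: inserting the cut data gives a predictable process.\<close>

primrec run_barrier :: "('n \<Rightarrow> real) \<Rightarrow> real \<Rightarrow> (nat \<Rightarrow> real) \<Rightarrow> (nat \<Rightarrow> 'n) \<Rightarrow> (nat \<Rightarrow> real) \<Rightarrow> nat \<Rightarrow> real \<times> real" where
  "run_barrier b x T p y 0 = (x, 0)"
| "run_barrier b x T p y (Suc k) =
    (let (u, d) = run_barrier b x T p y k; h = T (Suc k) - T k; a = barrier_payment m (b (p k)) u h
     in if u < 0 then (u, d) else (u + premium m * h - a - y k, d + a))"

lemma barrier_state_eq: "barrier_state m b i x \<omega> k = run_barrier b x (jump_time m i \<omega>) (phase_chain i \<omega>) (claim_at i \<omega>) k"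
  by (induction k) simp_all

lemma run_barrier_cong:
  assumes "\<And>l. l \<le> k \<Longrightarrow> T l = T' l" "\<And>l. l < k \<Longrightarrow> p l = p' l" "\<And>l. l < k \<Longrightarrow> y l = y' l"
  shows "run_barrier b x T p y k = run_barrier b x T' p' y' k"
  using assms
proof (induction k)
  case (Suc k)
  have "T k = T' k" "T (Suc k) = T' (Suc k)" "p k = p' k" "y k = y' k" using Suc.prems by auto
  moreover have "run_barrier b x T p y k = run_barrier b x T' p' y' k" using Suc by simp
  ultimately show ?case by (simp only: run_barrier.simps)
qed simp

lemma measurable_barrier_payment:
  fixes p :: "'z \<Rightarrow> 'n"
  assumes [measurable]: "p \<in> M \<rightarrow>\<^sub>M count_space UNIV" "u \<in> borel_measurable M" "h \<in> borel_measurable M"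
  shows "(\<lambda>z. barrier_payment m (b (p z)) (u z) (h z)) \<in> borel_measurable M"
proof -
  have [measurable]: "(\<lambda>z. b (p z)) \<in> borel_measurable M" for b :: "'n \<Rightarrow> real"
    by (rule measurable_compose[OF assms(1)]) simp
  show ?thesis unfolding barrier_payment_def by measurable
qed

lemma measurable_run_barrier:
  assumes T [measurable]: "\<And>k. (\<lambda>z. T z k) \<in> borel_measurable M"
    and p: "\<And>k. (\<lambda>z. p z k) \<in> M \<rightarrow>\<^sub>M count_space UNIV"
    and y [measurable]: "\<And>k. (\<lambda>z. y z k) \<in> borel_measurable M"
  shows "(\<lambda>z. fst (run_barrier b x (T z) (p z) (y z) k)) \<in> borel_measurable M"
    "(\<lambda>z. snd (run_barrier b x (T z) (p z) (y z) k)) \<in> borel_measurable M"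
proof -
  have "(\<lambda>z. fst (run_barrier b x (T z) (p z) (y z) k)) \<in> borel_measurable M \<and>
    (\<lambda>z. snd (run_barrier b x (T z) (p z) (y z) k)) \<in> borel_measurable M"
  proof (induction k)
    case (Suc k)
    let ?u = "\<lambda>z. fst (run_barrier b x (T z) (p z) (y z) k)" and ?d = "\<lambda>z. snd (run_barrier b x (T z) (p z) (y z) k)"
    have [measurable]: "?u \<in> borel_measurable M" "?d \<in> borel_measurable M" using Suc by auto
    let ?a = "\<lambda>z. barrier_payment m (b (p z k)) (?u z) (T z (Suc k) - T z k)"
    have [measurable]: "?a \<in> borel_measurable M" by (rule measurable_barrier_payment[OF p]) measurable
    have "fst (run_barrier b x (T z) (p z) (y z) (Suc k)) = (if ?u z < 0 then ?u z else ?u z + premium m * (T z (Suc k) - T z k) - ?a z - y z k)"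
      "snd (run_barrier b x (T z) (p z) (y z) (Suc k)) = (if ?u z < 0 then ?d z else ?d z + ?a z)" for z
      by (simp_all add: Let_def split: prod.split)
    then show ?case by (simp del: run_barrier.simps)
  qed simp
  then show "(\<lambda>z. fst (run_barrier b x (T z) (p z) (y z) k)) \<in> borel_measurable M"
    "(\<lambda>z. snd (run_barrier b x (T z) (p z) (y z) k)) \<in> borel_measurable M" by auto
qed

text \<open>The number \<open>k\<close> of jumps is a separate argument, so that measurability can
  be checked for each fixed \<open>k\<close> and then composed with a random one.\<close>

definition pay_barrier :: "('n \<Rightarrow> real) \<Rightarrow> real \<Rightarrow> real \<Rightarrow> nat \<Rightarrow> (nat \<Rightarrow> real) \<Rightarrow> (nat \<Rightarrow> 'n) \<Rightarrow> (nat \<Rightarrow> real) \<Rightarrow> real" where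
  "pay_barrier b x t k T p y = (if t \<le> 0 then 0
     else snd (run_barrier b x T p y k) + barrier_payment m (b (p k)) (fst (run_barrier b x T p y k)) (t - T k))"

lemma measurable_pay_barrier:
  assumes T [measurable]: "\<And>k. (\<lambda>z. T z k) \<in> borel_measurable M"
    and p: "\<And>k. (\<lambda>z. p z k) \<in> M \<rightarrow>\<^sub>M count_space UNIV"
    and y: "\<And>k. (\<lambda>z. y z k) \<in> borel_measurable M"
    and t [measurable]: "t \<in> borel_measurable M" and N: "N \<in> M \<rightarrow>\<^sub>M count_space UNIV"
  shows "(\<lambda>z. pay_barrier b x (t z) (N z) (T z) (p z) (y z)) \<in> borel_measurable M"
proof -
  note [measurable] = measurable_run_barrier[OF T p y, of b x]
  have [measurable]: "(\<lambda>z. barrier_payment m (b (p z k)) (fst (run_barrier b x (T z) (p z) (y z) k)) (t z - T z k)) \<in> borel_measurable M" for k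
    by (rule measurable_barrier_payment[OF p]) measurable
  have "(\<lambda>z. pay_barrier b x (t z) k (T z) (p z) (y z)) \<in> borel_measurable M" for k
    unfolding pay_barrier_def by measurable
  then show ?thesis by (rule measurable_compose_countable'[OF _ N]) simp
qed

abbreviation strict_jumps :: "'n \<Rightarrow> real \<Rightarrow> 'n driver stream \<Rightarrow> nat" where
  "strict_jumps i t \<omega> \<equiv> card {k. 0 < k \<and> jump_time m i \<omega> k < t}"

lemma phasewise_barrier_eq:
  "phasewise_barrier m b i x t \<omega> = pay_barrier b x t (strict_jumps i t \<omega>) (jump_time m i \<omega>) (phase_chain i \<omega>) (claim_at i \<omega>)"
  by (simp add: phasewise_barrier_def pay_barrier_def barrier_state_eq Let_def split: prod.split)

lemma measurable_JM_snd: "f \<in> S0 \<rightarrow>\<^sub>M N \<Longrightarrow> (\<lambda>p. f (snd p)) \<in> JM \<rightarrow>\<^sub>M N"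
  by (rule measurable_compose[OF measurable_snd measurable_P_S0])

text \<open>The amount paid by time \<open>t\<close> depends only on jumps strictly before
  \<open>t\<close>, where cut and true data agree. A single claim is recovered as the increase of
  the accumulated claims between successive histories. The agreement is almost sure, so joint
  measurability of the strategy is shown separately.\<close>

lemma predictable_phasewise_barrier:
  "(\<lambda>(t, \<omega>). phasewise_barrier m b i x t \<omega>) \<in> borel_measurable (PR i)"
proof -
  let ?N = "\<lambda>p. strict_jumps i (fst p) (snd p)"
  note [measurable] = measurable_PR_fst PR_past measurable_cut_time
  have h [measurable]: "(\<lambda>p. fst (cut_hist i k p)) \<in> PR i \<rightarrow>\<^sub>M count_space UNIV"
    "(\<lambda>p. snd (snd (cut_hist i k p))) \<in> borel_measurable (PR i)" for k
    by (rule measurable_compose[OF measurable_cut_hist], measurable)+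
  let ?p = "\<lambda>p k. fst (cut_hist i k p)" and ?y = "\<lambda>p k. snd (snd (cut_hist i (Suc k) p)) - snd (snd (cut_hist i k p))"
  let ?T = "\<lambda>p k. cut_time i k p"
  have "(\<lambda>p. pay_barrier b x (fst p) (?N p) (?T p) (?p p) (?y p)) \<in> borel_measurable (PR i)"
    by (rule measurable_pay_barrier) measurable
  then have "(\<lambda>p. (\<lambda>(t, \<omega>). phasewise_barrier m b i x t \<omega>) p) \<in> borel_measurable (PR i)"
  proof (rule measurable_PR_AE)
    have [measurable]: "Measurable.pred JM (\<lambda>p. jump_time m i (snd p) k < fst p)" for k
    proof -
      have [measurable]: "(\<lambda>p. jump_time m i (snd p) k) \<in> borel_measurable JM" by (rule measurable_JM_snd) simp
      show ?thesis by measurable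
    qed
    have "(\<lambda>p. pay_barrier b x (fst p) (?N p) (jump_time m i (snd p)) (phase_chain i (snd p)) (claim_at i (snd p))) \<in> borel_measurable JM"
    proof (rule measurable_pay_barrier)
      show "(\<lambda>p. jump_time m i (snd p) k) \<in> borel_measurable JM" for k by (rule measurable_JM_snd) simp
      show "(\<lambda>p. phase_chain i (snd p) k) \<in> JM \<rightarrow>\<^sub>M count_space UNIV" for k by (rule measurable_JM_snd) simp
      show "(\<lambda>p. claim_at i (snd p) k) \<in> borel_measurable JM" for k by (rule measurable_JM_snd) simp
    qed measurable
    then show "(\<lambda>p. (\<lambda>(t, \<omega>). phasewise_barrier m b i x t \<omega>) p) \<in> borel_measurable JM"
      by (simp add: phasewise_barrier_eq case_prod_beta')
    show "AE \<omega> in P. \<forall>t\<ge>0. pay_barrier b x (fst (t, \<omega>)) (?N (t, \<omega>)) (?T (t, \<omega>)) (?p (t, \<omega>)) (?y (t, \<omega>)) =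
      (\<lambda>(t, \<omega>). phasewise_barrier m b i x t \<omega>) (t, \<omega>)"
      using AE_good
    proof eventually_elim
      case (elim \<omega>)
      show ?case
      proof (intro allI impI)
        fix t :: real assume "0 \<le> t"
        show "pay_barrier b x (fst (t, \<omega>)) (?N (t, \<omega>)) (?T (t, \<omega>)) (?p (t, \<omega>)) (?y (t, \<omega>)) =
          (\<lambda>(t, \<omega>). phasewise_barrier m b i x t \<omega>) (t, \<omega>)"
        proof (cases "t = 0")
          case False
          with \<open>0 \<le> t\<close> have "0 < t" by simp
          from jump_interval_ex_strict[OF elim this] obtain k where k: "jump_time m i \<omega> k < t" "t \<le> jump_time m i \<omega> (Suc k)" by blast
          have N: "strict_jumps i t \<omega> = k" by (rule num_jumps_strict_eq[OF elim k])
          have lt: "jump_time m i \<omega> l < t" if "l \<le> k" for l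
            using strict_mono_less_eq[OF strict_mono_jump_time[OF elim], of i l k] that k by simp
          have e: "run_barrier b x (?T (t, \<omega>)) (?p (t, \<omega>)) (?y (t, \<omega>)) k = run_barrier b x (jump_time m i \<omega>) (phase_chain i \<omega>) (claim_at i \<omega>) k"
            using lt by (intro run_barrier_cong) (auto simp: cut_time_def cut_hist_def hist_def)
          have e': "?T (t, \<omega>) k = jump_time m i \<omega> k" "?p (t, \<omega>) k = phase_chain i \<omega> k"
            using lt[of k] by (auto simp: cut_time_def cut_hist_def hist_def)
          show ?thesis unfolding phasewise_barrier_eq pay_barrier_def fst_conv snd_conv prod.case N e e' ..
        qed (simp add: pay_barrier_def phasewise_barrier_def)
      qed
    qed
  qed
  then show ?thesis by simp
qed

section \<open>The barrier strategy along a single path\<close>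

context
  fixes b :: "'n \<Rightarrow> real" and i :: 'n and x :: real and \<omega> :: "'n driver stream"
  assumes g: "good \<omega>"
begin

private abbreviation "T \<equiv> jump_time m i \<omega>"
private abbreviation "u k \<equiv> fst (barrier_state m b i x \<omega> k)"
private abbreviation "dv k \<equiv> snd (barrier_state m b i x \<omega> k)"
private abbreviation "pay k h \<equiv> barrier_payment m (b (phase_chain i \<omega> k)) (u k) h"
private abbreviation "B t \<equiv> phasewise_barrier m b i x t \<omega>"

lemma barrier_at: "T k < t \<Longrightarrow> t \<le> T (Suc k) \<Longrightarrow> B t = dv k + pay k (t - T k)"
  using num_jumps_strict_eq[OF g, of i k t] jump_time_nonneg[OF g, of i k]
  by (simp add: phasewise_barrier_def split: prod.split)

lemma barrier_state_Suc:
  "u (Suc k) = (if u k < 0 then u k else u k + premium m * (T (Suc k) - T k) - pay k (T (Suc k) - T k) - claim_at i \<omega> k)"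
  "dv (Suc k) = dv k + pay k (T (Suc k) - T k)"
  by (simp_all add: Let_def barrier_payment_def split: prod.split)

lemma T_Suc: "T k < T (Suc k)"
  using strict_mono_jump_time[OF g] by (simp add: strict_mono_Suc_iff)

lemma barrier_at_jump: "B (T k) = dv k"
proof (cases k)
  case 0 then show ?thesis by (simp add: phasewise_barrier_def)
next
  case (Suc l)
  then show ?thesis using barrier_at[of l "T k"] T_Suc[of l] barrier_state_Suc(2)[of l] by (simp del: barrier_state.simps)
qed

lemma pay_mono: "h \<le> h' \<Longrightarrow> pay k h \<le> pay k h'"
  using premium_pos by (auto simp: barrier_payment_def max_def intro: order_trans)

lemma pay_nonneg: "0 \<le> pay k h"
  by (simp add: barrier_payment_def)

lemma dv_mono: "k \<le> l \<Longrightarrow> dv k \<le> dv l"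
proof (induction l rule: dec_induct)
  case (step n)
  then show ?case using pay_nonneg[of n "T (Suc n) - T n"] unfolding barrier_state_Suc by linarith
qed simp

lemma regular_barrier: "regular_path B"
  unfolding regular_path_def
proof (intro conjI allI impI)
  show "B 0 = 0" by (simp add: phasewise_barrier_def)
  have nn: "0 \<le> B t" if "0 \<le> t" for t
  proof (cases "t = 0")
    case False
    with that have "0 < t" by simp
    from jump_interval_ex_strict[OF g this] obtain k where "T k < t" "t \<le> T (Suc k)" by blast
    then show ?thesis using barrier_at[of k t] pay_nonneg dv_mono[of 0 k] by simp
  qed (simp add: phasewise_barrier_def)
  show "mono_on {0..} B"
  proof (rule mono_onI)
    fix r s :: real assume rs: "r \<in> {0..}" "s \<in> {0..}" "r \<le> s"
    show "B r \<le> B s"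
    proof (cases "r = 0")
      case True then show ?thesis using nn[of s] rs by (simp add: phasewise_barrier_def)
    next
      case False
      with rs have r: "0 < r" "0 < s" by auto
      from jump_interval_ex_strict[OF g r(1)] obtain k where k: "T k < r" "r \<le> T (Suc k)" by blast
      from jump_interval_ex_strict[OF g r(2)] obtain l where l: "T l < s" "s \<le> T (Suc l)" by blast
      have "T k < T (Suc l)" using k l rs by linarith
      then have "k \<le> l" using strict_mono_less[OF strict_mono_jump_time[OF g]] by auto
      show ?thesis
      proof (cases "k = l")
        case True
        show ?thesis unfolding barrier_at[OF k] barrier_at[OF l] True
          using rs(3) by (intro add_left_mono pay_mono) simp
      next
        case False
        have "B r \<le> dv (Suc k)"
          using k pay_mono[of "r - T k" "T (Suc k) - T k" k] unfolding barrier_at[OF k] barrier_state_Suc by simp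
        also have "\<dots> \<le> dv l" using False \<open>k \<le> l\<close> by (intro dv_mono) simp
        also have "\<dots> \<le> B s" using l pay_nonneg[of l] by (simp add: barrier_at)
        finally show ?thesis .
      qed
    qed
  qed
  fix t :: real assume t: "0 < t"
  from jump_interval_ex_strict[OF g t] obtain k where k: "T k < t" "t \<le> T (Suc k)" by blast
  have "((\<lambda>s. dv k + pay k (s - T k)) \<longlongrightarrow> dv k + pay k (t - T k)) (at_left t)"
    unfolding barrier_payment_def by (cases "u k < 0") (auto intro!: tendsto_intros)
  moreover have "\<forall>\<^sub>F s in at_left t. dv k + pay k (s - T k) = B s"
    using k by (auto simp: eventually_at_left[OF k(1)] barrier_at intro!: exI[of _ "T k"])
  ultimately have "(B \<longlongrightarrow> dv k + pay k (t - T k)) (at_left t)" by (rule Lim_transform_eventually)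
  then show "continuous (at_left t) B" by (simp add: continuous_within barrier_at[OF k])
qed

lemma total_claims_at_jump: "T k \<le> t \<Longrightarrow> t < T (Suc k) \<Longrightarrow> total_claims m i t \<omega> = (\<Sum>l<k. claim_at i \<omega> l)"
  using num_jumps_eq[OF g, of i k t] by (simp add: total_claims_def)

text \<open>As long as no claim has exceeded the surplus, the recursion is not frozen and its first
  component is the true surplus. Between jumps the payment leaves the smaller of the available
  surplus and the barrier, which is nonnegative.\<close>

lemma path_ok_barrier:
  assumes b: "\<And>j. 0 \<le> b j" and x: "0 \<le> x"
  shows "path_ok i x B \<omega>"
  unfolding path_ok_def
proof (intro conjI allI impI regular_barrier)
  fix t :: real assume t: "0 \<le> t"
    and c: "\<forall>k. claim_jump i \<omega> k \<and> T (Suc k) \<le> t \<longrightarrow>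
      0 \<le> x + premium m * T (Suc k) - total_claims m i (T (Suc k)) \<omega> - B (T (Suc k))"
  have inv: "0 \<le> u k \<and> u k = x + premium m * T k - (\<Sum>l<k. claim_at i \<omega> l) - dv k" if "T k \<le> t" for k
    using that
  proof (induction k)
    case 0 then show ?case using x by simp
  next
    case (Suc k)
    then have IH: "0 \<le> u k" "u k = x + premium m * T k - (\<Sum>l<k. claim_at i \<omega> l) - dv k" using T_Suc[of k] by auto
    have eq: "u (Suc k) = x + premium m * T (Suc k) - (\<Sum>l<Suc k. claim_at i \<omega> l) - dv (Suc k)"
      unfolding barrier_state_Suc using IH by (simp add: algebra_simps)
    have "0 \<le> u (Suc k)"
    proof (cases "claim_jump i \<omega> k")
      case True
      then have "0 \<le> x + premium m * T (Suc k) - total_claims m i (T (Suc k)) \<omega> - B (T (Suc k))" using c Suc.prems by blast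
      then show ?thesis
        unfolding eq barrier_at_jump total_claims_at_jump[OF order_refl T_Suc] .
    next
      case False
      then have "u (Suc k) = u k + premium m * (T (Suc k) - T k) - max 0 (u k + premium m * (T (Suc k) - T k) - b (phase_chain i \<omega> k))"
        unfolding barrier_state_Suc using IH(1) by (simp add: claim_at_def barrier_payment_def)
      moreover have "0 \<le> premium m * (T (Suc k) - T k)" using premium_pos T_Suc[of k] by simp
      ultimately show ?thesis using IH(1) b[of "phase_chain i \<omega> k"] by (simp only: max_def) (auto split: if_splits)
    qed
    with eq show ?case by blast
  qed
  obtain k where k: "T k \<le> t" "t < T (Suc k)" using jump_interval_ex[OF g t] by blast
  note tot = total_claims_at_jump[OF k]
  show "B t \<le> x + premium m * t - total_claims m i t \<omega>"
  proof (cases "T k = t")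
    case True
    then show ?thesis using inv[OF k(1)] barrier_at_jump[of k] tot by (simp del: barrier_state.simps)
  next
    case False
    with k have lt: "T k < t" by simp
    have "0 \<le> premium m * (t - T k)" using premium_pos lt by simp
    then have "B t \<le> dv k + u k + premium m * (t - T k)"
      using inv[OF k(1)] b[of "phase_chain i \<omega> k"] k(2) unfolding barrier_at[OF lt less_imp_le[OF k(2)]]
      by (auto simp: barrier_payment_def max_def)
    then show ?thesis using inv[OF k(1)] tot by (simp add: algebra_simps)
  qed
qed

end

lemma admissible_phasewise_barrier:
  assumes "\<And>j. 0 \<le> b j" "0 \<le> x"
  shows "admissible m i x (phasewise_barrier m b i x)"
  unfolding admissible_iff
proof
  show "AE \<omega> in P. path_ok i x (\<lambda>t. phasewise_barrier m b i x t \<omega>) \<omega>"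
    using AE_good by eventually_elim (rule path_ok_barrier[OF _ assms])
qed (rule predictable_phasewise_barrier)

section \<open>Restart of the barrier strategy at the first jump\<close>

definition first_barrier :: "('n \<Rightarrow> real) \<Rightarrow> 'n \<Rightarrow> real \<Rightarrow> real \<Rightarrow> real" where
  "first_barrier b i x t = (if t \<le> 0 then 0 else max 0 (x + premium m * t - b i))"

text \<open>Stationarity of the recursion. It also covers ruin at the first jump, where both states
  stay frozen at the same negative surplus.\<close>

lemma barrier_state_Stream:
  assumes "0 \<le> x" "good_driver d"
  shows "barrier_state m b i x (d ## \<omega>) (Suc k) =
    (fst (barrier_state m b (succ_phase i d) (post i x (first_barrier b i x) d) \<omega> k),
     first_barrier b i x (hold i d) + snd (barrier_state m b (succ_phase i d) (post i x (first_barrier b i x) d) \<omega> k))"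
proof (induction k)
  case 0
  show ?case using assms good_driver_hold[OF assms(2), of i]
    by (simp add: jump_time_1 claim_at_Stream Let_def barrier_payment_def first_barrier_def post_def)
next
  case (Suc k)
  obtain u' d' where S: "barrier_state m b (succ_phase i d) (post i x (first_barrier b i x) d) \<omega> k = (u', d')" by fastforce
  from Suc have S': "barrier_state m b i x (d ## \<omega>) (Suc k) = (u', first_barrier b i x (hold i d) + d')" by (simp only: S fst_conv snd_conv)
  show ?case
    unfolding barrier_state.simps(2)[of m b i x "d ## \<omega>" "Suc k"] barrier_state.simps(2)[of m b "succ_phase i d" _ \<omega> k] S S'
    by (simp add: Let_def jump_time_Stream phase_chain_Stream claim_at_Stream del: phase_chain.simps barrier_state.simps)
qed

lemma phasewise_barrier_first:
  assumes "0 \<le> x" "good_driver d" "good \<omega>" "0 \<le> t" "t \<le> hold i d"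
  shows "phasewise_barrier m b i x t (d ## \<omega>) = first_barrier b i x t"
proof (cases "t = 0")
  case False
  then have "phasewise_barrier m b i x t (d ## \<omega>) = barrier_payment m (b i) x t"
    using barrier_at[OF good_StreamI[OF assms(2,3)], of i 0 t b x] assms by (simp add: jump_time_Stream)
  then show ?thesis using assms False by (simp add: first_barrier_def barrier_payment_def)
qed (simp add: phasewise_barrier_def first_barrier_def)

lemma phasewise_barrier_after:
  assumes "0 \<le> x" "good_driver d" "good \<omega>" "0 \<le> t"
  shows "phasewise_barrier m b i x (hold i d + t) (d ## \<omega>) =
    first_barrier b i x (hold i d) + phasewise_barrier m b (succ_phase i d) (post i x (first_barrier b i x) d) t \<omega>"
proof (cases "t = 0")
  case True
  then show ?thesis using phasewise_barrier_first[OF assms(1-3), of "hold i d" i b] good_driver_hold[OF assms(2), of i]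
    by (simp add: phasewise_barrier_def[of m b "succ_phase i d"])
next
  case False
  with assms have "0 < t" by simp
  from jump_interval_ex_strict[OF assms(3) this] obtain k where
    k: "jump_time m (succ_phase i d) \<omega> k < t" "t \<le> jump_time m (succ_phase i d) \<omega> (Suc k)" by blast
  have "phasewise_barrier m b i x (hold i d + t) (d ## \<omega>) =
    snd (barrier_state m b i x (d ## \<omega>) (Suc k)) + barrier_payment m (b (phase_chain i (d ## \<omega>) (Suc k)))
     (fst (barrier_state m b i x (d ## \<omega>) (Suc k))) (hold i d + t - jump_time m i (d ## \<omega>) (Suc k))"
    using k by (intro barrier_at[OF good_StreamI[OF assms(2,3)]]) (simp_all add: jump_time_Stream)
  then show ?thesis
    unfolding barrier_state_Stream[OF assms(1,2)] phase_chain_Stream jump_time_Stream barrier_at[OF assms(3) k]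
    by simp
qed

lemma measurable_first_barrier: "first_barrier b i x \<in> borel_measurable borel"
  unfolding first_barrier_def by measurable

lemma initial_phasewise_barrier:
  assumes "0 \<le> x"
  shows "initial i (phasewise_barrier m b i x) (first_barrier b i x)"
  unfolding initial_def
proof (intro conjI measurable_first_barrier)
  from AE_good_parts show "before_jump i (\<lambda>t \<omega>. phasewise_barrier m b i x t \<omega> = first_barrier b i x t)"
    by eventually_elim (auto simp: phasewise_barrier_first[OF assms])
qed

lemma val_continuation_barrier:
  assumes "0 \<le> x" "good_driver d"
  shows "val j y (continuation i (phasewise_barrier m b i x) (first_barrier b i x) d) n =
    val j y (phasewise_barrier m b (succ_phase i d) (post i x (first_barrier b i x) d)) n"
proof (rule val_cong)
  show "AE \<omega> in P. \<forall>t\<ge>0. continuation i (phasewise_barrier m b i x) (first_barrier b i x) d t \<omega> =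
    phasewise_barrier m b (succ_phase i d) (post i x (first_barrier b i x) d) t \<omega>"
    using AE_good by eventually_elim (simp add: continuation_def phasewise_barrier_after[OF assms])
qed

end

section \<open>Pasting strategies at the first jump\<close>

text \<open>The range of \<open>g\<close> is cut into bands of height \<open>e\<close>. A point that
  is the least one of its band is among countably many such points. Otherwise a rational lies
  between it and a smaller point of the band, and by monotonicity \<open>g\<close> there is at least
  the lower edge of the band.\<close>

lemma countable_rounding:
  fixes g :: "real \<Rightarrow> real"
  assumes mono: "mono_on {0..} g" and nn: "\<And>y. 0 \<le> y \<Longrightarrow> 0 \<le> g y" and e: "0 < e"
  shows "\<exists>Q :: nat \<Rightarrow> real. (\<forall>n. 0 \<le> Q n) \<and> (\<forall>y\<ge>0. \<exists>n. Q n \<le> y \<and> g y \<le> g (Q n) + e)"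
proof -
  let ?Z = "\<lambda>k::nat. {y. 0 \<le> y \<and> real k * e \<le> g y \<and> g y < (real k + 1) * e}"
  define min_pt where "min_pt k z \<longleftrightarrow> z \<in> ?Z k \<and> (\<forall>y\<in>?Z k. z \<le> y)" for k z
  \<comment> \<open>The default 0 for a band without a least point only keeps the chosen points
    nonnegative.\<close>
  define mn where "mn k = (if \<exists>z. min_pt k z then SOME z. min_pt k z else 0)" for k
  have mn: "min_pt k (mn k)" if "min_pt k z" for k z
  proof -
    from that have "\<exists>z. min_pt k z" ..
    then show ?thesis using someI_ex[of "min_pt k"] by (simp add: mn_def)
  qed
  have mn0: "0 \<le> mn k" for k
  proof (cases "\<exists>z. min_pt k z")
    case True
    then obtain z where "min_pt k z" ..
    from mn[OF this] show ?thesis by (simp add: min_pt_def)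
  qed (simp add: mn_def)
  define S where "S = (\<rat> \<inter> {0..}) \<union> range mn"
  have "countable S" "S \<noteq> {}" unfolding S_def by (auto intro: countable_Int1 countable_rat)
  then have S: "range (from_nat_into S) = S" by (rule range_from_nat_into[rotated])
  show ?thesis
  proof (intro exI[of _ "from_nat_into S"] conjI allI impI)
    fix n have "from_nat_into S n \<in> S" using S by blast
    then show "0 \<le> from_nat_into S n" using mn0 by (auto simp: S_def)
  next
    fix y :: real assume y: "0 \<le> y"
    define k where "k = nat \<lfloor>g y / e\<rfloor>"
    have "real k \<le> g y / e" "g y / e < real k + 1"
      unfolding k_def using nn[OF y] e by (auto simp: of_nat_nat)
    then have yZ: "y \<in> ?Z k" using y e by (simp add: field_simps)
    have "\<exists>q\<in>S. q \<le> y \<and> g y \<le> g q + e"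
    proof (cases "min_pt k y")
      case True
      then have "min_pt k (mn k)" by (rule mn)
      then have "mn k \<le> y" "real k * e \<le> g (mn k)" using yZ by (auto simp: min_pt_def)
      then show ?thesis using yZ by (intro bexI[of _ "mn k"]) (auto simp: S_def algebra_simps)
    next
      case False
      with yZ obtain y' where y': "y' \<in> ?Z k" "y' < y" unfolding min_pt_def by (meson not_le)
      from Rats_dense_in_real[OF y'(2)] obtain q where q: "q \<in> \<rat>" "y' < q" "q < y" by auto
      have "g y' \<le> g q" using mono y' q by (auto simp: mono_on_def)
      then show ?thesis using yZ y' q by (intro bexI[of _ q]) (auto simp: S_def algebra_simps)
    qed
    then obtain q where q: "q \<in> S" "q \<le> y \<and> g y \<le> g q + e" by blast
    from q(1) have "q \<in> range (from_nat_into S)" by (simp only: S)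
    then obtain n where "q = from_nat_into S n" ..
    with q(2) show "\<exists>n. from_nat_into S n \<le> y \<and> g y \<le> g (from_nat_into S n) + e" by blast
  qed
qed

text \<open>One half of additivity, with no measurability of \<open>u\<close>: for a simple function
  below \<open>u + v\<close>, its difference with \<open>v\<close> is measurable and lies below
  \<open>u\<close>. It serves for continuation values as functions of the first driver.\<close>

lemma nn_integral_add_le:
  assumes v [measurable]: "v \<in> borel_measurable M" and fin: "\<And>x. v x \<noteq> \<top>"
  shows "(\<integral>\<^sup>+ x. u x + v x \<partial>M) \<le> (\<integral>\<^sup>+ x. u x \<partial>M) + (\<integral>\<^sup>+ x. v x \<partial>M)"
  unfolding nn_integral_def[of M "\<lambda>x. u x + v x"]
proof (rule SUP_least, clarify)
  fix s assume s: "simple_function M s" "s \<le> (\<lambda>x. u x + v x)"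
  have [measurable]: "s \<in> borel_measurable M" using s(1) by (rule borel_measurable_simple_function)
  have "integral\<^sup>S M s = (\<integral>\<^sup>+ x. s x \<partial>M)" using s(1) by (rule nn_integral_eq_simple_integral[symmetric])
  also have "\<dots> \<le> (\<integral>\<^sup>+ x. (s x - v x) + v x \<partial>M)"
  proof (rule nn_integral_mono)
    fix x show "s x \<le> (s x - v x) + v x"
      by (cases "v x \<le> s x") (simp_all add: diff_add_cancel_ennreal add_increasing)
  qed
  also have "\<dots> = (\<integral>\<^sup>+ x. s x - v x \<partial>M) + (\<integral>\<^sup>+ x. v x \<partial>M)"
    by (rule nn_integral_add) measurable
  also have "(\<integral>\<^sup>+ x. s x - v x \<partial>M) \<le> (\<integral>\<^sup>+ x. u x \<partial>M)"
    using s(2) fin by (intro nn_integral_mono) (auto simp: le_fun_def ennreal_minus_le_iff add.commute)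
  finally show "integral\<^sup>S M s \<le> (\<integral>\<^sup>+ x. u x \<partial>M) + (\<integral>\<^sup>+ x. v x \<partial>M)"
    by (simp add: add_right_mono)
qed

context risk_process
begin

text \<open>Converse of \<open>path_ok_shift\<close>. If the first jump ruins, the path is constant
  from then on, and the budget clause is vacuous because that claim has left a negative
  surplus.\<close>

lemma path_ok_join:
  assumes g: "good_driver d" "good \<omega>" and ok: "path_ok i x a0 (d ## \<omega>)"
    and eq: "\<And>t. 0 \<le> t \<Longrightarrow> t \<le> hold i d \<Longrightarrow> a t = a0 t"
    and pos: "0 \<le> post i x a d \<Longrightarrow> path_ok (succ_phase i d) (post i x a d) (shift_path (hold i d) a) \<omega>"
    and neg: "post i x a d < 0 \<Longrightarrow> (\<And>t. 0 \<le> t \<Longrightarrow> a (hold i d + t) = a (hold i d))"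
  shows "path_ok i x a (d ## \<omega>)"
proof -
  let ?\<tau> = "hold i d" and ?j = "succ_phase i d" and ?y = "post i x a d"
  note reg0 = path_ok_regular[OF ok]
  have \<tau>: "0 < ?\<tau>" by (rule good_driver_hold[OF g(1)])
  have sh: "regular_path (shift_path ?\<tau> a)"
  proof (cases "0 \<le> ?y")
    case True then show ?thesis using pos path_ok_regular by blast
  next
    case False
    then have "shift_path ?\<tau> a t = 0" if "0 \<le> t" for t using neg that by simp
    moreover have "regular_path (\<lambda>_. 0)" by (simp add: regular_path_def mono_on_def)
    ultimately show ?thesis using regular_path_cong[of "shift_path ?\<tau> a" "\<lambda>_. 0"] by blast
  qed
  have after: "a t = a ?\<tau> + shift_path ?\<tau> a (t - ?\<tau>)" for t by simp
  show ?thesis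
    unfolding path_ok_def
  proof (intro conjI allI impI)
    show "regular_path a"
      unfolding regular_path_def
    proof (intro conjI allI impI)
      show "a 0 = 0" using eq[of 0] \<tau> reg0 by (simp add: regular_path_def)
      have before: "a r \<le> a s" if "0 \<le> r" "r \<le> s" "s \<le> ?\<tau>" for r s
        using regular_path_mono[OF reg0, of r s] eq that by simp
      have later: "a r \<le> a s" if "?\<tau> \<le> r" "r \<le> s" for r s
        using regular_path_mono[OF sh, of "r - ?\<tau>" "s - ?\<tau>"] that by simp
      show "mono_on {0..} a"
      proof (rule mono_onI)
        fix r s :: real assume "r \<in> {0..}" "s \<in> {0..}" "r \<le> s"
        then show "a r \<le> a s"
          using before[of r s] later[of r s] before[of r ?\<tau>] later[of ?\<tau> s]
          by (cases "s \<le> ?\<tau>"; cases "?\<tau> \<le> r") auto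
      qed
      fix t :: real assume t: "0 < t"
      show "continuous (at_left t) a"
      proof (cases "t \<le> ?\<tau>")
        case True
        have "\<forall>\<^sub>F s in at_left t. a0 s = a s"
          using eq t True by (auto simp: eventually_at_left[OF t])
        with regular_path_lim[OF reg0 t] have "(a \<longlongrightarrow> a0 t) (at_left t)" by (rule Lim_transform_eventually)
        then show ?thesis using eq[of t] t True by (simp add: continuous_within)
      next
        case False
        then have "continuous (at_left (- ?\<tau> + t)) (shift_path ?\<tau> a)" using sh by (simp add: regular_path_def)
        from continuous_shift[OF this] have "continuous (at_left t) (\<lambda>s. a ?\<tau> + shift_path ?\<tau> a (- ?\<tau> + s))"
          by (intro continuous_add continuous_const)
        then show ?thesis by simp
      qed
    qed
    fix t :: real assume t: "0 \<le> t" and c: "\<forall>k. claim_jump i (d ## \<omega>) k \<and> jump_time m i (d ## \<omega>) (Suc k) \<le> t \<longrightarrow>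
      0 \<le> x + premium m * jump_time m i (d ## \<omega>) (Suc k) - total_claims m i (jump_time m i (d ## \<omega>) (Suc k)) (d ## \<omega>) - a (jump_time m i (d ## \<omega>) (Suc k))"
    show "a t \<le> x + premium m * t - total_claims m i t (d ## \<omega>)"
    proof (cases "t < ?\<tau>")
      case True
      then show ?thesis using surplus_before[OF g ok t] eq[OF t] total_claims_before[OF g t True] by simp
    next
      case False
      define s where "s = t - ?\<tau>"
      have s: "0 \<le> s" "t = ?\<tau> + s" using False by (auto simp: s_def)
      \<comment> \<open>At a claim this is the premise of the budget clause for the first jump. At a
        change of phase nothing is lost, and the surplus before the jump is nonnegative.\<close>
      have y: "0 \<le> ?y"
      proof (cases "target d i = None")
        case True
        with c[rule_format, of 0] s show ?thesis using surplus_shift[OF g, of 0 x i a] total_claims_0[OF g(2), of ?j]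
          by (simp add: jump_time_Stream claim_jump_Stream)
      next
        case False
        then show ?thesis using surplus_at_jump[OF g ok] eq[of ?\<tau>] \<tau> by (auto simp: post_def loss_def)
      qed
      have "shift_path ?\<tau> a s \<le> ?y + premium m * s - total_claims m ?j s \<omega>"
      proof (rule pos[OF y, unfolded path_ok_def, THEN conjunct2, rule_format, OF s(1)])
        fix k assume k: "claim_jump ?j \<omega> k \<and> jump_time m ?j \<omega> (Suc k) \<le> s"
        with c[rule_format, of "Suc k"] s
        have "0 \<le> x + premium m * (?\<tau> + jump_time m ?j \<omega> (Suc k)) - total_claims m i (?\<tau> + jump_time m ?j \<omega> (Suc k)) (d ## \<omega>) - a (?\<tau> + jump_time m ?j \<omega> (Suc k))"
          unfolding jump_time_Stream claim_jump_Stream by auto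
        then show "0 \<le> ?y + premium m * jump_time m ?j \<omega> (Suc k) - total_claims m ?j (jump_time m ?j \<omega> (Suc k)) \<omega> - shift_path ?\<tau> a (jump_time m ?j \<omega> (Suc k))"
          unfolding surplus_shift[OF g jump_time_nonneg[OF g(2)]] .
      qed
      then show ?thesis using surplus_shift[OF g s(1), of x i a] unfolding s(2) by linarith
    qed
  qed
qed

text \<open>At the jump time \<open>D\<close> is still in force: with left-continuous strategies,
  payments triggered by the jump show only later. After a ruinous jump nothing more is paid.\<close>

definition paste ::
    "'n \<Rightarrow> real \<Rightarrow> 'n strategy \<Rightarrow> (real \<Rightarrow> real) \<Rightarrow> ('n \<Rightarrow> real \<Rightarrow> 'n strategy) \<Rightarrow> 'n strategy" where
  "paste i x D f R t \<omega> =
     (let d = shd \<omega>; y = post i x f d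
      in if t \<le> hold i d then D t \<omega>
         else f (hold i d) + (if 0 \<le> y then R (succ_phase i d) y (t - hold i d) (stl \<omega>) else 0))"

text \<open>The strategy followed after the jump is one of countably many, selected through the
  measurable index \<open>N\<close>. For each fixed phase and index the pasted process is
  predictable, and composition with the countably valued selection preserves this.\<close>

lemma predictable_paste:
  assumes D: "(\<lambda>(t, \<omega>). D t \<omega>) \<in> borel_measurable (PR i)"
    and f [measurable]: "f \<in> borel_measurable borel"
    and N: "\<And>j. N j \<in> borel \<rightarrow>\<^sub>M count_space (UNIV :: nat set)"
    and E: "\<And>j n. (\<lambda>(t, \<omega>). E j n t \<omega>) \<in> borel_measurable (PR j)"
    and R: "\<And>j y. R j y = lump (y - Q j (N j y)) (E j (N j y))"
  shows "(\<lambda>(t, \<omega>). paste i x D f R t \<omega>) \<in> borel_measurable (PR i)"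
proof -
  note [measurable] = measurable_PR_fst PR_past measurable_cut_time D
  have h [measurable]: "(\<lambda>p. fst (cut_hist i 1 p)) \<in> PR i \<rightarrow>\<^sub>M count_space UNIV"
    "(\<lambda>p. snd (snd (cut_hist i 1 p))) \<in> borel_measurable (PR i)"
    by (rule measurable_compose[OF measurable_cut_hist], measurable)+
  let ?T = "cut_time i 1" and ?j = "\<lambda>p. fst (cut_hist i 1 p)"
  let ?y = "\<lambda>p. x + premium m * ?T p - f (?T p) - snd (snd (cut_hist i 1 p))"
  have y [measurable]: "?y \<in> borel_measurable (PR i)" by measurable
  have n: "(\<lambda>p. N (?j p) (?y p)) \<in> PR i \<rightarrow>\<^sub>M count_space UNIV"
    by (rule measurable_compose_countable'[of _ "\<lambda>j p. N j (?y p)", OF measurable_compose[OF y N] h(1)]) simp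
  define F where "F j n = (\<lambda>(t, \<omega>). if hold i (shd \<omega>) < t \<and> succ_phase i (shd \<omega>) = j
    then (\<lambda>(t, \<omega>). E j n t \<omega>) (t - hold i (shd \<omega>), stl \<omega>) else 0)" for j n
  have [measurable]: "F j n \<in> borel_measurable (PR i)" for j n unfolding F_def by (rule measurable_PR_paste[OF E])
  define A where "A j n p = f (?T p) + (if 0 \<le> ?y p then ?y p - Q j n + F j n p else 0)" for j n p
  have "A j n \<in> borel_measurable (PR i)" for j n unfolding A_def by measurable
  then have "(\<lambda>p. A j (N (?j p) (?y p)) p) \<in> borel_measurable (PR i)" for j
    by (rule measurable_compose_countable'[OF _ n]) simp
  then have [measurable]: "(\<lambda>p. A (?j p) (N (?j p) (?y p)) p) \<in> borel_measurable (PR i)"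
    by (rule measurable_compose_countable'[OF _ h(1)]) simp
  have "(\<lambda>p. if jump_time m i (snd p) 1 < fst p then A (?j p) (N (?j p) (?y p)) p else (\<lambda>(t, \<omega>). D t \<omega>) p)
    \<in> borel_measurable (PR i)" (is "?L \<in> _")
    by measurable
  also have "?L = (\<lambda>(t, \<omega>). paste i x D f R t \<omega>)"
  proof
    fix p :: "real \<times> 'n driver stream"
    obtain t \<omega> where p: "p = (t, \<omega>)" by (cases p)
    have T1: "jump_time m i \<omega> 1 = hold i (shd \<omega>)" by (simp add: jump_time_1)
    have H1: "fst (hist i \<omega> 1) = succ_phase i (shd \<omega>)" "snd (snd (hist i \<omega> 1)) = loss i (shd \<omega>)"
      by (simp_all add: hist_def succ_phase_def claim_at_def claim_jump_def loss_def split: option.split)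
    have c: "?T (t, \<omega>) = hold i (shd \<omega>)" "?j (t, \<omega>) = succ_phase i (shd \<omega>)" "?y (t, \<omega>) = post i x f (shd \<omega>)"
      if "hold i (shd \<omega>) < t"
      unfolding cut_time_def cut_hist_def snd_conv fst_conv T1 post_def using H1 that by simp_all
    show "?L p = (\<lambda>(t, \<omega>). paste i x D f R t \<omega>) p"
      using c by (simp add: p A_def F_def paste_def Let_def lump_def R T1 del: One_nat_def)
  qed
  finally show ?thesis .
qed

lemma ex_near_optimal:
  assumes "0 \<le> q" "0 < e"
  shows "\<exists>E. admissible m j q E \<and> optimal_value m j q \<le> val j q E \<infinity> + ennreal e"
proof -
  \<comment> \<open>The barrier strategy with all barriers equal to 0 shows that the supremum is not
    over the empty set.\<close>
  have ne: "{D. admissible m j q D} \<noteq> {}"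
    using admissible_phasewise_barrier[of "\<lambda>_. 0" q j] assms by auto
  have "optimal_value m j q \<noteq> \<infinity>" using optimal_value_finite[OF assms(1), of j] by simp
  from SUP_approx_ennreal[OF assms(2) ne _ this, of "strategy_value m j q"]
  obtain E where "admissible m j q E" "optimal_value m j q < strategy_value m j q E + ennreal e"
    unfolding optimal_value_def by blast
  then show ?thesis using strategy_value_eq_val by (auto intro!: exI[of _ E] simp: less_imp_le)
qed

text \<open>Having surplus \<open>y\<close>, pay out the excess of \<open>y\<close> over a grid point and follow a strategy chosen
  for that point.  Only countably many strategies are involved, so that no measurable selection is
  needed; since values increase with the surplus, a countable grid exists without any continuity.\<close>

lemma near_optimal_family:
  assumes e: "0 < e"
  obtains R :: "'n \<Rightarrow> real \<Rightarrow> 'n strategy" where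
    "\<And>i x D f. (\<lambda>(t, \<omega>). D t \<omega>) \<in> borel_measurable (PR i) \<Longrightarrow> f \<in> borel_measurable borel \<Longrightarrow>
       (\<lambda>(t, \<omega>). paste i x D f R t \<omega>) \<in> borel_measurable (PR i)"
    "AE \<omega> in P. \<forall>j y. 0 \<le> y \<longrightarrow> path_ok j y (\<lambda>t. R j y t \<omega>) \<omega>"
    "\<And>j y. 0 \<le> y \<Longrightarrow> optimal_value m j y \<le> val j y (R j y) \<infinity> + ennreal (2 * e)"
proof -
  let ?V = "optimal_value m"
  let ?g = "\<lambda>j y. enn2real (?V j y)"
  have g: "ennreal (?g j y) = ?V j y" if "0 \<le> y" for j y
    using optimal_value_finite[OF that, of j] by simp
  have "\<forall>j. \<exists>Q :: nat \<Rightarrow> real. (\<forall>n. 0 \<le> Q n) \<and> (\<forall>y\<ge>0. \<exists>n. Q n \<le> y \<and> ?g j y \<le> ?g j (Q n) + e)"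
    using optimal_value_mono optimal_value_finite e
    by (intro allI countable_rounding) (auto simp: mono_on_def intro!: enn2real_mono)
  from choice[OF this] obtain Q :: "'n \<Rightarrow> nat \<Rightarrow> real" where
    QQ: "\<forall>j. (\<forall>n. 0 \<le> Q j n) \<and> (\<forall>y\<ge>0. \<exists>n. Q j n \<le> y \<and> ?g j y \<le> ?g j (Q j n) + e)" ..
  have Q: "0 \<le> Q j n" "0 \<le> y \<Longrightarrow> \<exists>n. Q j n \<le> y \<and> ?g j y \<le> ?g j (Q j n) + e" for j n y
    using QQ[rule_format, of j] by simp_all
  have "\<forall>j. \<exists>E. \<forall>n. admissible m j (Q j n) (E n) \<and> ?V j (Q j n) \<le> val j (Q j n) (E n) \<infinity> + ennreal e"
    by (intro allI choice ex_near_optimal Q(1) e)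
  from choice[OF this] obtain E :: "'n \<Rightarrow> nat \<Rightarrow> 'n strategy" where
    E: "\<forall>j n. admissible m j (Q j n) (E j n) \<and> ?V j (Q j n) \<le> val j (Q j n) (E j n) \<infinity> + ennreal e" ..
  have adm: "admissible m j (Q j n) (E j n)" for j n using E[rule_format, of j n] by simp
  \<comment> \<open>Taking the least suitable index makes the choice measurable;
    \<open>pos_part\<close> makes the condition Borel on the whole line.\<close>
  define N where "N j y = (LEAST n. Q j n \<le> y \<and> enn2real (pos_part ?V j y) \<le> ?g j (Q j n) + e)" for j y
  note [measurable] = measurable_pos_part[OF measurable_optimal_value]
  have N: "N j \<in> borel \<rightarrow>\<^sub>M count_space UNIV" for j unfolding N_def by measurable
  define R where "R j y = lump (y - Q j (N j y)) (E j (N j y))" for j y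
  have NQ: "Q j (N j y) \<le> y" "?V j y \<le> ?V j (Q j (N j y)) + ennreal e" if y: "0 \<le> y" for j y
  proof -
    have *: "Q j (N j y) \<le> y" "?g j y \<le> ?g j (Q j (N j y)) + e"
      using LeastI_ex[OF Q(2)[OF y, of j]] y by (simp_all add: N_def pos_part_def)
    show "Q j (N j y) \<le> y" by fact
    have "ennreal (?g j y) \<le> ennreal (?g j (Q j (N j y)) + e)" using *(2) by (rule ennreal_leI)
    then show "?V j y \<le> ?V j (Q j (N j y)) + ennreal e" using g y Q(1) e by (simp add: ennreal_plus)
  qed
  show ?thesis
  proof (rule that)
    show "(\<lambda>(t, \<omega>). paste i x D f R t \<omega>) \<in> borel_measurable (PR i)"
      if "(\<lambda>(t, \<omega>). D t \<omega>) \<in> borel_measurable (PR i)" "f \<in> borel_measurable borel" for i x D f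
      using adm by (intro predictable_paste[OF that N _ R_def]) (simp add: admissible_iff)
    have "AE \<omega> in P. \<forall>j n. path_ok j (Q j n) (\<lambda>t. E j n t \<omega>) \<omega>"
      using adm by (simp add: AE_all_countable admissible_iff)
    with AE_good show "AE \<omega> in P. \<forall>j y. 0 \<le> y \<longrightarrow> path_ok j y (\<lambda>t. R j y t \<omega>) \<omega>"
    proof eventually_elim
      case (elim \<omega>)
      show ?case
      proof (intro allI impI)
        fix j and y :: real assume "0 \<le> y"
        with path_ok_lump[OF elim(1) elim(2)[rule_format, of j "N j y"], of "y - Q j (N j y)"]
        show "path_ok j y (\<lambda>t. R j y t \<omega>) \<omega>" using NQ(1) Q(1) by (simp add: R_def lump_def)
      qed
    qed
    \<comment> \<open>One \<open>e\<close> is lost by rounding the surplus down to the grid, the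
      other by near-optimality at the grid point.\<close>
    fix j and y :: real assume y: "0 \<le> y"
    let ?q = "Q j (N j y)" and ?E = "E j (N j y)"
    have "?V j y \<le> ?V j ?q + ennreal e" by (rule NQ(2)[OF y])
    also have "?V j ?q \<le> val j ?q ?E \<infinity> + ennreal e" using E by blast
    also have "val j ?q ?E \<infinity> \<le> val j y (R j y) \<infinity>"
      using val_lump[OF adm, of "y - ?q" j "N j y" \<infinity>] NQ(1)[OF y] Q(1) by (simp add: R_def)
    finally show "?V j y \<le> val j y (R j y) \<infinity> + ennreal (2 * e)"
      using e by (simp add: add.assoc add_right_mono ennreal_plus[symmetric] del: ennreal_plus)
  qed
qed

lemma first_jump_value_le_optimal:
  assumes adm: "admissible m i x D" and e: "0 < e"
  shows "first_jump_value m (optimal_value m) i x D \<le> optimal_value m i x + ennreal (2 * e)"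
proof (rule near_optimal_family[OF e])
  let ?V = "optimal_value m"
  from initial_ex[OF adm] obtain f where f: "initial i D f" ..
  then have fm: "f \<in> borel_measurable borel" by (simp add: initial_def)
  fix R :: "'n \<Rightarrow> real \<Rightarrow> 'n strategy"
  assume R_pred: "\<And>i x D f. (\<lambda>(t, \<omega>). D t \<omega>) \<in> borel_measurable (PR i) \<Longrightarrow> f \<in> borel_measurable borel \<Longrightarrow>
       (\<lambda>(t, \<omega>). paste i x D f R t \<omega>) \<in> borel_measurable (PR i)"
    and R_ok: "AE \<omega> in P. \<forall>j y. 0 \<le> y \<longrightarrow> path_ok j y (\<lambda>t. R j y t \<omega>) \<omega>"
    and R_val: "\<And>j y. 0 \<le> y \<Longrightarrow> ?V j y \<le> val j y (R j y) \<infinity> + ennreal (2 * e)"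
  \<comment> \<open>\<open>G\<close> has the same initial path \<open>f\<close> as \<open>D\<close>,
    hence the same one-step functional, while its continuations are nearly optimal.\<close>
  define G where "G = paste i x D f R"
  have G_before: "G t \<omega> = D t \<omega>" if "t \<le> hold i (shd \<omega>)" for t \<omega>
    using that by (simp add: G_def paste_def Let_def)
  have G_after: "G (hold i d + t) (d ## \<omega>) = f (hold i d) +
      (if 0 \<le> post i x f d then R (succ_phase i d) (post i x f d) t \<omega> else 0)" if "0 < t" for t d \<omega>
    using that by (simp add: G_def paste_def Let_def)
  have initG: "initial i G f"
    using f G_before by (auto simp: initial_def elim: eventually_mono)
  have shiftG: "G (hold i d + t) (d ## \<omega>) - f (hold i d) = R (succ_phase i d) (post i x f d) t \<omega>"
    if "0 \<le> t" "0 \<le> post i x f d" "G (hold i d) (d ## \<omega>) = f (hold i d)"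
      "\<forall>j y. 0 \<le> y \<longrightarrow> path_ok j y (\<lambda>t. R j y t \<omega>) \<omega>" for t d \<omega>
    using that path_ok_regular[of _ "post i x f d" "\<lambda>t. R (succ_phase i d) (post i x f d) t \<omega>" \<omega>] G_after[of t d \<omega>]
    by (cases "t = 0") (auto simp: regular_path_def)
  have admG: "admissible m i x G"
    unfolding admissible_iff
  proof
    show "(\<lambda>(t, \<omega>). G t \<omega>) \<in> borel_measurable (PR i)"
      unfolding G_def using adm by (intro R_pred fm) (simp add: admissible_iff)
    note admissible_path_ok[OF adm]
    moreover have "before_jump i (\<lambda>t \<omega>. D t \<omega> = f t)" using f by (simp add: initial_def)
    ultimately show "AE \<omega> in P. path_ok i x (\<lambda>t. G t \<omega>) \<omega>"
      using AE_good_parts AE_P_stl[OF R_ok]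
    proof eventually_elim
      case (elim \<omega>')
      from elim(3) obtain d \<omega> where w: "\<omega>' = d ## \<omega>" and g: "good_driver d" "good \<omega>" by blast
      have Gf: "G (hold i d) (d ## \<omega>) = f (hold i d)"
        using elim(2) good_driver_hold[OF g(1), of i] by (simp add: w G_before)
      have p: "post i x (\<lambda>t. G t (d ## \<omega>)) d = post i x f d" by (simp add: post_def Gf)
      have ok: "\<forall>j y. 0 \<le> y \<longrightarrow> path_ok j y (\<lambda>t. R j y t \<omega>) \<omega>" using elim(4) by (simp add: w)
      show ?case
        unfolding w
      proof (rule path_ok_join[OF g elim(1)[unfolded w]])
        show "G t (d ## \<omega>) = D t (d ## \<omega>)" if "t \<le> hold i d" for t using that by (simp add: G_before)
        show "G (hold i d + t) (d ## \<omega>) = G (hold i d) (d ## \<omega>)" if "post i x (\<lambda>t. G t (d ## \<omega>)) d < 0" "0 \<le> t" for t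
          using that G_after[of t d \<omega>] Gf unfolding p by (cases "t = 0") auto
        assume "0 \<le> post i x (\<lambda>t. G t (d ## \<omega>)) d"
        then have y: "0 \<le> post i x f d" by (simp only: p)
        show "path_ok (succ_phase i d) (post i x (\<lambda>t. G t (d ## \<omega>)) d) (shift_path (hold i d) (\<lambda>t. G t (d ## \<omega>))) \<omega>"
          unfolding p using ok y shiftG[OF _ y Gf ok] Gf by (subst path_ok_cong[OF g(2)]) auto
      qed
    qed
  qed
  have step: "AE d in DM. 0 \<le> post i x f d \<longrightarrow> ?V (succ_phase i d) (post i x f d) \<le>
      val (succ_phase i d) (post i x f d) (continuation i G f d) \<infinity> + ennreal (2 * e)"
    using AE_initial[OF admG initG]
  proof eventually_elim
    case (elim d)
    show ?case
    proof
      let ?y = "post i x f d" and ?j = "succ_phase i d"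
      assume y: "0 \<le> ?y"
      from elim have gd: "good_driver d" by simp
      have "AE \<omega> in P. \<forall>t\<ge>0. R ?j ?y t \<omega> = continuation i G f d t \<omega>"
        using elim[THEN conjunct2] R_ok
      proof eventually_elim
        case (elim \<omega>)
        have "G (hold i d) (d ## \<omega>) = f (hold i d)" using elim(1) good_driver_hold[OF gd, of i] by simp
        then show ?case using shiftG[OF _ y _ elim(2)] by (simp add: continuation_def)
      qed
      from val_cong[OF this, of ?j ?y \<infinity>] R_val[OF y, of ?j]
      show "?V ?j ?y \<le> val ?j ?y (continuation i G f d) \<infinity> + ennreal (2 * e)" by simp
    qed
  qed
  have "first_jump_value m ?V i x D = (\<integral>\<^sup>+ d. payoff i x f ?V d \<partial>DM)"
    by (rule first_jump_value_eq[OF adm f measurable_optimal_value])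
  also have "\<dots> \<le> (\<integral>\<^sup>+ d. (payoff i x f (\<lambda>j y. val j y (continuation i G f d) \<infinity>) d) + ennreal (2 * e) \<partial>DM)"
  proof (rule nn_integral_mono_AE)
    from step AE_good_driver show "AE d in DM. payoff i x f ?V d \<le>
      (payoff i x f (\<lambda>j y. val j y (continuation i G f d) \<infinity>) d) + ennreal (2 * e)"
    proof eventually_elim
      case (elim d)
      show ?case
      proof (cases "0 \<le> post i x f d")
        case True
        let ?w = "val (succ_phase i d) (post i x f d) (continuation i G f d) \<infinity>" and ?k = "ennreal (exp (- discount m * hold i d))"
        have k: "?k \<le> 1" using good_driver_hold[OF elim(2), of i] discount_pos by (simp add: ennreal_le_1)
        have "?k * ?V (succ_phase i d) (post i x f d) \<le> ?k * (?w + ennreal (2 * e))"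
          using elim(1) True by (intro mult_left_mono) auto
        also have "\<dots> = ?k * ?w + ?k * ennreal (2 * e)" by (rule distrib_left)
        also have "?k * ennreal (2 * e) \<le> 1 * ennreal (2 * e)" using k by (rule mult_right_mono) simp
        finally show ?thesis using True by (simp add: add.assoc add_left_mono)
      qed simp
    qed
  qed
  \<comment> \<open>The continuation values of \<open>G\<close> are not known to be measurable in
    \<open>d\<close>, so only the one-sided additivity is used.\<close>
  also have "\<dots> \<le> val i x G \<infinity> + (\<integral>\<^sup>+ d. ennreal (2 * e) \<partial>DM)"
    using nn_integral_add_le[of "\<lambda>_. ennreal (2 * e)" DM] val_first_jump[OF admG initG, of \<infinity>] by simp
  also have "(\<integral>\<^sup>+ d. ennreal (2 * e) \<partial>DM) = ennreal (2 * e)" using DM.emeasure_space_1 by simp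
  also have "val i x G \<infinity> \<le> optimal_value m i x" by (rule val_le_optimal[OF admG])
  finally show ?thesis by (simp add: add_right_mono)
qed

lemma first_jump_sup_eq_optimal_value:
  "optimal_value m i x = first_jump_sup m (optimal_value m) i x"
proof (rule antisym[OF optimal_value_le_first_jump_sup])
  show "first_jump_sup m (optimal_value m) i x \<le> optimal_value m i x"
    unfolding first_jump_sup_def
  proof (rule SUP_least, clarify)
    fix D assume "admissible m i x D"
    show "first_jump_value m (optimal_value m) i x D \<le> optimal_value m i x"
    proof (rule ennreal_le_epsilon)
      fix e :: real assume "0 < e"
      with first_jump_value_le_optimal[OF \<open>admissible m i x D\<close>, of "e / 2"]
      show "first_jump_value m (optimal_value m) i x D \<le> optimal_value m i x + ennreal e" by simp
    qed
  qed
qed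

lemma nonneg_solution_optimal_value: "nonneg_solution m (optimal_value m)"
  unfolding nonneg_solution_def
  using measurable_optimal_value optimal_value_finite first_jump_sup_eq_optimal_value by blast

lemma optimal_value_le_solution:
  assumes "nonneg_solution m W" "0 \<le> x"
  shows "optimal_value m i x \<le> W i x"
  using assms by (intro optimal_value_le_supersolution) (auto simp: nonneg_solution_def)

section \<open>Optimality of the phase-wise barrier strategy\<close>

lemma optimal_value_barrier_step:
  assumes D: "admissible m i x D" "barrier_until_jump m (b i) i x D"
    and att: "first_jump_value m (optimal_value m) i x D = first_jump_sup m (optimal_value m) i x"
  shows "optimal_value m i x = (\<integral>\<^sup>+ d. payoff i x (first_barrier b i x) (optimal_value m) d \<partial>DM)"
proof -
  \<comment> \<open>After the first jump \<open>D\<close> may differ from the barrier strategy, but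
    the one-step functional depends only on its initial path.\<close>
  have "initial i D (first_barrier b i x)"
    unfolding initial_def
  proof (intro conjI measurable_first_barrier)
    from D(2)[unfolded barrier_until_jump_def]
    show "before_jump i (\<lambda>t \<omega>. D t \<omega> = first_barrier b i x t)"
      by eventually_elim (auto simp: jump_time_1 first_barrier_def)
  qed
  from first_jump_value_eq[OF D(1) this measurable_optimal_value] att first_jump_sup_eq_optimal_value[of i x]
  show ?thesis by simp
qed

text \<open>The discounting is split in half. Over a holding time \<open>h\<close> the surplus grows
  by at most \<open>premium m * h\<close>, so surplus plus \<open>value_const\<close> grows at most
  by the factor \<open>exp (discount m * h / 2)\<close>. Half of the discounting cancels this
  factor, and the expectation of the other half is at most \<open>q\<close>.\<close>

lemma optimal_value_barrier_approx:
  assumes b: "\<And>j. 0 \<le> b j"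
    and att: "\<And>i x. 0 \<le> x \<Longrightarrow> \<exists>D. admissible m i x D \<and> barrier_until_jump m (b i) i x D \<and>
      first_jump_value m (optimal_value m) i x D = first_jump_sup m (optimal_value m) i x"
    and q: "0 \<le> q" "\<And>i. (\<integral>\<^sup>+ d. ennreal (exp (- (discount m / 2) * hold i d)) \<partial>DM) \<le> ennreal q"
    and x: "0 \<le> x"
  shows "optimal_value m i x \<le> val i x (phasewise_barrier m b i x) (enat n) + ennreal (q ^ n * (x + value_const))"
  using x
proof (induction n arbitrary: i x)
  case 0
  then show ?case using optimal_value_le_linear[OF 0, of i] by (simp add: add_increasing)
next
  case (Suc n)
  let ?f = "first_barrier b i x" and ?B = "phasewise_barrier m b" and ?C = value_const and ?d = "discount m"
  \<comment> \<open>The second bound makes \<open>premium m\<close> at most half of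
    \<open>discount m * value_const\<close>, which allows linear growth in \<open>h\<close> to be
    replaced by the factor \<open>1 + discount m * h / 2\<close>.\<close>
  have C: "0 \<le> ?C" "2 * premium m / ?d \<le> ?C" using premium_pos discount_pos by (simp_all add: value_const_def field_simps)
  obtain D where D: "admissible m i x D" "barrier_until_jump m (b i) i x D"
    "first_jump_value m (optimal_value m) i x D = first_jump_sup m (optimal_value m) i x" using att[OF Suc.prems, of i] by blast
  let ?u = "\<lambda>d. payoff i x ?f (\<lambda>j y. val j y (continuation i (?B i x) ?f d) (enat n)) d"
  let ?v = "\<lambda>d. ennreal (q ^ n * (x + ?C)) * ennreal (exp (- (?d / 2) * hold i d))"
  have "optimal_value m i x = (\<integral>\<^sup>+ d. payoff i x ?f (optimal_value m) d \<partial>DM)"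
    by (rule optimal_value_barrier_step[where b = b, OF D])
  also have "\<dots> \<le> (\<integral>\<^sup>+ d. ?u d + ?v d \<partial>DM)"
  proof (rule nn_integral_mono_AE)
    from AE_good_driver show "AE d in DM. payoff i x ?f (optimal_value m) d \<le> ?u d + ?v d"
    proof eventually_elim
      case (elim d)
      let ?y = "post i x ?f d" and ?j = "succ_phase i d" and ?h = "hold i d"
      show ?case
      proof (cases "0 \<le> ?y")
        case True
        have h: "0 < ?h" by (rule good_driver_hold[OF elim])
        let ?w = "val ?j ?y (continuation i (?B i x) ?f d) (enat n)" and ?k = "ennreal (exp (- ?d * ?h))"
        have "optimal_value m ?j ?y \<le> ?w + ennreal (q ^ n * (?y + ?C))"
          using Suc.IH[OF True, of ?j] val_continuation_barrier[OF Suc.prems elim, of ?j ?y i b "enat n"] by simp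
        then have "?k * optimal_value m ?j ?y \<le> ?k * (?w + ennreal (q ^ n * (?y + ?C)))"
          by (rule mult_left_mono) simp
        also have "\<dots> = ?k * ?w + ?k * ennreal (q ^ n * (?y + ?C))" by (rule distrib_left)
        also have "?k * ennreal (q ^ n * (?y + ?C)) \<le> ?v d"
        proof -
          have "0 \<le> ?f ?h" by (simp add: first_barrier_def)
          then have "?y + ?C \<le> x + premium m * ?h + ?C"
            using good_driver_loss[OF elim, of i] by (simp add: post_def)
          also have "premium m * ?h \<le> (x + ?C) * (?d * ?h / 2)"
          proof -
            have "2 * premium m / ?d \<le> x + ?C" using C Suc.prems by linarith
            then have "2 * premium m / ?d * (?d * ?h / 2) \<le> (x + ?C) * (?d * ?h / 2)"
              using h discount_pos by (intro mult_right_mono) auto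
            then show ?thesis using discount_pos by simp
          qed
          finally have "?y + ?C \<le> (x + ?C) * (1 + ?d * ?h / 2)" by (simp add: algebra_simps)
          also have "\<dots> \<le> (x + ?C) * exp (?d * ?h / 2)"
            using C Suc.prems exp_ge_add_one_self[of "?d * ?h / 2"] by (intro mult_left_mono) auto
          finally have "exp (- ?d * ?h) * (q ^ n * (?y + ?C)) \<le> exp (- ?d * ?h) * (q ^ n * ((x + ?C) * exp (?d * ?h / 2)))"
            using q(1) by (intro mult_left_mono) auto
          also have "\<dots> = q ^ n * (x + ?C) * exp (- (?d / 2) * ?h)"
          proof -
            have "exp (- ?d * ?h) * exp (?d * ?h / 2) = exp (- (?d / 2) * ?h)" by (simp add: exp_add[symmetric] algebra_simps)
            then show ?thesis by (simp add: ac_simps)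
          qed
          finally have "ennreal (exp (- ?d * ?h) * (q ^ n * (?y + ?C))) \<le> ennreal (q ^ n * (x + ?C) * exp (- (?d / 2) * ?h))"
            by (rule ennreal_leI)
          then show ?thesis using q(1) True C Suc.prems by (simp add: ennreal_mult)
        qed
        finally show ?thesis using True by (simp add: add.assoc add_left_mono)
      qed simp
    qed
  qed
  also have "\<dots> \<le> (\<integral>\<^sup>+ d. ?u d \<partial>DM) + (\<integral>\<^sup>+ d. ?v d \<partial>DM)"
    by (rule nn_integral_add_le) (measurable, simp add: ennreal_mult_eq_top_iff)
  also have "(\<integral>\<^sup>+ d. ?u d \<partial>DM) = val i x (?B i x) (enat (Suc n))"
    using val_first_jump[of i x "?B i x" ?f "enat n", OF admissible_phasewise_barrier[OF b Suc.prems] initial_phasewise_barrier[OF Suc.prems]]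
    by (simp add: eSuc_enat)
  also have "(\<integral>\<^sup>+ d. ?v d \<partial>DM) = ennreal (q ^ n * (x + ?C)) * (\<integral>\<^sup>+ d. ennreal (exp (- (?d / 2) * hold i d)) \<partial>DM)"
    by (rule nn_integral_cmult) measurable
  also have "\<dots> \<le> ennreal (q ^ n * (x + ?C)) * ennreal q" by (intro mult_left_mono q(2)) simp
  also have "\<dots> = ennreal (q ^ Suc n * (x + ?C))" using q(1) C Suc.prems by (simp add: ennreal_mult[symmetric] ac_simps)
  finally show ?case by (simp add: add_left_mono)
qed

text \<open>The truncated barrier values stay below the full one, while the remainder
  \<open>q ^ n * (x + value_const)\<close> tends to 0; this gives the inequality opposite to
  admissibility.\<close>

lemma phasewise_barrier_optimal:
  assumes b: "\<And>j. 0 \<le> b j"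
    and att: "\<And>i x. 0 \<le> x \<Longrightarrow> \<exists>D. admissible m i x D \<and> barrier_until_jump m (b i) i x D \<and>
      first_jump_value m (optimal_value m) i x D = first_jump_sup m (optimal_value m) i x"
    and x: "0 \<le> x"
  shows "strategy_value m i x (phasewise_barrier m b i x) = optimal_value m i x"
proof -
  note adm = admissible_phasewise_barrier[OF b x, of i]
  obtain q where q: "0 \<le> q" "q < 1" "\<And>i. (\<integral>\<^sup>+ d. ennreal (exp (- (discount m / 2) * hold i d)) \<partial>DM) \<le> ennreal q"
    using ex_discount_factor[of "discount m / 2"] discount_pos by auto
  have "(\<lambda>n. val i x (phasewise_barrier m b i x) \<infinity> + ennreal (q ^ n * (x + value_const))) \<longlonglongrightarrow>
    val i x (phasewise_barrier m b i x) \<infinity> + ennreal (0 * (x + value_const))"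
    using q by (intro tendsto_add tendsto_const tendsto_ennrealI tendsto_mult LIMSEQ_power_zero) auto
  moreover have "optimal_value m i x \<le> val i x (phasewise_barrier m b i x) \<infinity> + ennreal (q ^ n * (x + value_const))" for n
  proof -
    have "val i x (phasewise_barrier m b i x) (enat n) \<le> val i x (phasewise_barrier m b i x) \<infinity>"
      unfolding val_SUP[OF adm] by (rule SUP_upper) simp
    then show ?thesis
      using optimal_value_barrier_approx[OF b att q(1,3) x, of i n] by (meson add_right_mono order_trans)
  qed
  ultimately have "optimal_value m i x \<le> val i x (phasewise_barrier m b i x) \<infinity> + ennreal (0 * (x + value_const))"
    by (intro LIMSEQ_le_const) auto
  with val_le_optimal[OF adm] show ?thesis
    by (simp add: strategy_value_eq_val[OF adm] antisym)
qed

end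

theorem proposition5p3:
  fixes m :: "('n::finite) risk_model"
  assumes "CARD('n) \<ge> 3"
    and "premium m > 0" and "claim_rate m > 0" and "discount m > 0"
    and "\<And>i j. j \<noteq> Some i \<Longrightarrow> intensity m i j \<ge> 0"
    and "\<And>i. exit_rate m i > 0"
    and "\<And>i. transient m i"
  shows "(nonneg_solution m (optimal_value m) \<and>
          (\<forall>W. nonneg_solution m W \<longrightarrow> (\<forall>i. \<forall>x\<ge>0. optimal_value m i x \<le> W i x)))
       \<and> (\<forall>b :: 'n \<Rightarrow> real.
            (\<forall>i. b i \<ge> 0) \<longrightarrow>
            (\<forall>i. \<forall>x\<ge>0. \<exists>D. admissible m i x D \<and> barrier_until_jump m (b i) i x D \<and>
               first_jump_value m (optimal_value m) i x D
                 = first_jump_sup m (optimal_value m) i x) \<longrightarrow>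
            (\<forall>i. \<forall>x\<ge>0. admissible m i x (phasewise_barrier m b i x) \<and>
               strategy_value m i x (phasewise_barrier m b i x) = optimal_value m i x))"
proof -
  interpret risk_process m by unfold_locales (use assms in auto)
  show ?thesis
    using nonneg_solution_optimal_value optimal_value_le_solution admissible_phasewise_barrier phasewise_barrier_optimal
    by (intro conjI allI impI) blast+
qed

end
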